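(* Let $\varphi$ be a fixed point of $U$. Assume that $1$ is not an eigenvalue of $U'(\varphi)$, and that properties (P1) and (P2) (stated in full in the context) hold, with $r>0$ the radius and $m_0,M_1,M_2$ the constants appearing in (P2). Then $\varphi$ is an isolated fixed point of $U$. Moreover, there are $\epsilon\in\,]0,r[$ and $n_\epsilon>0$ such that, for every $n\ge n_\epsilon$, $U_n$ has a unique fixed point $\varphi_n$ in $\Omega_\epsilon(\varphi)$. Also, there is a constant $\gamma>0$ such that, for all $n\ge n_\epsilon$, $$\|\varphi-\varphi_n\|\le\gamma\big(2w_2(L,h_n)m_0+2M_1w_1(\varphi,h_n)+2M_2\,w_1(\varphi,h_n)^2\big).$$
   Context: Let $a<b$ be real numbers, and let $L^1([a,b],\mathbb{C})$ be the complex Banach space with its usual norm. $\|\cdot\|$ denotes the norm of the underlying space (including operator norms for bounded linear and bilinear maps), whatever it may be. For $\varphi\in L^1([a,b],\mathbb{C})$ and $r>0$, $\Omega_r(\varphi)$ is the open ball of $L^1([a,b],\mathbb{C})$ with center $\varphi$ and radius $r$. Operator $U$. Let $\Omega\subset L^1([a,b],\mathbb{C})$, $y\in L^1([a,b],\mathbb{C})$, let $H,L$ be complex-valued functions on $[a,b]^2$ with $H$ measurable, and let $N:\mathbb{C}\to\mathbb{C}$ be twice Fréchet-differentiable (possibly nonlinear). For $x\in\Omega$ put $$K(x)(s):=\int_a^b H(s,t)L(s,t)N(x(t))\,dt,\qquad U(x):=K(x)-y .$$ $\varphi$ denotes a fixed point of $U$, i.e. $U(\varphi)=\varphi$. Approximate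 operators. For $n\ge 1$ let $h_n:=(b-a)/n$, $t_{n,i}:=a+ih_n$ for $i=0,\dots,n$. For $x\in L^1([a,b],\mathbb{C})$ let $\pi_n(x)$ be the piecewise constant function with $\pi_n(x)(t):=\frac1{h_n}\int_{t_{n,i-1}}^{t_{n,i}}x(v)\,dv$ for $t\in[t_{n,i-1},t_{n,i}]$, $i=1,\dots,n$. For $s\in[a,b]$ and $t\in[t_{n,i-1},t_{n,i}]$ let $$[L(s,t)]_n:=\frac1{h_n}\big((t_{n,i}-t)L(s,t_{n,i-1})+(t-t_{n,i-1})L(s,t_{n,i})\big),$$ and $$K_n(x)(s):=\int_a^b H(s,t)[L(s,t)]_nN(\pi_n(x)(t))\,dt,\qquad U_n(x):=K_n(x)-y .$$ Set $A_0(x)(s):=\int_a^b|H(s,t)||N(x(t))|\,dt$ whenever the integral exists. Let $\widetilde H(s,t):=H(s,t)$ if $s\in[a,b]$ and $\widetilde H(s,t):=0$ if $s\notin[a,b]$. A prime and a double prime denote first and second Fréchet derivatives. (P1) $L\in C^0([a,b]^2,\mathbb{C})$, and $c_L:=\max_{s,t\in[a,b]}|L(s,t)|$. (P2) There exist $r>0$ with $\Omega_r(\varphi)\subset\Omega$ and positive constants $m_0,M_0,M_1,M_2,C_1,C_2,M,C$ such that: (P2.1) for all $x\in\Omega_r(\varphi)$ and all $n\ge1$, $A_0(x)\in L^1([a,b])$ and $A_0(\pi_n(x))\in L^1([a,b])$, with $\sup_{x\in\Omega_r(\varphi)}\|A_0(x)\|\le M_0$ and $\sup_{x\in\Omega_r(\varphi)}\|A_0(\pi_n(x))\|\le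 m_0$ for all $n\ge 1$; (P2.2) $K$ is twice Fréchet-differentiable on $\Omega_r(\varphi)$, $\sup_{x\in\Omega_r(\varphi)}\|K'(x)\|\le M_1$ and $\sup_{x\in\Omega_r(\varphi)}\|K''(x)\|\le M_2$; (P2.3) each $K_n$ is twice Fréchet-differentiable on $\Omega_r(\varphi)$, $\sup_{n\ge1}\|K_n'(\varphi)\|\le C_1$, and, for $n$ large enough, $\sup_{x\in\Omega_r(\varphi)}\|K_n''(x)\|\le C_2$; (P2.4) $\sup_{x\in\Omega_r(\varphi)}\int_a^b|N(\pi_n(x)(t))|\,dt\le M$ for all $n\ge1$, and $\sup_{x\in\Omega_r(\varphi)}\int_a^b|N(x(t))|\,dt\le C$; (P2.5) the function $w_H(h):=\sup_{t\in[a,b]}\int_a^b|\widetilde H(s+h,t)-\widetilde H(s,t)|\,ds$ satisfies $\lim_{h\to0}w_H(h)=0$. Moduli. For $x\in L^1([a,b],\mathbb{C})$, let $\widetilde x$ be its extension by $0$ outside $[a,b]$, and $$w_1(x,h):=\sup_{|u|\in[0,|h|]}\int_a^b|\widetilde x(v+u)-\widetilde x(v)|\,dv .$$ For $f\in C^0([a,b]^2,\mathbb{C})$, $$w_2(f,h):=\sup_{u,v\in[a,b]^2,\ \|u-v\|\le|h|}|f(u)-f(v)|,$$ where $\|\cdot\|$ is the Euclidean norm of $\mathbb{R}^2$. A fixed point $\varphi$ of $U$ is isolated if some neighborhood of $\varphi$ contains no other fixed point of $U$. *)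

theory Defs
  imports "HOL-Analysis.Analysis"
begin

section \<open>The space of integrable functions modulo equality almost everywhere\<close>

text \<open>
  The interval \<open>[a, b]\<close> is a parameter, so it cannot be part of a type. The type \<open>L1\<close> is
  \<open>L\<^sup>1(\<real>, \<complex>)\<close>, and \<open>L\<^sup>1([a, b], \<complex>)\<close> is its closed subspace \<open>L1_on a b\<close> of the classes that
  vanish almost everywhere outside \<open>[a, b]\<close> (a function on \<open>[a, b]\<close> is identified with its
  extension by zero, which preserves the norm).
\<close>

definition L1_rel :: "(real \<Rightarrow> complex) \<Rightarrow> (real \<Rightarrow> complex) \<Rightarrow> bool" where
  "L1_rel f g \<longleftrightarrow> integrable lebesgue f \<and> integrable lebesgue g \<and> (AE t in lebesgue. f t = g t)"

lemma part_equivp_L1_rel: "part_equivp L1_rel"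
proof (rule part_equivpI)
  show "\<exists>f. L1_rel f f"
    by (rule exI[of _ "\<lambda>_. 0"]) (simp add: L1_rel_def)
  show "symp L1_rel"
    by (auto intro!: sympI simp: L1_rel_def)
  show "transp L1_rel"
  proof (rule transpI)
    fix f g h assume "L1_rel f g" "L1_rel g h"
    then have "AE t in lebesgue. f t = g t" "AE t in lebesgue. g t = h t"
      by (auto simp: L1_rel_def)
    then have "AE t in lebesgue. f t = h t"
      by eventually_elim simp
    then show "L1_rel f h"
      using \<open>L1_rel f g\<close> \<open>L1_rel g h\<close> by (simp add: L1_rel_def)
  qed
qed

quotient_type L1 = "real \<Rightarrow> complex" / partial: L1_rel
  morphisms fun_of L1_abs
  by (rule part_equivp_L1_rel)

lemma L1_rel_I:
  assumes "integrable lebesgue f" "integrable lebesgue g" "AE t in lebesgue. f t = g t"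
  shows "L1_rel f g"
  using assms by (simp add: L1_rel_def)

lemma L1_relD:
  assumes "L1_rel f g"
  shows "integrable lebesgue f" "integrable lebesgue g" "AE t in lebesgue. f t = g t"
  using assms by (simp_all add: L1_rel_def)

instantiation L1 :: real_normed_vector
begin

lift_definition zero_L1 :: L1 is "\<lambda>_. 0"
  by (simp add: L1_rel_def)

lift_definition plus_L1 :: "L1 \<Rightarrow> L1 \<Rightarrow> L1" is "\<lambda>f g t. f t + g t"
proof -
  fix f f' g g' assume *: "L1_rel f f'" "L1_rel g g'"
  have "AE t in lebesgue. f t + g t = f' t + g' t"
    using L1_relD(3)[OF *(1)] L1_relD(3)[OF *(2)] by eventually_elim simp
  then show "L1_rel (\<lambda>t. f t + g t) (\<lambda>t. f' t + g' t)"
    using * by (simp add: L1_rel_def)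
qed

lift_definition minus_L1 :: "L1 \<Rightarrow> L1 \<Rightarrow> L1" is "\<lambda>f g t. f t - g t"
proof -
  fix f f' g g' assume *: "L1_rel f f'" "L1_rel g g'"
  have "AE t in lebesgue. f t - g t = f' t - g' t"
    using L1_relD(3)[OF *(1)] L1_relD(3)[OF *(2)] by eventually_elim simp
  then show "L1_rel (\<lambda>t. f t - g t) (\<lambda>t. f' t - g' t)"
    using * by (simp add: L1_rel_def)
qed

lift_definition uminus_L1 :: "L1 \<Rightarrow> L1" is "\<lambda>f t. - f t"
  by (simp add: L1_rel_def)

lift_definition scaleR_L1 :: "real \<Rightarrow> L1 \<Rightarrow> L1" is "\<lambda>c f t. c *\<^sub>R f t"
proof -
  fix c :: real and f f' assume *: "L1_rel f f'"
  have "AE t in lebesgue. c *\<^sub>R f t = c *\<^sub>R f' t"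
    using L1_relD(3)[OF *] by eventually_elim simp
  then show "L1_rel (\<lambda>t. c *\<^sub>R f t) (\<lambda>t. c *\<^sub>R f' t)"
    using * unfolding L1_rel_def by (intro conjI integrable_scaleR_right) auto
qed

lift_definition norm_L1 :: "L1 \<Rightarrow> real" is "\<lambda>f. LINT t|lebesgue. norm (f t)"
proof -
  fix f f' assume *: "L1_rel f f'"
  show "(LINT t|lebesgue. norm (f t)) = (LINT t|lebesgue. norm (f' t))"
  proof (rule integral_cong_AE)
    show "AE t in lebesgue. norm (f t) = norm (f' t)"
      using L1_relD(3)[OF *] by eventually_elim simp
  qed (use L1_relD(1,2)[OF *] in \<open>auto dest!: borel_measurable_integrable\<close>)
qed

definition dist_L1 :: "L1 \<Rightarrow> L1 \<Rightarrow> real" where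
  "dist_L1 x y = norm (x - y)"

definition sgn_L1 :: "L1 \<Rightarrow> L1" where
  "sgn_L1 x = inverse (norm x) *\<^sub>R x"

definition uniformity_L1 :: "(L1 \<times> L1) filter" where
  "uniformity_L1 = (INF e\<in>{0<..}. principal {(x, y). dist x y < e})"

definition open_L1 :: "L1 set \<Rightarrow> bool" where
  "open_L1 S \<longleftrightarrow> (\<forall>x\<in>S. \<forall>\<^sub>F (x', y) in uniformity. x' = x \<longrightarrow> y \<in> S)"

instance
proof
  fix x y z :: L1 and c d :: real and S :: "L1 set"
  show "x + y + z = x + (y + z)"
    by transfer (simp add: L1_rel_def algebra_simps)
  show "x + y = y + x"
    by transfer (simp add: L1_rel_def algebra_simps)
  show "0 + x = x"
    by transfer (simp add: L1_rel_def algebra_simps)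
  show "- x + x = 0"
    by transfer (simp add: L1_rel_def algebra_simps)
  show "x - y = x + - y"
    by transfer (simp add: L1_rel_def algebra_simps)
  show "c *\<^sub>R (x + y) = c *\<^sub>R x + c *\<^sub>R y"
    by transfer (simp add: L1_rel_def algebra_simps)
  show "(c + d) *\<^sub>R x = c *\<^sub>R x + d *\<^sub>R x"
    by transfer (simp add: L1_rel_def algebra_simps)
  show "c *\<^sub>R d *\<^sub>R x = (c * d) *\<^sub>R x"
    by transfer (simp add: L1_rel_def algebra_simps)
  show "1 *\<^sub>R x = x"
    by transfer (simp add: L1_rel_def algebra_simps)
  show "dist x y = norm (x - y)"
    by (rule dist_L1_def)
  show "sgn x = inverse (norm x) *\<^sub>R x"
    by (rule sgn_L1_def)
  show "uniformity = (INF e\<in>{0<..}. principal {(x::L1, y). dist x y < e})"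
    by (rule uniformity_L1_def)
  show "open S \<longleftrightarrow> (\<forall>x\<in>S. \<forall>\<^sub>F (x', y) in uniformity. x' = x \<longrightarrow> y \<in> S)"
    by (rule open_L1_def)
  show "norm x = 0 \<longleftrightarrow> x = 0"
  proof (transfer, goal_cases)
    case (1 f)
    then have f: "integrable lebesgue f" by (auto dest: L1_relD)
    then have "(LINT t|lebesgue. norm (f t)) = 0 \<longleftrightarrow> (AE t in lebesgue. norm (f t) = 0)"
      by (intro integral_nonneg_eq_0_iff_AE) auto
    then show ?case
      using f by (simp add: L1_rel_def)
  qed
  show "norm (x + y) \<le> norm x + norm y"
  proof (transfer, goal_cases)
    case (1 f g)
    then have f: "integrable lebesgue f" and g: "integrable lebesgue g" by (auto dest: L1_relD)
    then have "(LINT t|lebesgue. norm (f t + g t)) \<le> (LINT t|lebesgue. norm (f t) + norm (g t))"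
      by (intro integral_mono) (auto intro: norm_triangle_ineq)
    then show ?case
      using f g by simp
  qed
  show "norm (c *\<^sub>R x) = \<bar>c\<bar> * norm x"
    by transfer simp
qed

end

text \<open>The class in \<open>L\<^sup>1([a, b], \<complex>)\<close> of a function integrable on \<open>[a, b]\<close>; the value on functions
  that are not integrable on \<open>[a, b]\<close> is a dummy.\<close>

definition ext0 :: "real \<Rightarrow> real \<Rightarrow> (real \<Rightarrow> 'c::zero) \<Rightarrow> real \<Rightarrow> 'c" where
  "ext0 a b f t = (if t \<in> {a..b} then f t else 0)"

definition class_on :: "real \<Rightarrow> real \<Rightarrow> (real \<Rightarrow> complex) \<Rightarrow> L1" where
  "class_on a b f = (if integrable lebesgue (ext0 a b f) then L1_abs (ext0 a b f) else 0)"

definition L1_on :: "real \<Rightarrow> real \<Rightarrow> L1 set" where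
  "L1_on a b = {x. AE t in lebesgue. t \<notin> {a..b} \<longrightarrow> fun_of x t = 0}"

definition L1_ball :: "real \<Rightarrow> real \<Rightarrow> L1 \<Rightarrow> real \<Rightarrow> L1 set" where
  "L1_ball a b \<phi> r = ball \<phi> r \<inter> L1_on a b"

definition restr :: "real \<Rightarrow> real \<Rightarrow> L1 \<Rightarrow> L1" where
  "restr a b x = class_on a b (fun_of x)"

section \<open>Frechet derivatives on the space of classes on an interval\<close>

text \<open>
  A bounded linear map \<open>T\<close> on \<open>L\<^sup>1([a, b], \<complex>)\<close> is identified with the map \<open>T \<circ> restr a b\<close> on \<open>L1\<close>.
  Since \<open>restr a b\<close> is a projection of norm at most one onto \<open>L1_on a b\<close>, this identification is
  linear and isometric for the operator norm; its range is \<open>ops a b\<close>. With \<open>'b\<close> itself a space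
  of bounded linear maps, bounded bilinear maps are covered as well.

  Derivatives are the library's, hence bounded linear over the reals. A Frechet derivative over
  the complex numbers is one over the reals, with the same norm and the same fixed vectors, so
  differentiability over the reals is the weaker requirement.
\<close>

definition ops :: "real \<Rightarrow> real \<Rightarrow> (L1 \<Rightarrow>\<^sub>L 'b::real_normed_vector) set" where
  "ops a b = {T. \<forall>v. blinfun_apply T v = blinfun_apply T (restr a b v)}"

definition has_fderiv ::
  "real \<Rightarrow> real \<Rightarrow> (L1 \<Rightarrow> 'b::real_normed_vector) \<Rightarrow> (L1 \<Rightarrow>\<^sub>L 'b) \<Rightarrow> L1 \<Rightarrow> bool" where
  "has_fderiv a b F T x \<longleftrightarrow>
     T \<in> ops a b \<and> (F has_derivative blinfun_apply T) (at x within L1_on a b)"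

definition fderiv ::
  "real \<Rightarrow> real \<Rightarrow> (L1 \<Rightarrow> 'b::real_normed_vector) \<Rightarrow> L1 \<Rightarrow> (L1 \<Rightarrow>\<^sub>L 'b)" where
  "fderiv a b F x = (THE T. has_fderiv a b F T x)"

definition twice_fdiff_on ::
  "real \<Rightarrow> real \<Rightarrow> (L1 \<Rightarrow> 'b::real_normed_vector) \<Rightarrow> L1 set \<Rightarrow> bool" where
  "twice_fdiff_on a b F S \<longleftrightarrow>
     (\<forall>x\<in>S. (\<exists>T. has_fderiv a b F T x) \<and> (\<exists>T. has_fderiv a b (fderiv a b F) T x))"

definition twice_frechet_differentiable :: "(complex \<Rightarrow> complex) \<Rightarrow> bool" where
  "twice_frechet_differentiable N \<longleftrightarrow>
     (\<exists>(N1 :: complex \<Rightarrow> complex \<Rightarrow>\<^sub>L complex) (N2 :: complex \<Rightarrow> complex \<Rightarrow>\<^sub>L complex \<Rightarrow>\<^sub>L complex).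
        \<forall>z. (N has_derivative blinfun_apply (N1 z)) (at z) \<and>
            (N1 has_derivative blinfun_apply (N2 z)) (at z))"

definition eigenvalue_on :: "real \<Rightarrow> real \<Rightarrow> (L1 \<Rightarrow>\<^sub>L L1) \<Rightarrow> real \<Rightarrow> bool" where
  "eigenvalue_on a b T \<mu> \<longleftrightarrow> (\<exists>v\<in>L1_on a b. v \<noteq> 0 \<and> blinfun_apply T v = \<mu> *\<^sub>R v)"

subsection \<open>Basic facts\<close>

lemma fun_of_L1_rel: "L1_rel (fun_of x) (fun_of x)"
  by (rule Quotient_rep_reflp[OF Quotient_L1])

lemma integrable_fun_of: "integrable lebesgue (fun_of x)"
  using fun_of_L1_rel by (rule L1_relD)

lemma L1_abs_fun_of: "L1_abs (fun_of x) = x"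
  by (rule Quotient_abs_rep[OF Quotient_L1])

lemma fun_of_L1_abs:
  assumes "integrable lebesgue f"
  shows "AE t in lebesgue. fun_of (L1_abs f) t = f t"
proof -
  have "L1_rel f f" using assms by (simp add: L1_rel_def)
  then have "L1_rel (fun_of (L1_abs f)) f"
    by (rule rep_abs_rsp_left[OF Quotient3_L1])
  then show ?thesis by (rule L1_relD)
qed

lemma L1_abs_eqI:
  assumes "integrable lebesgue f" "integrable lebesgue g" "AE t in lebesgue. f t = g t"
  shows "L1_abs f = L1_abs g"
  by (rule Quotient_rel_abs[OF Quotient_L1]) (rule L1_rel_I[OF assms])

lemma ext0_indicator: "ext0 a b f = (\<lambda>t. indicator {a..b} t *\<^sub>R (f t :: complex))"
  by (auto simp: ext0_def fun_eq_iff)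

lemma integrable_ext0_iff: "integrable lebesgue (ext0 a b f) \<longleftrightarrow> set_integrable lebesgue {a..b} f"
  for f :: "real \<Rightarrow> complex"
  by (simp add: ext0_indicator set_integrable_def)

lemma integrable_ext0_fun_of: "integrable lebesgue (ext0 a b (fun_of x))"
  unfolding ext0_indicator by (rule integrable_mult_indicator) (auto simp: integrable_fun_of)

lemma restr_in_L1_on: "restr a b x \<in> L1_on a b"
  using fun_of_L1_abs[OF integrable_ext0_fun_of[of a b x]]
  by (auto simp: restr_def class_on_def integrable_ext0_fun_of L1_on_def ext0_def elim: eventually_mono)

lemma restr_L1_on:
  assumes "x \<in> L1_on a b"
  shows "restr a b x = x"
proof -
  have "L1_abs (ext0 a b (fun_of x)) = L1_abs (fun_of x)"
    using assms
    by (intro L1_abs_eqI integrable_ext0_fun_of integrable_fun_of)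
       (auto simp: L1_on_def ext0_def elim: eventually_mono)
  then show ?thesis
    by (simp add: restr_def class_on_def integrable_ext0_fun_of L1_abs_fun_of)
qed

lemma norm_L1_abs: "integrable lebesgue f \<Longrightarrow> norm (L1_abs f) = (LINT t|lebesgue. norm (f t))"
  by (rule norm_L1.abs_eq) (simp add: L1_rel_def)

lemma norm_fun_of: "norm x = (LINT t|lebesgue. norm (fun_of x t))"
  using norm_L1_abs[OF integrable_fun_of, of x] by (simp add: L1_abs_fun_of)

lemma norm_class_on:
  assumes "set_integrable lebesgue {a..b} f"
  shows "norm (class_on a b f) = (LINT t:{a..b}|lebesgue. norm (f t))"
  using assms
  by (simp add: class_on_def norm_L1_abs integrable_ext0_iff set_lebesgue_integral_def)
     (simp add: ext0_indicator)

lemma norm_restr_le: "norm (restr a b x) \<le> norm x"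
proof -
  have "norm (restr a b x) = (LINT t|lebesgue. norm (ext0 a b (fun_of x) t))"
    by (simp add: restr_def class_on_def integrable_ext0_fun_of norm_L1_abs)
  also have "\<dots> \<le> (LINT t|lebesgue. norm (fun_of x t))"
    by (intro integral_mono integrable_norm integrable_ext0_fun_of integrable_fun_of)
       (simp add: ext0_def)
  finally show ?thesis by (simp add: norm_fun_of)
qed

lemma fun_of_add: "AE t in lebesgue. fun_of (x + y) t = fun_of x t + fun_of y t"
proof -
  have "x + y = L1_abs (\<lambda>t. fun_of x t + fun_of y t)"
    using plus_L1.abs_eq[OF fun_of_L1_rel fun_of_L1_rel, of x y] by (simp add: L1_abs_fun_of)
  then show ?thesis
    using fun_of_L1_abs[of "\<lambda>t. fun_of x t + fun_of y t"] by (simp add: integrable_fun_of)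
qed

lemma fun_of_scaleR: "AE t in lebesgue. fun_of (c *\<^sub>R x) t = c *\<^sub>R fun_of x t"
proof -
  have "c *\<^sub>R x = L1_abs (\<lambda>t. c *\<^sub>R fun_of x t)"
    using scaleR_L1.abs_eq[OF fun_of_L1_rel, of c x] by (simp add: L1_abs_fun_of)
  then show ?thesis
    using fun_of_L1_abs[of "\<lambda>t. c *\<^sub>R fun_of x t"] integrable_scaleR_right[OF integrable_fun_of, of c x]
    by simp
qed

lemma subspace_L1_on: "subspace (L1_on a b)"
  unfolding subspace_def
proof (intro conjI ballI allI)
  show "0 \<in> L1_on a b"
    using fun_of_L1_abs[of "\<lambda>_. 0"] by (auto simp: L1_on_def zero_L1_def elim: eventually_mono)
next
  fix x y assume "x \<in> L1_on a b" "y \<in> L1_on a b"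
  then have *: "AE t in lebesgue. t \<notin> {a..b} \<longrightarrow> fun_of x t = 0"
      "AE t in lebesgue. t \<notin> {a..b} \<longrightarrow> fun_of y t = 0"
    by (simp_all add: L1_on_def)
  have "AE t in lebesgue. t \<notin> {a..b} \<longrightarrow> fun_of (x + y) t = 0"
    using fun_of_add[of x y] * by eventually_elim auto
  then show "x + y \<in> L1_on a b" by (simp add: L1_on_def)
next
  fix c x assume "x \<in> L1_on a b"
  then have *: "AE t in lebesgue. t \<notin> {a..b} \<longrightarrow> fun_of x t = 0"
    by (simp add: L1_on_def)
  have "AE t in lebesgue. t \<notin> {a..b} \<longrightarrow> fun_of (c *\<^sub>R x) t = 0"
    using fun_of_scaleR[of c x] * by eventually_elim auto
  then show "c *\<^sub>R x \<in> L1_on a b" by (simp add: L1_on_def)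
qed

lemma norm_ops:
  assumes "T \<in> ops a b"
  shows "norm T = (SUP v\<in>{v\<in>L1_on a b. norm v \<le> 1}. norm (blinfun_apply T v))"
proof (rule antisym)
  let ?S = "{v\<in>L1_on a b. norm v \<le> 1}"
  have bdd: "bdd_above ((\<lambda>v. norm (blinfun_apply T v)) ` ?S)"
    by (rule bdd_aboveI[of _ "norm T"])
       (auto intro!: order_trans[OF norm_blinfun] simp: mult_left_le)
  have z: "0 \<in> ?S" using subspace_0[OF subspace_L1_on] by simp
  have nn: "0 \<le> (SUP v\<in>?S. norm (blinfun_apply T v))"
    using cSUP_upper[OF z bdd] by simp
  show "norm T \<le> (SUP v\<in>?S. norm (blinfun_apply T v))"
  proof (rule norm_blinfun_bound[OF nn])
    fix v
    let ?w = "restr a b v"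
    show "norm (blinfun_apply T v) \<le> (SUP v\<in>?S. norm (blinfun_apply T v)) * norm v"
    proof (cases "?w = 0")
      case True
      have "blinfun_apply T v = blinfun_apply T ?w"
        using assms unfolding ops_def by blast
      then show ?thesis using True nn by (simp add: blinfun.zero_right)
    next
      case False
      have "inverse (norm ?w) *\<^sub>R ?w \<in> ?S"
        using False subspace_scale[OF subspace_L1_on restr_in_L1_on] by simp
      from cSUP_upper[OF this bdd]
      have "norm (blinfun_apply T ?w) \<le> (SUP v\<in>?S. norm (blinfun_apply T v)) * norm ?w"
        using False by (simp add: blinfun.scaleR_right field_simps)
      also have "\<dots> \<le> (SUP v\<in>?S. norm (blinfun_apply T v)) * norm v"
        using nn norm_restr_le by (intro mult_left_mono) auto
      finally show ?thesis using assms by (simp add: ops_def)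
    qed
  qed
  show "(SUP v\<in>?S. norm (blinfun_apply T v)) \<le> norm T"
    using z by (intro cSUP_least) (auto intro!: order_trans[OF norm_blinfun] simp: mult_left_le)
qed

lemma has_fderiv_unique:
  assumes x: "x \<in> L1_on a b" and S: "has_fderiv a b F S x" and T: "has_fderiv a b F T x"
  shows "S = T"
proof (rule blinfun_eqI)
  fix w
  define v where "v = restr a b w"
  have v: "v \<in> L1_on a b" by (simp add: v_def restr_in_L1_on)
  have line: "x + c *\<^sub>R v \<in> L1_on a b" for c
    using x v by (intro subspace_add[OF subspace_L1_on] subspace_scale[OF subspace_L1_on])
  have g: "((\<lambda>c. x + c *\<^sub>R v) has_derivative (\<lambda>c. c *\<^sub>R v)) (at 0)"
    by (auto intro!: derivative_eq_intros)
  have "((\<lambda>c. F (x + c *\<^sub>R v)) has_derivative (\<lambda>c. blinfun_apply R (c *\<^sub>R v))) (at 0)"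
    if "has_fderiv a b F R x" for R
    using has_derivative_in_compose[OF g, of F "blinfun_apply R"] that line
    by (auto simp: has_fderiv_def intro: has_derivative_subset)
  from has_derivative_unique[OF this[OF S] this[OF T]]
  have "blinfun_apply S v = blinfun_apply T v"
    by (metis scaleR_one)
  then show "blinfun_apply S w = blinfun_apply T w"
    using S T by (simp add: has_fderiv_def ops_def v_def)
qed

lemma fderiv_eq:
  assumes "x \<in> L1_on a b" "has_fderiv a b F T x"
  shows "fderiv a b F x = T"
  unfolding fderiv_def using assms by (blast intro: has_fderiv_unique)

section \<open>The operators\<close>

definition op_K ::
  "real \<Rightarrow> real \<Rightarrow> (real \<times> real \<Rightarrow> complex) \<Rightarrow> (real \<times> real \<Rightarrow> complex) \<Rightarrow>
   (complex \<Rightarrow> complex) \<Rightarrow> L1 \<Rightarrow> L1" where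
  "op_K a b H L N x =
     class_on a b (\<lambda>s. LINT t:{a..b}|lebesgue. H (s, t) * L (s, t) * N (fun_of x t))"

definition op_U ::
  "real \<Rightarrow> real \<Rightarrow> (real \<times> real \<Rightarrow> complex) \<Rightarrow> (real \<times> real \<Rightarrow> complex) \<Rightarrow>
   (complex \<Rightarrow> complex) \<Rightarrow> L1 \<Rightarrow> L1 \<Rightarrow> L1" where
  "op_U a b H L N y x = op_K a b H L N x - y"

definition mesh :: "real \<Rightarrow> real \<Rightarrow> nat \<Rightarrow> real" where
  "mesh a b n = (b - a) / real n"

definition node :: "real \<Rightarrow> real \<Rightarrow> nat \<Rightarrow> nat \<Rightarrow> real" where
  "node a b n i = a + real i * mesh a b n"

text \<open>For \<open>t \<in> [a, b]\<close>, an index \<open>i \<in> {1..n}\<close> with \<open>t \<in> [node (i - 1), node i]\<close>. It is unique unless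
  \<open>t\<close> is an interior node; there \<open>interp\<close> does not depend on the choice and \<open>cell_mean\<close> is only
  defined up to null sets anyway.\<close>

definition cell :: "real \<Rightarrow> real \<Rightarrow> nat \<Rightarrow> real \<Rightarrow> nat" where
  "cell a b n t = (LEAST i. 1 \<le> i \<and> t \<le> node a b n i)"

definition cell_mean :: "real \<Rightarrow> real \<Rightarrow> nat \<Rightarrow> L1 \<Rightarrow> L1" where
  "cell_mean a b n x = class_on a b (\<lambda>t. let i = cell a b n t in
     (LINT v:{node a b n (i - 1)..node a b n i}|lebesgue. fun_of x v) / of_real (mesh a b n))"

definition interp ::
  "real \<Rightarrow> real \<Rightarrow> nat \<Rightarrow> (real \<times> real \<Rightarrow> complex) \<Rightarrow> real \<times> real \<Rightarrow> complex" where
  "interp a b n L = (\<lambda>(s, t). let i = cell a b n t in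
     (of_real (node a b n i - t) * L (s, node a b n (i - 1)) +
      of_real (t - node a b n (i - 1)) * L (s, node a b n i)) / of_real (mesh a b n))"

definition op_Kn ::
  "real \<Rightarrow> real \<Rightarrow> (real \<times> real \<Rightarrow> complex) \<Rightarrow> (real \<times> real \<Rightarrow> complex) \<Rightarrow>
   (complex \<Rightarrow> complex) \<Rightarrow> nat \<Rightarrow> L1 \<Rightarrow> L1" where
  "op_Kn a b H L N n x = class_on a b
     (\<lambda>s. LINT t:{a..b}|lebesgue. H (s, t) * interp a b n L (s, t) * N (fun_of (cell_mean a b n x) t))"

definition op_Un ::
  "real \<Rightarrow> real \<Rightarrow> (real \<times> real \<Rightarrow> complex) \<Rightarrow> (real \<times> real \<Rightarrow> complex) \<Rightarrow>
   (complex \<Rightarrow> complex) \<Rightarrow> L1 \<Rightarrow> nat \<Rightarrow> L1 \<Rightarrow> L1" where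
  "op_Un a b H L N y n x = op_Kn a b H L N n x - y"

definition op_A0 ::
  "real \<Rightarrow> real \<Rightarrow> (real \<times> real \<Rightarrow> complex) \<Rightarrow> (complex \<Rightarrow> complex) \<Rightarrow> L1 \<Rightarrow> real \<Rightarrow> real" where
  "op_A0 a b H N x s = (LINT t:{a..b}|lebesgue. norm (H (s, t)) * norm (N (fun_of x t)))"

text \<open>The first conjunct says that the integral defining \<open>A\<^sub>0(x)(s)\<close> exists for almost all \<open>s\<close>;
  without it, the dummy value \<open>0\<close> of the integral would be taken for a genuine one.\<close>

definition A0_in_L1 ::
  "real \<Rightarrow> real \<Rightarrow> (real \<times> real \<Rightarrow> complex) \<Rightarrow> (complex \<Rightarrow> complex) \<Rightarrow> L1 \<Rightarrow> bool" where
  "A0_in_L1 a b H N x \<longleftrightarrow>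
     (AE s in lebesgue. s \<in> {a..b} \<longrightarrow>
        set_integrable lebesgue {a..b} (\<lambda>t. norm (H (s, t)) * norm (N (fun_of x t)))) \<and>
     set_integrable lebesgue {a..b} (op_A0 a b H N x)"

definition norm_A0 ::
  "real \<Rightarrow> real \<Rightarrow> (real \<times> real \<Rightarrow> complex) \<Rightarrow> (complex \<Rightarrow> complex) \<Rightarrow> L1 \<Rightarrow> real" where
  "norm_A0 a b H N x = (LINT s:{a..b}|lebesgue. \<bar>op_A0 a b H N x s\<bar>)"

section \<open>Moduli of continuity\<close>

definition w_H :: "real \<Rightarrow> real \<Rightarrow> (real \<times> real \<Rightarrow> complex) \<Rightarrow> real \<Rightarrow> ennreal" where
  "w_H a b H h = (SUP t\<in>{a..b}. \<integral>\<^sup>+ s\<in>{a..b}.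
     ennreal (norm (ext0 a b (\<lambda>s. H (s, t)) (s + h) - ext0 a b (\<lambda>s. H (s, t)) s)) \<partial>lebesgue)"

definition w1 :: "real \<Rightarrow> real \<Rightarrow> L1 \<Rightarrow> real \<Rightarrow> real" where
  "w1 a b x h = (SUP u\<in>{u. \<bar>u\<bar> \<in> {0..\<bar>h\<bar>}}. LINT v:{a..b}|lebesgue.
     norm (ext0 a b (fun_of x) (v + u) - ext0 a b (fun_of x) v))"

text \<open>On \<open>real \<times> real\<close>, \<open>dist\<close> is the Euclidean distance.\<close>

definition w2 :: "real \<Rightarrow> real \<Rightarrow> (real \<times> real \<Rightarrow> complex) \<Rightarrow> real \<Rightarrow> real" where
  "w2 a b f h = (SUP (u, v)\<in>{(u, v). u \<in> {a..b} \<times> {a..b} \<and> v \<in> {a..b} \<times> {a..b} \<and> dist u v \<le> \<bar>h\<bar>}.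
     norm (f u - f v))"

section \<open>Fixed points\<close>

definition fixed_point_in :: "L1 set \<Rightarrow> (L1 \<Rightarrow> L1) \<Rightarrow> L1 \<Rightarrow> bool" where
  "fixed_point_in S F x \<longleftrightarrow> x \<in> S \<and> F x = x"

definition isolated_fixed_point_in :: "L1 set \<Rightarrow> (L1 \<Rightarrow> L1) \<Rightarrow> L1 \<Rightarrow> bool" where
  "isolated_fixed_point_in S F x \<longleftrightarrow>
     fixed_point_in S F x \<and> (\<exists>V. open V \<and> x \<in> V \<and> (\<forall>z\<in>V. fixed_point_in S F z \<longrightarrow> z = x))"

end

theory Submission
  imports Defs
begin

text \<open>
  For a kernel \<open>H L'\<close> the hypothesis on \<open>w_H\<close> bounds \<open>\<integral> \<bar>H(s, t)\<bar> ds\<close> uniformly in \<open>t\<close> and makes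
  \<open>g \<mapsto> \<integral> H(\<cdot>, t) L'(\<cdot>, t) g(t) dt\<close> send bounded sets to sets with a uniform \<open>L\<^sup>1\<close> modulus of
  translation. As \<open>\<parallel>\<pi>\<^sub>m x - x\<parallel> \<le> 2 w\<^sub>1(x, h\<^sub>m)\<close>, the finite rank projections \<open>\<pi>\<^sub>m\<close> approximate the
  identity uniformly on all values of the \<open>K\<^sub>n\<close> near \<open>\<phi>\<close>. The bounds on the second derivatives
  transfer this to the operators \<open>K\<^sub>n'(\<phi>)\<close>, through difference quotients, and also give
  \<open>K\<^sub>n'(\<phi>) \<rightarrow> K'(\<phi>)\<close> pointwise. Since \<open>1\<close> is not an eigenvalue of \<open>K'(\<phi>)\<close>, a compactness argument
  yields \<open>c > 0\<close> with \<open>\<parallel>x - K\<^sub>n'(\<phi>) x\<parallel> \<ge> c \<parallel>x\<parallel>\<close> for all large \<open>n\<close>. For a fixed large \<open>m\<close> the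
  operators \<open>I - \<pi>\<^sub>m K\<^sub>n'(\<phi>)\<close> are then invertible by finite dimensional linear algebra, with uniformly
  bounded inverses \<open>G\<close>, and \<open>x \<mapsto> G (K\<^sub>n(x) - \<pi>\<^sub>m K\<^sub>n'(\<phi>) x - y)\<close> is a contraction near \<open>\<phi>\<close> whose
  fixed points are those of \<open>U\<^sub>n\<close>. The error is thus bounded by a multiple of
  \<open>\<parallel>K\<^sub>n(\<phi>) - K(\<phi>)\<parallel> \<le> \<parallel>K\<^sub>n(\<phi>) - K(\<pi>\<^sub>n \<phi>)\<parallel> + \<parallel>K(\<pi>\<^sub>n \<phi>) - K(\<phi>)\<parallel>\<close>.
\<close>

section \<open>Finite rank operators and collectively compact approximation\<close>

text \<open>The derivatives at \<phi> are only shown to converge pointwise, so I - Kn'(\<phi>)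
  cannot be inverted as a small perturbation of I - K'(\<phi>). Norm convergence is replaced by the
  fact that one and the same finite rank projection approximates the images of the unit ball under
  all the Kn'(\<phi>). The hypotheses bound these derivatives but give no formula for them, and the
  kernel is visible only in the values of \<open>Kn\<close>. Facts about derivatives are therefore
  read off from increments over a step of length \<delta>, whose linearization error is of order
  \<delta>^2 and stays of order \<delta> after division. A lower bound yields injectivity but, in
  infinite dimension, not surjectivity. Passing to a finite rank operator at the cost of a quarter
  of \<open>c\<close> turns the one into the other without Fredholm theory, and the discarded part
  is moved into the nonlinear remainder.\<close>

text \<open>Built from rank one summands with real functionals, so that boundedness, finite
  dimensional range and compactness on balls follow by induction; a complex coefficient has to enter
  as two real ones.\<close>

inductive finite_rank :: "('a::real_normed_vector \<Rightarrow> 'b::real_normed_vector) \<Rightarrow> bool" where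
  zero: "finite_rank (\<lambda>x. 0)"
| add_rank_one: "finite_rank F \<Longrightarrow> bounded_linear c \<Longrightarrow> finite_rank (\<lambda>x. F x + c x *\<^sub>R e)"

lemma finite_rank_bounded_linear: "finite_rank F \<Longrightarrow> bounded_linear F"
  by (induction rule: finite_rank.induct)
    (auto intro: bounded_linear_zero bounded_linear_add bounded_linear_scaleR_const)

lemma finite_rank_one: "bounded_linear c \<Longrightarrow> finite_rank (\<lambda>x. c x *\<^sub>R e)"
  using finite_rank.add_rank_one[OF finite_rank.zero, of c e] by simp

lemma finite_rank_add:
  assumes "finite_rank F" "finite_rank G"
  shows "finite_rank (\<lambda>x. F x + G x)"
  using assms(2)
proof induction
  case zero
  then show ?case using assms(1) by simp
next
  case (add_rank_one G c e)
  from finite_rank.add_rank_one[OF this(3) this(2), of e] show ?case by (simp add: add.assoc)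
qed

lemma finite_rank_sum:
  assumes "finite I" "\<And>i. i \<in> I \<Longrightarrow> finite_rank (F i)"
  shows "finite_rank (\<lambda>x. \<Sum>i\<in>I. F i x)"
  using assms by (induction rule: finite_induct) (simp_all add: finite_rank.zero finite_rank_add)

lemma finite_rank_compose:
  assumes "finite_rank F" "bounded_linear G"
  shows "finite_rank (\<lambda>x. F (G x))"
  using assms(1)
proof induction
  case zero
  show ?case by (rule finite_rank.zero)
next
  case (add_rank_one F c e)
  from finite_rank.add_rank_one[OF this(3) bounded_linear_compose[OF this(2) assms(2)]] show ?case .
qed

lemma finite_rank_range:
  assumes "finite_rank F"
  shows "\<exists>E. finite E \<and> range F \<subseteq> span E"
  using assms
proof induction
  case zero
  show ?case by (rule exI[of _ "{}"]) auto
next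
  case (add_rank_one F c e)
  then obtain E where E: "finite E" "range F \<subseteq> span E" by blast
  have "F x + c x *\<^sub>R e \<in> span (insert e E)" for x
  proof (rule span_add)
    show "F x \<in> span (insert e E)" using E(2) span_mono[of E "insert e E"] by auto
    show "c x *\<^sub>R e \<in> span (insert e E)" by (intro span_scale span_base) simp
  qed
  then show ?case using E(1) by (intro exI[of _ "insert e E"]) auto
qed

text \<open>A rank one summand sends the ball into a segment, and sums of compact sets are
  compact.\<close>

lemma finite_rank_compact:
  assumes "finite_rank F"
  shows "\<exists>S. compact S \<and> (\<forall>x. norm x \<le> R \<longrightarrow> F x \<in> S)"
  using assms
proof induction
  case zero
  show ?case by (rule exI[of _ "{0}"]) simp
next
  case (add_rank_one F c e)
  then obtain S where S: "compact S" "\<And>x. norm x \<le> R \<Longrightarrow> F x \<in> S" by blast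
  let ?T = "(\<lambda>s. s *\<^sub>R e) ` {- (onorm c * R)..onorm c * R}"
  have T: "compact ?T"
    by (intro compact_continuous_image continuous_intros) simp
  have "c x *\<^sub>R e \<in> ?T" if "norm x \<le> R" for x
  proof -
    have "\<bar>c x\<bar> \<le> onorm c * norm x" using onorm[OF add_rank_one.hyps(2), of x] by simp
    also have "\<dots> \<le> onorm c * R" using that by (intro mult_left_mono onorm_pos_le add_rank_one.hyps)
    finally show ?thesis by (intro imageI) (simp add: abs_le_iff)
  qed
  then have "F x + c x *\<^sub>R e \<in> {u + v | u v. u \<in> S \<and> v \<in> ?T}" if "norm x \<le> R" for x
    using S(2)[OF that] that by blast
  then show ?case using compact_sums[OF S(1) T] by blast
qed

section \<open>Invertibility of the identity minus a finite rank map\<close>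

text \<open>Dimension count inside a space of arbitrary dimension: the image of a basis is
  independent and equally large, so a vector outside its span would produce too large an independent
  set.\<close>

lemma linear_inj_span_surj:
  fixes f :: "'a::real_vector \<Rightarrow> 'a"
  assumes "finite E" "linear f" "f ` span E \<subseteq> span E" "inj_on f (span E)"
  shows "f ` span E = span E"
proof -
  obtain B where B0: "B \<subseteq> E" "independent B" "E \<subseteq> span B"
    using maximal_independent_subset[of E] by blast
  have "span B = span E"
    by (intro subset_antisym span_mono span_minimal B0 subspace_span)
  note B = B0(1,2) this
  then have fin: "finite B" using assms(1) finite_subset by blast
  have ind: "independent (f ` B)"
    using linear_independent_injective_image[OF assms(2) B(2)] assms(4) B(3) by simp
  have sub: "f ` B \<subseteq> span B"
    using assms(3) span_superset[of B] unfolding B(3) by blast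
  have card: "card (f ` B) = card B"
    by (intro card_image inj_on_subset[OF assms(4)]) (use B(3) span_superset[of B] in blast)
  have "w \<in> span (f ` B)" if w: "w \<in> span B" for w
  proof (rule ccontr)
    assume n: "w \<notin> span (f ` B)"
    then have "independent (insert w (f ` B))" using ind by (rule independent_insertI)
    moreover have "insert w (f ` B) \<subseteq> span B" using sub w by simp
    ultimately have "card (insert w (f ` B)) \<le> card B" by (rule independent_span_bound[OF fin, THEN conjunct2])
    moreover have "w \<notin> f ` B" using n span_base[of w "f ` B"] by blast
    ultimately show False using card fin by simp
  qed
  then have "span B \<subseteq> span (f ` B)" by blast
  also have "span (f ` B) = f ` span B" by (rule linear_span_image[OF assms(2)])
  finally show ?thesis using B(3) assms(3) by (simp add: subset_antisym)
qed

text \<open>With x = y + v and v in the range of \<open>F\<close>, the equation becomes v - F v = F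
  y, which lives in a finite dimensional space. \<open>X\<close> is carried along because
  injectivity is known only there.\<close>

lemma finite_rank_id_minus_surj:
  fixes F :: "'a::real_normed_vector \<Rightarrow> 'a"
  assumes F: "finite_rank F" and X: "subspace X" and FX: "range F \<subseteq> X"
    and inj: "\<And>x. x \<in> X \<Longrightarrow> F x = x \<Longrightarrow> x = 0" and y: "y \<in> X"
  shows "\<exists>x\<in>X. x - F x = y"
proof -
  have lin: "linear F" using finite_rank_bounded_linear[OF F] bounded_linear.linear by blast
  obtain E where E: "finite E" "range F \<subseteq> span E"
    using finite_rank_range[OF F] by blast
  \<comment> \<open>The generators \<open>E\<close> may lie outside \<open>X\<close>, where
    injectivity is unknown; a basis taken from the range itself stays inside.\<close>
  obtain B where B: "B \<subseteq> range F" "independent B" "range F \<subseteq> span B"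
    using maximal_independent_subset[of "range F"] by blast
  have "finite B"
    using independent_span_bound[OF E(1) B(2) order_trans[OF B(1) E(2)]] by blast
  have spB: "span B \<subseteq> X" by (rule span_minimal[OF order_trans[OF B(1) FX] X])
  let ?g = "\<lambda>x. x - F x"
  have lg: "linear ?g" by (intro linear_compose_sub linear_id[unfolded id_def] lin)
  have "?g ` span B = span B"
  proof (rule linear_inj_span_surj[OF \<open>finite B\<close> lg])
    show "?g ` span B \<subseteq> span B" using B(3) by (auto intro!: span_diff)
    show "inj_on ?g (span B)"
      unfolding linear_inj_on_iff_eq_0[OF lg subspace_span]
    proof (intro ballI impI)
      fix x assume "x \<in> span B" "x - F x = 0"
      then show "x = 0" using inj[of x] spB by auto
    qed
  qed
  moreover have "F y \<in> span B" using B by auto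
  ultimately have "F y \<in> ?g ` span B" by simp
  then obtain v where v: "v \<in> span B" "v - F v = F y" by (metis imageE)
  have "y + v - F (y + v) = y" using v(2) linear_add[OF lin, of y v] by (simp add: algebra_simps)
  moreover have "y + v \<in> X" using v(1) spB y X by (auto intro: subspace_add)
  ultimately show ?thesis by blast
qed

section \<open>Compactness and uniform lower bounds\<close>

text \<open>Although the compact set varies with \<eta>, closeness to one for every \<eta> makes the
  range totally bounded.\<close>

lemma convergent_subseq_nearly_compact:
  fixes z :: "nat \<Rightarrow> 'a::complete_space"
  assumes "\<And>\<eta>. \<eta> > 0 \<Longrightarrow> \<exists>S. compact S \<and> (\<forall>k. \<exists>w\<in>S. dist (z k) w < \<eta>)"
  shows "\<exists>l (s :: nat \<Rightarrow> nat). strict_mono s \<and> (z \<circ> s) \<longlonglongrightarrow> l"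
proof -
  have "compact (closure (range z))"
    unfolding compact_eq_totally_bounded
  proof (intro conjI allI impI)
    show "complete (closure (range z))" by (simp add: complete_eq_closed)
  next
    \<comment> \<open>One third leads from the closure to some \<open>z i\<close>, one from there to
      \<open>S\<close>, one to the finite net of \<open>S\<close>.\<close>
    fix \<epsilon> :: real assume "\<epsilon> > 0"
    then obtain S where S: "compact S" "\<forall>k. \<exists>w\<in>S. dist (z k) w < \<epsilon>/3" using assms[of "\<epsilon>/3"] by auto
    then obtain k where k: "finite k" "S \<subseteq> (\<Union>x\<in>k. ball x (\<epsilon>/3))"
      using compact_eq_totally_bounded[THEN iffD1, THEN conjunct2, THEN spec, of S "\<epsilon>/3"] \<open>\<epsilon> > 0\<close>
      by auto
    have "closure (range z) \<subseteq> (\<Union>x\<in>k. ball x \<epsilon>)"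
    proof
      fix v assume "v \<in> closure (range z)"
      then obtain i where i: "dist (z i) v < \<epsilon>/3"
        using \<open>\<epsilon> > 0\<close> closure_approachable[THEN iffD1, THEN spec, of v "range z" "\<epsilon>/3"] by auto
      obtain w where w: "w \<in> S" "dist (z i) w < \<epsilon>/3" using S by blast
      then obtain x where x: "x \<in> k" "dist x w < \<epsilon>/3" using k by (auto simp: subset_iff)
      have "dist x v \<le> dist x w + dist w (z i) + dist (z i) v"
        using dist_triangle[of x v w] dist_triangle[of w v "z i"] by linarith
      also have "\<dots> < \<epsilon>" using i w x by (simp add: dist_commute)
      finally show "v \<in> (\<Union>x\<in>k. ball x \<epsilon>)" using x by auto
    qed
    then show "\<exists>k. finite k \<and> closure (range z) \<subseteq> (\<Union>x\<in>k. ball x \<epsilon>)" using k by blast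
  qed
  then have "seq_compact (closure (range z))" by (simp add: compact_imp_seq_compact)
  moreover have "\<forall>n. z n \<in> closure (range z)" using closure_subset by (metis rangeI subsetD)
  ultimately show ?thesis unfolding seq_compact_def by blast
qed

text \<open>Otherwise there are unit vectors \<open>x k\<close> with
  \<open>x k - Bn (\<nu> k) (x k)\<close> tending to 0. By \<open>approx\<close> their images have a
  convergent subsequence, so the vectors converge along it as well, and their limit is a unit fixed
  vector of \<open>B\<close>.\<close>

lemma collectively_compact_bounded_below:
  fixes X :: "'a::banach set" and B :: "'a \<Rightarrow>\<^sub>L 'a" and Bn :: "nat \<Rightarrow> 'a \<Rightarrow>\<^sub>L 'a"
  assumes X: "subspace X" "closed X"
    and bdd: "\<And>n. n \<ge> n1 \<Longrightarrow> norm (Bn n) \<le> C"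
    and conv: "\<And>x. x \<in> X \<Longrightarrow> (\<lambda>n. Bn n x) \<longlonglongrightarrow> B x"
    and inj: "\<And>x. x \<in> X \<Longrightarrow> B x = x \<Longrightarrow> x = 0"
    and approx: "\<And>\<eta>. \<eta> > 0 \<Longrightarrow> \<exists>P. finite_rank P \<and>
        (\<forall>n\<ge>n1. \<forall>x\<in>X. norm (P (Bn n x) - Bn n x) \<le> \<eta> * norm x)"
  shows "\<exists>c>0. \<exists>n0. \<forall>n\<ge>n0. \<forall>x\<in>X. c * norm x \<le> norm (x - Bn n x)"
proof (rule ccontr)
  assume neg: "\<not> ?thesis"
  \<comment> \<open>The condition \<open>n \<ge> max k n1\<close> sends the indices to infinity, as
    pointwise convergence requires, and keeps them where the uniform bounds hold.\<close>
  define bad where "bad k n x \<longleftrightarrow> n \<ge> max k n1 \<and> x \<in> X \<and> norm x = 1 \<and>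
      norm (x - Bn n x) < inverse (real (Suc k))" for k n x
  have "\<exists>n x. bad k n x" for k
  proof -
    have "inverse (real (Suc k)) > 0" by simp
    then obtain n x where nx: "n \<ge> max k n1" "x \<in> X" "norm (x - Bn n x) < inverse (real (Suc k)) * norm x"
      using neg by (meson not_le)
    then have nz: "norm x > 0" by (cases "x = 0") auto
    define x' where "x' = inverse (norm x) *\<^sub>R x"
    have "x' - Bn n x' = inverse (norm x) *\<^sub>R (x - Bn n x)"
      by (simp add: x'_def blinfun.scaleR_right scaleR_right_diff_distrib)
    then have "norm (x' - Bn n x') = inverse (norm x) * norm (x - Bn n x)" by simp
    also have "\<dots> < inverse (norm x) * (inverse (real (Suc k)) * norm x)"
      using nx(3) nz by (intro mult_strict_left_mono) auto
    also have "\<dots> = inverse (real (Suc k))" using nz by simp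
    finally have "norm (x' - Bn n x') < inverse (real (Suc k))" .
    moreover have "norm x' = 1" "x' \<in> X" using nz nx X by (auto simp: x'_def subspace_scale)
    ultimately show ?thesis using nx unfolding bad_def by blast
  qed
  then obtain \<nu> x where "\<And>k. bad k (\<nu> k) (x k)" by metis
  then have nx: "\<And>k. \<nu> k \<ge> max k n1" "\<And>k. x k \<in> X" "\<And>k. norm (x k) = 1"
      "\<And>k. norm (x k - Bn (\<nu> k) (x k)) < inverse (real (Suc k))"
    unfolding bad_def by blast+
  define z where "z k = Bn (\<nu> k) (x k)" for k
  have C: "norm (Bn n v) \<le> C * norm v" if "n \<ge> n1" for n v
    by (rule order_trans[OF norm_blinfun mult_right_mono[OF bdd[OF that] norm_ge_zero]])
  have "\<exists>S. compact S \<and> (\<forall>k. \<exists>w\<in>S. dist (z k) w < \<eta>)" if "\<eta> > 0" for \<eta>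
  proof -
    obtain P where P: "finite_rank P" "\<forall>n\<ge>n1. \<forall>x\<in>X. norm (P (Bn n x) - Bn n x) \<le> \<eta>/2 * norm x"
      using approx[of "\<eta>/2"] \<open>\<eta> > 0\<close> by auto
    obtain S where S: "compact S" "\<forall>x. norm x \<le> C \<longrightarrow> P x \<in> S"
      using finite_rank_compact[OF P(1)] by blast
    have "P (z k) \<in> S" for k using S C[of "\<nu> k" "x k"] nx[of k] by (auto simp: z_def)
    moreover have "dist (z k) (P (z k)) < \<eta>" for k
    proof -
      have "norm (P (z k) - z k) \<le> \<eta>/2 * norm (x k)"
        unfolding z_def using P(2) nx(1)[of k] nx(2)[of k] by auto
      then show ?thesis using nx(3)[of k] that by (simp add: dist_norm norm_minus_commute)
    qed
    ultimately show ?thesis using S by blast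
  qed
  from convergent_subseq_nearly_compact[OF this]
  obtain l s where s: "strict_mono (s::nat\<Rightarrow>nat)" "(z \<circ> s) \<longlonglongrightarrow> l" by blast
  have "(\<lambda>k. x k - z k) \<longlonglongrightarrow> 0"
    by (rule tendsto_norm_zero_cancel, rule tendsto_sandwich[OF _ _ tendsto_const LIMSEQ_inverse_real_of_nat])
       (use nx(4) in \<open>auto simp: z_def intro!: always_eventually less_imp_le\<close>)
  from LIMSEQ_subseq_LIMSEQ[OF this s(1)] s(2)
  have "(\<lambda>k. ((\<lambda>k. x k - z k) \<circ> s) k + (z \<circ> s) k) \<longlonglongrightarrow> 0 + l" by (intro tendsto_add)
  then have xl: "(\<lambda>k. x (s k)) \<longlonglongrightarrow> l" by (simp add: o_def)
  have lX: "l \<in> X" using closed_sequentially[OF X(2), of "\<lambda>k. x (s k)"] nx(2) xl by blast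
  have n1: "norm l = 1" using tendsto_norm[OF xl] nx(3) by (simp add: LIMSEQ_const_iff)
  have \<nu>: "filterlim (\<lambda>k. \<nu> (s k)) sequentially sequentially"
    by (rule filterlim_at_top_mono[OF filterlim_subseq[OF s(1)]]) (use nx(1) in auto)
  have a: "(\<lambda>k. Bn (\<nu> (s k)) l) \<longlonglongrightarrow> B l" using filterlim_compose[OF conv[OF lX] \<nu>] .
  \<comment> \<open>Index and argument move together; the uniform norm bound allows the argument to
    be frozen at \<open>l\<close>.\<close>
  have "(\<lambda>k. Bn (\<nu> (s k)) (x (s k) - l)) \<longlonglongrightarrow> 0"
  proof (rule Lim_null_comparison)
    show "\<forall>\<^sub>F k in sequentially. norm (Bn (\<nu> (s k)) (x (s k) - l)) \<le> C * norm (x (s k) - l)"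
      using C nx(1) by (auto intro!: always_eventually)
    show "(\<lambda>k. C * norm (x (s k) - l)) \<longlonglongrightarrow> 0"
      using tendsto_mult_right_zero tendsto_norm_zero xl LIM_zero by blast
  qed
  from tendsto_add[OF this a] have "(z \<circ> s) \<longlonglongrightarrow> B l"
    by (simp add: z_def o_def blinfun.diff_right)
  then have "B l = l" using s(2) LIMSEQ_unique by blast
  then show False using inj[OF lX] n1 by auto
qed

section \<open>Abstract approximation theorem for fixed points\<close>

text \<open>\<open>B\<close> and \<open>Bn n\<close> stand for the derivatives at \<phi>;
  differentiability enters only through the linearization bounds, whose factor \<rho> comes from
  bounded second derivatives. The constant \<open>C\<^sub>0\<close> bounds P - I on all vectors,
  since P is also applied to linearization remainders, about which \<open>approx\<close> says
  nothing.\<close>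

locale collectively_compact_approximation =
  fixes X :: "'a::banach set" and K :: "'a \<Rightarrow> 'a" and Kn :: "nat \<Rightarrow> 'a \<Rightarrow> 'a"
    and B :: "'a \<Rightarrow>\<^sub>L 'a" and Bn :: "nat \<Rightarrow> 'a \<Rightarrow>\<^sub>L 'a"
    and \<phi> y :: 'a and r C C\<^sub>0 C\<^sub>1 :: real and n\<^sub>1 :: nat
  assumes X: "subspace X" "closed X"
    and \<phi>: "\<phi> \<in> X" "K \<phi> - y = \<phi>" and y: "y \<in> X" and r: "r > 0" and C: "C \<ge> 0"
    and K_lin: "\<And>\<rho> x z. \<rho> \<le> r \<Longrightarrow> x \<in> X \<inter> ball \<phi> \<rho> \<Longrightarrow> z \<in> X \<inter> ball \<phi> \<rho> \<Longrightarrow>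
        norm (K x - K z - B (x - z)) \<le> C * \<rho> * norm (x - z)"
    and Kn_lin: "\<And>n \<rho> x z. n \<ge> n\<^sub>1 \<Longrightarrow> \<rho> \<le> r \<Longrightarrow> x \<in> X \<inter> ball \<phi> \<rho> \<Longrightarrow> z \<in> X \<inter> ball \<phi> \<rho> \<Longrightarrow>
        norm (Kn n x - Kn n z - Bn n (x - z)) \<le> C * \<rho> * norm (x - z)"
    and Kn_X: "\<And>n x. Kn n x \<in> X"
    and Bn_bdd: "\<And>n. n \<ge> n\<^sub>1 \<Longrightarrow> norm (Bn n) \<le> C\<^sub>1"
    and K_conv: "\<And>x. x \<in> X \<inter> ball \<phi> r \<Longrightarrow> (\<lambda>n. Kn n x) \<longlonglongrightarrow> K x"
    and inj: "\<And>x. x \<in> X \<Longrightarrow> B x = x \<Longrightarrow> x = 0"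
    and C\<^sub>0: "C\<^sub>0 \<ge> 0"
    and approx: "\<And>\<eta>. \<eta> > 0 \<Longrightarrow> \<exists>P. finite_rank P \<and> range P \<subseteq> X \<and>
        (\<forall>x. norm (P x - x) \<le> C\<^sub>0 * norm x) \<and>
        (\<forall>n\<ge>n\<^sub>1. \<forall>x\<in>X \<inter> ball \<phi> r. norm (P (Kn n x) - Kn n x) \<le> \<eta>)"
begin

text \<open>Rescales a direction to length \<delta>. The radius is 2 * \<delta> because the ball is
  open and \<phi> + v has distance exactly \<delta> from the center.\<close>

lemma small_step:
  assumes "\<delta> > 0" "2 * \<delta> \<le> r" "x \<in> X" "x \<noteq> 0"
  defines "v \<equiv> (\<delta> / norm x) *\<^sub>R x"
  shows "x = (norm x / \<delta>) *\<^sub>R v" "\<phi> + v \<in> X \<inter> ball \<phi> (2 * \<delta>)" "\<phi> \<in> X \<inter> ball \<phi> (2 * \<delta>)"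
    "norm v = \<delta>" "X \<inter> ball \<phi> (2 * \<delta>) \<subseteq> X \<inter> ball \<phi> r"
proof -
  show nv: "norm v = \<delta>" using assms by simp
  show "x = (norm x / \<delta>) *\<^sub>R v" using assms by simp
  have "v \<in> X" using assms X by (simp add: subspace_scale)
  then show "\<phi> + v \<in> X \<inter> ball \<phi> (2 * \<delta>)"
    using nv assms(1) X \<phi> by (simp add: subspace_add dist_norm)
  show "\<phi> \<in> X \<inter> ball \<phi> (2 * \<delta>)" using assms(1) \<phi> by simp
  show "X \<inter> ball \<phi> (2 * \<delta>) \<subseteq> X \<inter> ball \<phi> r" using assms(2) by auto
qed

text \<open>The increments of \<open>Kn n\<close> and \<open>K\<close> along v match
  \<open>Bn n v\<close> and \<open>B v\<close> up to 2 C \<delta>^2. Scaling back multiplies by norm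
  x / \<delta> and leaves an error of order \<delta> that does not depend on n, so \<delta> is fixed
  before n.\<close>

lemma Bn_tendsto:
  assumes x: "x \<in> X"
  shows "(\<lambda>n. Bn n x) \<longlonglongrightarrow> B x"
proof (cases "x = 0")
  case False
  show ?thesis
  proof (rule LIMSEQ_I)
    fix e :: real assume e: "e > 0"
    \<comment> \<open>After rescaling, the two linearization errors cost at most e / 2 and the
      convergence of the values e / 4. The summand 1 covers C = 0.\<close>
    define \<delta> where "\<delta> = min (r / 2) (e / (8 * (C + 1) * norm x))"
    have \<delta>: "\<delta> > 0" "2 * \<delta> \<le> r" using r e C False by (auto simp: \<delta>_def)
    have "\<delta> \<le> e / (8 * (C + 1) * norm x)" by (simp add: \<delta>_def)
    then have "8 * (C + 1) * norm x * \<delta> \<le> e"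
      using C False by (subst (asm) pos_le_divide_eq) (auto simp: mult.commute)
    moreover have "C * (norm x * \<delta>) \<le> (C + 1) * (norm x * \<delta>)"
      using \<delta>(1) by (intro mult_right_mono) auto
    ultimately have small: "8 * C * \<delta> * norm x \<le> e" by (simp add: algebra_simps)
    define v where "v = (\<delta> / norm x) *\<^sub>R x"
    note s = small_step[OF \<delta> x False, folded v_def]
    have "(\<lambda>n. Kn n (\<phi> + v) - Kn n \<phi>) \<longlonglongrightarrow> K (\<phi> + v) - K \<phi>"
      using s by (intro tendsto_diff K_conv) auto
    from LIMSEQ_D[OF this, of "e * \<delta> / (4 * norm x)"] e \<delta> False
    obtain n0 where n0: "\<And>n. n \<ge> n0 \<Longrightarrow>
        norm (Kn n (\<phi> + v) - Kn n \<phi> - (K (\<phi> + v) - K \<phi>)) < e * \<delta> / (4 * norm x)" by auto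
    show "\<exists>n0. \<forall>n\<ge>n0. norm (Bn n x - B x) < e"
    proof (intro exI allI impI)
      fix n assume n: "n \<ge> max n0 n\<^sub>1"
      let ?a = "Kn n (\<phi> + v) - Kn n \<phi>" and ?b = "K (\<phi> + v) - K \<phi>"
      have 1: "norm (?a - Bn n v) \<le> C * (2 * \<delta>) * \<delta>"
        using Kn_lin[of n "2 * \<delta>" "\<phi> + v" \<phi>] n s \<delta> by simp
      have 2: "norm (?b - B v) \<le> C * (2 * \<delta>) * \<delta>"
        using K_lin[of "2 * \<delta>" "\<phi> + v" \<phi>] s \<delta> by simp
      have "Bn n v - B v = (?a - ?b) - (?a - Bn n v) + (?b - B v)" by simp
      also have "norm \<dots> \<le> norm (?a - ?b) + norm (?a - Bn n v) + norm (?b - B v)"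
        by (meson norm_triangle_le add_mono_thms_linordered_semiring(3) norm_triangle_ineq4)
      also have "\<dots> < e * \<delta> / (4 * norm x) + C * (2 * \<delta>) * \<delta> + C * (2 * \<delta>) * \<delta>"
        using n0[of n] n 1 2 by simp
      finally have *: "norm (Bn n v - B v) < e * \<delta> / (4 * norm x) + 4 * C * \<delta> * \<delta>" by simp
      have "Bn n x - B x = (norm x / \<delta>) *\<^sub>R (Bn n v - B v)"
        using s(1) by (metis blinfun.scaleR_right scaleR_right_diff_distrib)
      then have "norm (Bn n x - B x) = (norm x / \<delta>) * norm (Bn n v - B v)"
        using \<delta> by simp
      also have "\<dots> < (norm x / \<delta>) * (e * \<delta> / (4 * norm x) + 4 * C * \<delta> * \<delta>)"
        using * \<delta> False by (intro mult_strict_left_mono) auto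
      also have "\<dots> = e / 4 + 4 * C * \<delta> * norm x"
        using \<delta> False by (simp add: field_simps)
      also have "\<dots> < e" using small e by simp
      finally show "norm (Bn n x - B x) < e" .
    qed
  qed
qed (simp add: blinfun.zero_right)

text \<open>The same increments carry the approximation property from the values of
  \<open>Kn\<close> to \<open>Bn\<close>: under P - I the two values contribute \<eta> \<delta> / 2,
  the remainder at most \<open>2 * C\<^sub>0 * C * \<delta>\<^sup>2\<close>.\<close>

lemma Bn_approx:
  assumes \<eta>: "\<eta> > 0"
  shows "\<exists>P. finite_rank P \<and> range P \<subseteq> X \<and> (\<forall>n\<ge>n\<^sub>1. \<forall>x\<in>X. norm (P (Bn n x) - Bn n x) \<le> \<eta> * norm x)"
proof -
  \<comment> \<open>Chosen so that the remainder also costs at most \<eta> \<delta> / 2.\<close>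
  define \<delta> where "\<delta> = min (r / 2) (\<eta> / (4 * (C\<^sub>0 * C + 1)))"
  have CC: "C\<^sub>0 * C \<ge> 0" using C C\<^sub>0 by simp
  have \<delta>: "\<delta> > 0" "2 * \<delta> \<le> r" using r \<eta> CC by (auto simp: \<delta>_def add_nonneg_pos)
  have "\<delta> \<le> \<eta> / (4 * (C\<^sub>0 * C + 1))" by (simp add: \<delta>_def)
  then have "4 * (C\<^sub>0 * C + 1) * \<delta> \<le> \<eta>" using CC by (simp add: field_simps)
  then have small: "4 * (C\<^sub>0 * C) * \<delta> \<le> \<eta>" using \<delta>(1) by (simp add: algebra_simps)
  obtain P where P: "finite_rank P" "range P \<subseteq> X" "\<And>x. norm (P x - x) \<le> C\<^sub>0 * norm x"
      "\<And>n x. n \<ge> n\<^sub>1 \<Longrightarrow> x \<in> X \<inter> ball \<phi> r \<Longrightarrow> norm (P (Kn n x) - Kn n x) \<le> \<eta> * \<delta> / 4"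
    using approx[of "\<eta> * \<delta> / 4"] \<eta> \<delta> by auto
  have lin: "linear P" using finite_rank_bounded_linear[OF P(1)] bounded_linear.linear by blast
  have "norm (P (Bn n x) - Bn n x) \<le> \<eta> * norm x" if n: "n \<ge> n\<^sub>1" and x: "x \<in> X" for n x
  proof (cases "x = 0")
    case True
    then show ?thesis by (simp add: blinfun.zero_right linear_0[OF lin])
  next
    case False
    define v where "v = (\<delta> / norm x) *\<^sub>R x"
    note s = small_step[OF \<delta> x False, folded v_def]
    define D where "D w = P w - w" for w
    have D: "linear D" unfolding D_def by (intro linear_compose_sub lin linear_id[unfolded id_def])
    let ?a = "Kn n (\<phi> + v) - Kn n \<phi>"
    have 1: "norm (?a - Bn n v) \<le> C * (2 * \<delta>) * \<delta>"
      using Kn_lin[of n "2 * \<delta>" "\<phi> + v" \<phi>] n s \<delta> by simp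
    have k: "norm (D (Kn n (\<phi> + v))) \<le> \<eta> * \<delta> / 4" "norm (D (Kn n \<phi>)) \<le> \<eta> * \<delta> / 4"
      unfolding D_def using P(4)[OF n] s by blast+
    have "D (Bn n v) = D (Kn n (\<phi> + v)) - D (Kn n \<phi>) - D (?a - Bn n v)"
      by (simp add: linear_diff[OF D])
    also have "norm \<dots> \<le> norm (D (Kn n (\<phi> + v))) + norm (D (Kn n \<phi>)) + norm (D (?a - Bn n v))"
      by (meson add_right_mono norm_triangle_ineq4 order_trans)
    also have "\<dots> \<le> \<eta> * \<delta> / 4 + \<eta> * \<delta> / 4 + C\<^sub>0 * (C * (2 * \<delta>) * \<delta>)"
      using k order_trans[OF P(3) mult_left_mono[OF 1 C\<^sub>0]] unfolding D_def by (intro add_mono) auto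
    also have "\<dots> = (\<eta> + 4 * (C\<^sub>0 * C) * \<delta>) * \<delta> / 2" by (simp add: field_simps)
    also have "\<dots> \<le> (\<eta> + \<eta>) * \<delta> / 2"
      using small \<delta> by (intro divide_right_mono mult_right_mono) auto
    finally have *: "norm (D (Bn n v)) \<le> \<eta> * \<delta>" by simp
    have "Bn n x = (norm x / \<delta>) *\<^sub>R Bn n v" using s(1) by (metis blinfun.scaleR_right)
    then have "norm (D (Bn n x)) = (norm x / \<delta>) * norm (D (Bn n v))"
      using \<delta> by (simp add: linear_scale[OF D])
    also have "\<dots> \<le> (norm x / \<delta>) * (\<eta> * \<delta>)" using * \<delta> by (intro mult_left_mono) auto
    also have "\<dots> = \<eta> * norm x" using \<delta> by simp
    finally show ?thesis unfolding D_def .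
  qed
  then show ?thesis using P by blast
qed

text \<open>The equivalence with \<open>z = x\<close> expresses existence and uniqueness at once.
  Only the discrepancy at \<phi> enters the bound because \<phi> solves the limit equation
  exactly.\<close>

theorem fixed_points:
  "\<exists>\<epsilon>>0. \<epsilon> < r \<and> (\<forall>x\<in>X \<inter> ball \<phi> \<epsilon>. K x - y = x \<longrightarrow> x = \<phi>) \<and>
    (\<exists>\<gamma>>0. \<exists>n\<^sub>0. \<forall>n\<ge>n\<^sub>0. \<exists>x. (\<forall>z. z \<in> X \<inter> ball \<phi> \<epsilon> \<and> Kn n z - y = z \<longleftrightarrow> z = x) \<and>
      norm (\<phi> - x) \<le> \<gamma> * norm (Kn n \<phi> - K \<phi>))"
proof -
  have "\<exists>c>0. \<exists>n0. \<forall>n\<ge>n0. \<forall>x\<in>X. c * norm x \<le> norm (x - Bn n x)"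
    by (rule collectively_compact_bounded_below[OF X Bn_bdd Bn_tendsto inj]) (use Bn_approx in blast)+
  then obtain c n0 where c: "c > 0" and n0: "\<And>n x. n \<ge> n0 \<Longrightarrow> x \<in> X \<Longrightarrow> c * norm x \<le> norm (x - Bn n x)"
    by blast
  \<comment> \<open>The lower bound survives the pointwise limit; together with \<open>K_lin\<close>
    it isolates \<phi>.\<close>
  have B_below: "c * norm x \<le> norm (x - B x)" if "x \<in> X" for x
  proof (rule tendsto_lowerbound)
    show "(\<lambda>n. norm (x - Bn n x)) \<longlonglongrightarrow> norm (x - B x)"
      by (intro tendsto_intros Bn_tendsto that)
    show "\<forall>\<^sub>F n in sequentially. c * norm x \<le> norm (x - Bn n x)"
      using n0 that by (auto simp: eventually_sequentially)
  qed simp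
  \<comment> \<open>Ensures \<open>C * \<epsilon> \<le> c / 8\<close>, so the linearization
    remainder has Lipschitz constant at most c / 8 on the ball.\<close>
  define \<epsilon> where "\<epsilon> = min (r / 2) (c / (8 * (C + 1)))"
  have \<epsilon>: "\<epsilon> > 0" "\<epsilon> < r" using r c C by (auto simp: \<epsilon>_def)
  have "\<epsilon> \<le> c / (8 * (C + 1))" by (simp add: \<epsilon>_def)
  then have "8 * (C + 1) * \<epsilon> \<le> c" using C by (simp add: field_simps)
  then have C\<epsilon>: "C * \<epsilon> \<le> c / 8" using \<epsilon>(1) by (simp add: algebra_simps)
  have iso: "x = \<phi>" if x: "x \<in> X \<inter> ball \<phi> \<epsilon>" "K x - y = x" for x
  proof -
    have "K x - K \<phi> = x - \<phi>" using x(2) \<phi>(2) by (simp add: algebra_simps)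
    then have "norm (x - \<phi> - B (x - \<phi>)) \<le> C * \<epsilon> * norm (x - \<phi>)"
      using K_lin[of \<epsilon> x \<phi>] \<epsilon> x \<phi> by simp
    also have "\<dots> \<le> c / 8 * norm (x - \<phi>)" using C\<epsilon> by (intro mult_right_mono) auto
    finally have "c * norm (x - \<phi>) \<le> c / 8 * norm (x - \<phi>)"
      using B_below[of "x - \<phi>"] x \<phi> X by (simp add: subspace_diff)
    then have "c * (7 / 8 * norm (x - \<phi>)) \<le> 0" by simp
    then show ?thesis using c by (simp add: mult_le_0_iff)
  qed
  \<comment> \<open>One P for all n: precision c / 4 lowers the bound c for the identity minus
    \<open>Bn n\<close> to 3 c / 4 for the identity minus its composition with P.\<close>
  obtain P where P: "finite_rank P" "range P \<subseteq> X"
      "\<And>n x. n \<ge> n\<^sub>1 \<Longrightarrow> x \<in> X \<Longrightarrow> norm (P (Bn n x) - Bn n x) \<le> c / 4 * norm x"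
    using Bn_approx[of "c / 4"] c by auto
  have "(\<lambda>n. Kn n \<phi>) \<longlonglongrightarrow> K \<phi>" using \<phi> r by (intro K_conv) auto
  \<comment> \<open>The tolerance is what the self-mapping of the half ball below can
    afford.\<close>
  from LIMSEQ_D[OF this, of "c * \<epsilon> / 8"] c \<epsilon>
  obtain n2 where n2: "\<And>n. n \<ge> n2 \<Longrightarrow> norm (Kn n \<phi> - K \<phi>) < c * \<epsilon> / 8" by auto
  have main: "\<exists>x. (\<forall>z. z \<in> X \<inter> ball \<phi> \<epsilon> \<and> Kn n z - y = z \<longleftrightarrow> z = x) \<and>
      norm (\<phi> - x) \<le> 8 / (3 * c) * norm (Kn n \<phi> - K \<phi>)" if n: "n \<ge> max n\<^sub>1 (max n0 n2)" for n
  proof -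
    define F where "F x = P (Bn n x)" for x
    have F: "finite_rank F" "range F \<subseteq> X"
      unfolding F_def using finite_rank_compose[OF P(1) blinfun.bounded_linear_right] P(2) by auto
    have linF: "linear F" using finite_rank_bounded_linear[OF F(1)] bounded_linear.linear by blast
    have below: "3 * c / 4 * norm x \<le> norm (x - F x)" if "x \<in> X" for x
    proof -
      have "c * norm x \<le> norm (x - Bn n x)" using n0[of n x] n that by simp
      also have "\<dots> = norm ((x - F x) + (P (Bn n x) - Bn n x))" by (simp add: F_def)
      also have "\<dots> \<le> norm (x - F x) + c / 4 * norm x"
        using P(3)[of n x] n that by (intro norm_triangle_le add_left_mono) auto
      finally show ?thesis by (simp add: field_simps)
    qed
    have surj: "\<exists>x\<in>X. x - F x = w" if "w \<in> X" for w
      by (rule finite_rank_id_minus_surj[OF F(1) X(1) F(2) _ that]) (use below c in \<open>force simp: mult_le_0_iff\<close>)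
    \<comment> \<open>The inverse of the identity minus \<open>F\<close> on \<open>X\<close>. Its
      values elsewhere are arbitrary, but it is applied only to \<open>R x\<close>, which lies in
      \<open>X\<close>.\<close>
    define G where "G w = (SOME x. x \<in> X \<and> x - F x = w)" for w
    have G: "G w \<in> X" "G w - F (G w) = w" if "w \<in> X" for w
      using someI_ex[of "\<lambda>x. x \<in> X \<and> x - F x = w"] surj[OF that] unfolding G_def by blast+
    have FX: "F x \<in> X" for x using F(2) by auto
    define R where "R x = Kn n x - F x - y" for x
    have RX: "R x \<in> X" for x
      unfolding R_def using FX Kn_X y X by (simp add: subspace_diff)
    \<comment> \<open>The constant is c / 8 + c / 4, from linearization and projection. It is half
      of the lower bound 3 c / 4, whence the contraction factor 1/2.\<close>
    have R: "norm (R x - R z) \<le> 3 * c / 8 * norm (x - z)"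
      if "x \<in> X \<inter> ball \<phi> \<epsilon>" "z \<in> X \<inter> ball \<phi> \<epsilon>" for x z
    proof -
      have "R x - R z = (Kn n x - Kn n z - Bn n (x - z)) - (P (Bn n (x - z)) - Bn n (x - z))"
        using linear_diff[OF linF, of x z] by (simp add: R_def F_def)
      also have "norm \<dots> \<le> C * \<epsilon> * norm (x - z) + c / 4 * norm (x - z)"
        using Kn_lin[of n \<epsilon> x z] P(3)[of n "x - z"] n that \<epsilon> X
        by (intro order_trans[OF norm_triangle_ineq4 add_mono]) (auto simp: subspace_diff)
      also have "\<dots> \<le> c / 8 * norm (x - z) + c / 4 * norm (x - z)"
        using C\<epsilon> by (intro add_right_mono mult_right_mono) auto
      finally show ?thesis by (simp add: field_simps)
    qed
    \<comment> \<open>Serves twice: with \<open>x = G (R z)\<close> for the self-mapping, and with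
      \<open>z = x\<close> for the error bound.\<close>
    have err: "3 * c / 4 * norm (x - \<phi>) \<le> norm (R z - R \<phi>) + norm (Kn n \<phi> - K \<phi>)"
      if "x \<in> X" "x - F x = R z" for x z
    proof -
      have "(x - \<phi>) - F (x - \<phi>) = (R z - R \<phi>) + (Kn n \<phi> - K \<phi>)"
        using that(2) \<phi>(2) linear_diff[OF linF, of x \<phi>] unfolding R_def by (simp add: algebra_simps)
      then show ?thesis
        using below[of "x - \<phi>"] that X \<phi> norm_triangle_ineq[of "R z - R \<phi>" "Kn n \<phi> - K \<phi>"]
        by (simp add: subspace_diff)
    qed
    have fix_iff: "Kn n x - y = x \<longleftrightarrow> x - F x = R x" for x
      unfolding R_def by (auto simp: algebra_simps)
    have unique: "x = z" if "x \<in> X \<inter> ball \<phi> \<epsilon>" "z \<in> X \<inter> ball \<phi> \<epsilon>" "Kn n x - y = x" "Kn n z - y = z" for x z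
    proof -
      have "(x - z) - F (x - z) = R x - R z"
        unfolding that(3,4)[unfolded fix_iff, symmetric] linear_diff[OF linF, of x z] by simp
      then have "3 * c / 4 * norm (x - z) \<le> 3 * c / 8 * norm (x - z)"
        using below[of "x - z"] R[OF that(1,2)] X that by (simp add: subspace_diff)
      then have "c * (3 / 8 * norm (x - z)) \<le> 0" by simp
      then show ?thesis using c by (simp add: mult_le_0_iff)
    qed
    \<comment> \<open>The closed half ball provides completeness; uniqueness in the whole open ball
      comes from \<open>unique\<close>.\<close>
    let ?S = "X \<inter> cball \<phi> (\<epsilon> / 2)"
    have S: "?S \<subseteq> X \<inter> ball \<phi> \<epsilon>" using \<epsilon> by auto
    have "\<exists>!x\<in>?S. G (R x) = x"
    proof (rule Banach_fix[where c = "1/2"])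
      show "complete ?S" using X(2) by (simp add: complete_eq_closed closed_Int)
      show "?S \<noteq> {}" using \<phi> \<epsilon> by auto
      show "(\<lambda>x. G (R x)) ` ?S \<subseteq> ?S"
      proof (rule image_subsetI)
        fix z assume z: "z \<in> ?S"
        have "norm (R z - R \<phi>) \<le> 3 * c / 8 * norm (z - \<phi>)" using R[of z \<phi>] z S \<phi> \<epsilon> by auto
        also have "\<dots> \<le> 3 * c / 8 * (\<epsilon> / 2)"
          using z c by (intro mult_left_mono) (auto simp: dist_norm norm_minus_commute)
        finally have "3 * c / 4 * norm (G (R z) - \<phi>) \<le> 3 * c / 4 * (\<epsilon> / 4) + c * \<epsilon> / 8"
          using err[OF G[OF RX[of z]]] n2[of n] n by (simp add: algebra_simps)
        \<comment> \<open>Since 3/16 + 1/8 = 5/16, the distance is at most 5/12 of \<epsilon>, which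
          is below one half.\<close>
        then have "c * (3 / 4 * norm (G (R z) - \<phi>)) \<le> c * (5 / 16 * \<epsilon>)" by (simp add: algebra_simps)
        then have "norm (G (R z) - \<phi>) \<le> \<epsilon> / 2" using c \<epsilon> by simp
        then show "G (R z) \<in> ?S" using G RX by (simp add: dist_norm norm_minus_commute)
      qed
      show "dist (G (R x)) (G (R z)) \<le> 1 / 2 * dist x z" if "x \<in> ?S" "z \<in> ?S" for x z
      proof -
        let ?d = "G (R x) - G (R z)"
        have "?d - F ?d = (G (R x) - F (G (R x))) - (G (R z) - F (G (R z)))"
          by (simp add: linear_diff[OF linF])
        also have "\<dots> = R x - R z" by (simp only: G(2)[OF RX])
        finally have "?d - F ?d = R x - R z" .
        moreover have "?d \<in> X" using X G(1)[OF RX] by (simp add: subspace_diff)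
        moreover have "norm (R x - R z) \<le> 3 * c / 8 * norm (x - z)" using R that S by blast
        ultimately have "3 * c / 4 * norm ?d \<le> 3 * c / 8 * norm (x - z)"
          using below[of ?d] by simp
        then have "c * (3 / 4 * norm ?d) \<le> c * (3 / 8 * norm (x - z))" by simp
        then show ?thesis using c by (simp add: dist_norm)
      qed
    qed simp_all
    then obtain x where x: "x \<in> ?S" "G (R x) = x" by auto
    then have fx: "Kn n x - y = x" unfolding fix_iff using G(2)[OF RX[of x]] by simp
    have xS: "x \<in> X \<inter> ball \<phi> \<epsilon>" using x S by blast
    have "3 * c / 4 * norm (x - \<phi>) \<le> 3 * c / 8 * norm (x - \<phi>) + norm (Kn n \<phi> - K \<phi>)"
      using err[of x x] R[of x \<phi>] xS \<phi> \<epsilon> fx[unfolded fix_iff] by auto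
    \<comment> \<open>Absorbing 3 c / 8 into 3 c / 4 on the left leaves 3 c / 8, hence the
      constant.\<close>
    then have "norm (\<phi> - x) \<le> 8 / (3 * c) * norm (Kn n \<phi> - K \<phi>)"
      using c by (simp add: field_simps norm_minus_commute)
    then show ?thesis using unique xS fx by blast
  qed
  have "\<exists>\<gamma>>0. \<exists>n\<^sub>0. \<forall>n\<ge>n\<^sub>0. \<exists>x. (\<forall>z. z \<in> X \<inter> ball \<phi> \<epsilon> \<and> Kn n z - y = z \<longleftrightarrow> z = x) \<and>
      norm (\<phi> - x) \<le> \<gamma> * norm (Kn n \<phi> - K \<phi>)"
    using main c by (intro exI[of _ "8 / (3 * c)"] conjI exI[of _ "max n\<^sub>1 (max n0 n2)"]) auto
  then show ?thesis using \<epsilon> iso by blast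
qed

end

section \<open>Completeness of the space of integrable classes\<close>

lemma L1_eqI:
  assumes "AE t in lebesgue. fun_of x t = fun_of z t"
  shows "x = z"
  using L1_abs_eqI[OF integrable_fun_of integrable_fun_of assms] by (simp add: L1_abs_fun_of)

lemma fun_of_diff: "AE t in lebesgue. fun_of (x - z) t = fun_of x t - fun_of z t"
proof -
  have "AE t in lebesgue. fun_of (x + (-1) *\<^sub>R z) t = fun_of x t - fun_of z t"
    using fun_of_add[of x "(-1) *\<^sub>R z"] fun_of_scaleR[of "-1" z] by eventually_elim simp
  then show ?thesis by simp
qed

lemma fun_of_class_on:
  assumes "set_integrable lebesgue {a..b} f"
  shows "AE t in lebesgue. fun_of (class_on a b f) t = ext0 a b f t"
  using assms fun_of_L1_abs[of "ext0 a b f"] by (simp add: class_on_def integrable_ext0_iff)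

lemma class_on_in_L1_on: "class_on a b f \<in> L1_on a b"
proof (cases "integrable lebesgue (ext0 a b f)")
  case True
  then show ?thesis
    using fun_of_L1_abs[OF True]
    by (auto simp: class_on_def L1_on_def ext0_def elim: eventually_mono)
next
  case False
  then show ?thesis using subspace_0[OF subspace_L1_on] by (simp add: class_on_def)
qed

lemma fun_of_restr: "AE t in lebesgue. fun_of (restr a b x) t = ext0 a b (fun_of x) t"
  unfolding restr_def using integrable_ext0_fun_of[of a b x]
  by (intro fun_of_class_on) (simp add: integrable_ext0_iff)

lemma L1_on_ext0: "x \<in> L1_on a b \<Longrightarrow> AE t in lebesgue. ext0 a b (fun_of x) t = fun_of x t"
  by (auto simp: L1_on_def ext0_def elim: eventually_mono)

lemma restr_diff: "restr a b (x - z) = restr a b x - restr a b z"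
proof (rule L1_eqI)
  show "AE t in lebesgue. fun_of (restr a b (x - z)) t = fun_of (restr a b x - restr a b z) t"
    using fun_of_restr[of a b "x - z"] fun_of_restr[of a b x] fun_of_restr[of a b z]
      fun_of_diff[of "restr a b x" "restr a b z"] fun_of_diff[of x z]
    by eventually_elim (simp add: ext0_def)
qed

text \<open>\<open>restr a b\<close> is a nonexpansive projection onto the subspace, so a limit of
  vectors fixed by it is fixed too.\<close>

lemma closed_L1_on: "closed (L1_on a b)"
  unfolding closed_sequential_limits
proof (intro allI impI, elim conjE)
  fix X l assume X: "\<forall>n. X n \<in> L1_on a b" "X \<longlonglongrightarrow> l"
  have "(\<lambda>n. restr a b (X n) - restr a b l) \<longlonglongrightarrow> 0"
  proof (rule Lim_null_comparison)
    show "\<forall>\<^sub>F n in sequentially. norm (restr a b (X n) - restr a b l) \<le> norm (X n - l)"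
      by (simp add: norm_restr_le flip: restr_diff)
    show "(\<lambda>n. norm (X n - l)) \<longlonglongrightarrow> 0" using X(2) by (simp add: LIM_zero tendsto_norm_zero)
  qed
  then have "X \<longlonglongrightarrow> restr a b l" using X(1) by (simp add: restr_L1_on LIM_zero_cancel)
  from LIMSEQ_unique[OF this X(2)] show "l \<in> L1_on a b" using restr_in_L1_on[of a b l] by simp
qed

text \<open>The Riesz-Fischer argument: the pointwise sum of the norms is integrable and dominates
  every remainder of the series, so dominated convergence gives convergence in norm.\<close>

lemma summable_L1:
  fixes D :: "nat \<Rightarrow> L1"
  assumes D: "summable (\<lambda>k. norm (D k))"
  shows "summable D"
proof -
  define f where "f k = fun_of (D k)" for k
  have int: "integrable lebesgue (f k)" for k unfolding f_def by (rule integrable_fun_of)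
  have nf: "(LINT t|lebesgue. norm (f k t)) = norm (D k)" for k by (simp add: f_def norm_fun_of)
  have "(\<integral>\<^sup>+t. (\<Sum>k. ennreal (norm (f k t))) \<partial>lebesgue) = (\<Sum>k. \<integral>\<^sup>+t. ennreal (norm (f k t)) \<partial>lebesgue)"
    using int by (intro nn_integral_suminf) (auto dest!: borel_measurable_integrable)
  also have "\<dots> = (\<Sum>k. ennreal (norm (D k)))"
    using int by (intro suminf_cong) (simp add: nn_integral_eq_integral nf)
  also have "\<dots> \<noteq> \<infinity>" using D by (simp add: suminf_ennreal2)
  finally have "AE t in lebesgue. (\<Sum>k. ennreal (norm (f k t))) \<noteq> \<infinity>"
    using int by (intro nn_integral_noteq_infinite) (auto dest!: borel_measurable_integrable)
  then have AEs: "AE t in lebesgue. summable (\<lambda>k. norm (f k t))"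
    by eventually_elim (rule summable_suminf_not_top, auto)
  have sn: "summable (\<lambda>k. LINT t|lebesgue. norm (f k t))" using D by (simp add: nf)
  have F: "integrable lebesgue (\<lambda>t. \<Sum>k. f k t)" by (rule integrable_suminf[OF int AEs sn])
  have W: "integrable lebesgue (\<lambda>t. \<Sum>k. norm (f k t))"
    by (rule integrable_suminf) (use int AEs sn in auto)
  define l where "l = L1_abs (\<lambda>t. \<Sum>k. f k t)"
  have l: "AE t in lebesgue. fun_of l t = (\<Sum>k. f k t)" unfolding l_def by (rule fun_of_L1_abs[OF F])
  have part: "AE t in lebesgue. fun_of (\<Sum>k<n. D k) t = (\<Sum>k<n. f k t)" for n
  proof (induction n)
    case 0
    \<comment> \<open>Applied to 0 - 0, the rule shows that the representative of 0 vanishes almost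
      everywhere.\<close>
    show ?case using fun_of_diff[of 0 0] by simp
  next
    case (Suc n)
    then show ?case using fun_of_add[of "\<Sum>k<n. D k" "D n"]
      by eventually_elim (simp add: f_def)
  qed
  \<comment> \<open>One exceptional set for all n is needed before the pointwise limit is
    taken.\<close>
  have part_all: "AE t in lebesgue. \<forall>n. fun_of (\<Sum>k<n. D k) t = (\<Sum>k<n. f k t)"
    using part by (simp add: AE_all_countable)
  have diff_all: "AE t in lebesgue. \<forall>n. fun_of (l - (\<Sum>k<n. D k)) t = fun_of l t - fun_of (\<Sum>k<n. D k) t"
    using fun_of_diff by (simp add: AE_all_countable)
  have "(\<lambda>n. norm (l - (\<Sum>k<n. D k))) \<longlonglongrightarrow> (LINT t::real|lebesgue. (0::real))"
    unfolding norm_fun_of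
  proof (rule integral_dominated_convergence[where f = "\<lambda>_. 0" and w = "\<lambda>t. \<Sum>k. norm (f k t)"
        and s = "\<lambda>n t. norm (fun_of (l - (\<Sum>k<n. D k)) t)"])
    show "integrable lebesgue (\<lambda>t. \<Sum>k. norm (f k t))" by (rule W)
    show "AE t in lebesgue. (\<lambda>n. norm (fun_of (l - (\<Sum>k<n. D k)) t)) \<longlonglongrightarrow> 0"
      using AEs l part_all diff_all
    proof eventually_elim
      case (elim t)
      have "(\<lambda>n. (\<Sum>k. f k t) - (\<Sum>k<n. f k t)) \<longlonglongrightarrow> (\<Sum>k. f k t) - (\<Sum>k. f k t)"
        by (rule tendsto_diff[OF tendsto_const summable_LIMSEQ[OF summable_norm_cancel[OF elim(1)]]])
      moreover have "fun_of (l - (\<Sum>k<n. D k)) t = (\<Sum>k. f k t) - (\<Sum>k<n. f k t)" for n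
        using elim(2-4) by simp
      ultimately have "(\<lambda>n. fun_of (l - (\<Sum>k<n. D k)) t) \<longlonglongrightarrow> 0" by simp
      then show ?case by (rule tendsto_norm_zero)
    qed
    show "AE t in lebesgue. norm (norm (fun_of (l - (\<Sum>k<n. D k)) t)) \<le> (\<Sum>k. norm (f k t))" for n
      using AEs l part[of n] fun_of_diff[of l "\<Sum>k<n. D k"]
    proof eventually_elim
      case (elim t)
      have s: "summable (\<lambda>k. f k t)" using elim(1) by (rule summable_norm_cancel)
      have s': "summable (\<lambda>k. norm (f (k + n) t))" using elim(1) by (subst summable_iff_shift)
      have "norm (fun_of (l - (\<Sum>k<n. D k)) t) = norm (\<Sum>k. f (k + n) t)"
        using elim suminf_minus_initial_segment[OF s, of n] by simp
      also have "\<dots> \<le> (\<Sum>k. norm (f (k + n) t))" by (rule summable_norm[OF s'])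
      also have "\<dots> = (\<Sum>k. norm (f k t)) - (\<Sum>k<n. norm (f k t))"
        by (rule suminf_minus_initial_segment[OF elim(1)])
      also have "\<dots> \<le> (\<Sum>k. norm (f k t))" by (simp add: sum_nonneg)
      finally show ?case by simp
    qed
    show "(\<lambda>t. norm (fun_of (l - (\<Sum>k<n. D k)) t)) \<in> borel_measurable lebesgue" for n
      by (rule borel_measurable_integrable[OF integrable_norm[OF integrable_fun_of]])
  qed simp
  then have "(\<lambda>n. l - (\<Sum>k<n. D k)) \<longlonglongrightarrow> 0" by (simp add: tendsto_norm_zero_iff)
  from tendsto_diff[OF tendsto_const[of l] this] have "(\<lambda>n. \<Sum>k<n. D k) \<longlonglongrightarrow> l" by simp
  then show ?thesis by (auto simp: summable_def sums_def)
qed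

instance L1 :: banach
proof
  fix X :: "nat \<Rightarrow> L1" assume X: "Cauchy X"
  have "\<forall>k. \<exists>n. \<forall>m\<ge>n. norm (X m - X n) < (1/2) ^ k"
  proof
    fix k
    obtain M where "\<forall>m\<ge>M. \<forall>n\<ge>M. norm (X m - X n) < (1/2) ^ k"
      using CauchyD[OF X, of "(1/2) ^ k"] by auto
    then show "\<exists>n. \<forall>m\<ge>n. norm (X m - X n) < (1/2) ^ k" by (intro exI[of _ M]) simp
  qed
  from choice[OF this] obtain N where N: "\<And>k m. m \<ge> N k \<Longrightarrow> norm (X m - X (N k)) < (1/2) ^ k"
    by blast
  \<comment> \<open>Indices beyond the thresholds \<open>N k\<close>, forced to increase strictly;
    the increments of X along them are summable.\<close>
  define r where "r = rec_nat (N 0) (\<lambda>k m. max (Suc m) (N (Suc k)))"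
  have r: "r 0 = N 0" "r (Suc k) = max (Suc (r k)) (N (Suc k))" for k by (simp_all add: r_def)
  have mono: "strict_mono r" unfolding strict_mono_Suc_iff r by (simp add: less_max_iff_disj)
  have rN: "r k \<ge> N k" for k by (cases k) (simp_all add: r)
  have "norm (X (r (Suc k)) - X (r k)) \<le> 2 * (1/2) ^ k" for k
  proof -
    have "norm (X (r (Suc k)) - X (r k)) \<le> norm (X (r (Suc k)) - X (N k)) + norm (X (r k) - X (N k))"
      using norm_triangle_ineq4[of "X (r (Suc k)) - X (N k)" "X (r k) - X (N k)"] by simp
    moreover have "r (Suc k) \<ge> N k" using rN[of k] r(2)[of k] by simp
    ultimately show ?thesis using N[OF rN[of k]] N[of k "r (Suc k)"] by linarith
  qed
  then have le: "norm (norm (X (r (Suc k)) - X (r k))) \<le> 2 * (1/2) ^ k" for k by simp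
  have "summable (\<lambda>k. 2 * (1/2::real) ^ k)" by (rule summable_mult[OF summable_geometric]) simp
  from summable_comparison_test'[OF this le]
  have "summable (\<lambda>k. norm (X (r (Suc k)) - X (r k)))" .
  then have "summable (\<lambda>k. X (r (Suc k)) - X (r k))" by (rule summable_L1)
  then have "(\<lambda>n. (\<Sum>k<n. X (r (Suc k)) - X (r k)) + X (r 0)) \<longlonglongrightarrow>
      (\<Sum>k. X (r (Suc k)) - X (r k)) + X (r 0)"
    by (rule tendsto_add[OF summable_LIMSEQ tendsto_const])
  then have "(X \<circ> r) \<longlonglongrightarrow> (\<Sum>k. X (r (Suc k)) - X (r k)) + X (r 0)"
    by (simp add: sum_lessThan_telescope[of "\<lambda>k. X (r k)"] o_def)
  from Cauchy_converges_subseq[OF X mono this] show "convergent X" by (rule convergentI)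
qed

section \<open>Translations of integrable functions\<close>

text \<open>Classes are taken with respect to Lebesgue measure, while iterated integrals and
  translations are treated below for Borel functions. This is the passage between the two.\<close>

lemma complex_borel_representative:
  fixes f :: "'a::euclidean_space \<Rightarrow> complex"
  assumes "f \<in> borel_measurable lebesgue"
  shows "\<exists>g\<in>borel_measurable borel. AE x in lborel. f x = g x"
proof -
  have re: "(\<lambda>x. Re (f x)) \<in> borel_measurable lebesgue" and im: "(\<lambda>x. Im (f x)) \<in> borel_measurable lebesgue"
    using assms by measurable
  obtain u where u: "u \<in> borel_measurable borel" "AE x in lborel. Re (f x) = u x"
    using completion_ex_borel_measurable_real[OF re] by auto
  obtain v where v: "v \<in> borel_measurable borel" "AE x in lborel. Im (f x) = v x"
    using completion_ex_borel_measurable_real[OF im] by auto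
  define g where "g x = complex_of_real (u x) + \<i> * complex_of_real (v x)" for x
  have "g \<in> borel_measurable borel" using u(1) v(1) unfolding g_def by measurable
  moreover have "AE x in lborel. f x = g x"
    using u(2) v(2) unfolding g_def by eventually_elim (metis complex_eq)
  ultimately show ?thesis by (intro bexI)
qed

lemma AE_lborel_translate:
  fixes u :: real
  assumes "AE x in lborel. P x"
  shows "AE x in lborel. P (x + u)"
proof -
  have "AE x in distr lborel borel ((+) u). P x"
    unfolding lborel_distr_plus by (rule assms)
  from AE_distrD[OF _ this] show ?thesis by (simp add: add.commute)
qed

lemma nn_integral_translate:
  fixes f :: "real \<Rightarrow> ennreal"
  assumes "f \<in> borel_measurable borel"
  shows "(\<integral>\<^sup>+x. f (x + u) \<partial>lborel) = (\<integral>\<^sup>+x. f x \<partial>lborel)"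
  using nn_integral_real_affine[OF assms, of 1 u] by (simp add: add.commute)

text \<open>Continuous functions converging pointwise to \<open>p\<close> need not be dominated. The
  nearest-point map onto a disc of radius k keeps them continuous and bounds them by k, which is
  integrable on \<open>{c..d}\<close>; \<open>p\<close> itself is first truncated in the same way at
  small cost.\<close>

lemma continuous_approximation_L1:
  fixes p :: "real \<Rightarrow> complex"
  assumes p: "integrable lborel p" and e: "e > 0"
  shows "\<exists>g. continuous_on UNIV g \<and> (\<integral>\<^sup>+v\<in>{c..d}. ennreal (norm (p v - g v)) \<partial>lborel) \<le> ennreal e"
proof -
  have pm[measurable]: "p \<in> borel_measurable borel" using p by (simp add: borel_measurable_integrable)
  have "p \<in> borel_measurable lebesgue" by (rule measurable_completion) simp
  then have "p measurable_on UNIV"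
    by (subst measurable_on_iff_borel_measurable) (simp_all add: lebesgue_on_UNIV_eq)
  then obtain Z g where Z: "negligible Z" "\<And>n::nat. continuous_on UNIV (g n)"
      "\<And>x. x \<notin> Z \<Longrightarrow> (\<lambda>n. g n x) \<longlonglongrightarrow> p x"
    unfolding measurable_on_def by auto
  then have gp: "AE x in lborel. (\<lambda>n. g n x) \<longlonglongrightarrow> p x"
    using AE_not_in[of Z lebesgue] by (auto simp: negligible_iff_null_sets AE_completion_iff elim: eventually_mono)
  define cut where "cut k z = closest_point (cball 0 (real k)) z" for k and z :: complex
  have cont: "continuous_on UNIV (cut k)" for k
    unfolding cut_def by (intro continuous_on_closest_point) auto
  then have cutm[measurable]: "cut k \<in> borel_measurable borel" for k
    by (rule borel_measurable_continuous_onI)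
  have gm[measurable]: "g n \<in> borel_measurable borel" for n
    using Z(2) by (rule borel_measurable_continuous_onI)
  have cut_le: "norm (cut k z) \<le> real k" for k z
    using closest_point_in_set[of "cball (0::complex) (real k)" z] by (simp add: cut_def)
  have "(\<lambda>k. LINT v|lborel. norm (p v - cut k (p v))) \<longlonglongrightarrow> (LINT v::real|lborel. (0::real))"
  proof (rule integral_dominated_convergence[where f = "\<lambda>_. 0" and w = "\<lambda>v. norm (p v)"
        and s = "\<lambda>k v. norm (p v - cut k (p v))"])
    show "integrable lborel (\<lambda>v. norm (p v))" using p by simp
    show "AE v in lborel. (\<lambda>k. norm (p v - cut k (p v))) \<longlonglongrightarrow> 0"
    proof (rule AE_I2)
      fix v
      obtain k0 where "norm (p v) \<le> real k0" using real_arch_simple by blast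
      then have "norm (p v - cut k (p v)) = 0" if "k \<ge> k0" for k
        unfolding cut_def using that by (subst closest_point_self) auto
      then show "(\<lambda>k. norm (p v - cut k (p v))) \<longlonglongrightarrow> 0"
        by (intro tendsto_eventually) (auto simp: eventually_sequentially)
    qed
    show "AE v in lborel. norm (norm (p v - cut k (p v))) \<le> norm (p v)" for k
      unfolding cut_def using closest_point_le[of "cball (0::complex) (real k)" 0 "p v" for v]
      by (auto simp: dist_norm)
  qed (simp_all, measurable)
  then have "(\<lambda>k. LINT v|lborel. norm (p v - cut k (p v))) \<longlonglongrightarrow> 0" by simp
  from LIMSEQ_D[OF this, of "e / 2"] e obtain k where
    "\<bar>LINT v|lborel. norm (p v - cut k (p v))\<bar> < e / 2" by auto
  then have k: "(LINT v|lborel. norm (p v - cut k (p v))) \<le> e / 2" by simp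
  have ik: "integrable lborel (\<lambda>v. norm (p v - cut k (p v)))"
  proof (rule Bochner_Integration.integrable_bound[OF integrable_norm[OF p]])
    show "AE v in lborel. norm (norm (p v - cut k (p v))) \<le> norm (norm (p v))"
      unfolding cut_def using closest_point_le[of "cball (0::complex) (real k)" 0 "p v" for v]
      by (auto simp: dist_norm)
  qed measurable
  have step1: "(\<integral>\<^sup>+v. ennreal (norm (p v - cut k (p v))) \<partial>lborel) \<le> ennreal (e / 2)"
    using k ik by (subst nn_integral_eq_integral) (auto intro: ennreal_leI)
  have int2: "integrable lborel (\<lambda>v. (2 * real k) * indicator {c..d} v :: real)"
    by (intro integrable_mult_right integrable_real_indicator) (auto simp: emeasure_lborel_Icc_eq)
  have bd: "norm (norm (cut k (p v) - cut k (g n v)) * indicator {c..d} v) \<le> (2 * real k) * indicator {c..d} v"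
    for n v
    using norm_triangle_ineq4[of "cut k (p v)" "cut k (g n v)"] cut_le[of k "p v"] cut_le[of k "g n v"]
    by (auto simp: indicator_def)
  have "(\<lambda>n. LINT v|lborel. norm (cut k (p v) - cut k (g n v)) * indicator {c..d} v) \<longlonglongrightarrow>
      (LINT v::real|lborel. (0::real))"
  proof (rule integral_dominated_convergence[where f = "\<lambda>_. 0" and w = "\<lambda>v. (2 * real k) * indicator {c..d} v"
        and s = "\<lambda>n v. norm (cut k (p v) - cut k (g n v)) * indicator {c..d} v"])
    show "AE v in lborel. (\<lambda>n. norm (cut k (p v) - cut k (g n v)) * indicator {c..d} v) \<longlonglongrightarrow> 0"
      using gp
    proof eventually_elim
      case (elim v)
      have "isCont (cut k) (p v)" using cont by (simp add: continuous_on_eq_continuous_at)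
      then have "(\<lambda>n. cut k (g n v)) \<longlonglongrightarrow> cut k (p v)" using elim by (rule isCont_tendsto_compose)
      from tendsto_mult_right[OF tendsto_norm[OF tendsto_diff[OF tendsto_const[of "cut k (p v)"] this]]]
      show ?case by (rule tendsto_eq_rhs) simp
    qed
    show "AE v in lborel. norm (norm (cut k (p v) - cut k (g n v)) * indicator {c..d} v) \<le> (2 * real k) * indicator {c..d} v"
      for n by (rule AE_I2) (rule bd)
  qed (use int2 in \<open>simp_all\<close>, measurable)
  then have "(\<lambda>n. LINT v|lborel. norm (cut k (p v) - cut k (g n v)) * indicator {c..d} v) \<longlonglongrightarrow> 0" by simp
  from LIMSEQ_D[OF this, of "e / 2"] e obtain n where
    "\<bar>LINT v|lborel. norm (cut k (p v) - cut k (g n v)) * indicator {c..d} v\<bar> < e / 2" by auto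
  then have n: "(LINT v|lborel. norm (cut k (p v) - cut k (g n v)) * indicator {c..d} v) \<le> e / 2" by simp
  have "integrable lborel (\<lambda>v. norm (cut k (p v) - cut k (g n v)) * indicator {c..d} v)"
  proof (rule Bochner_Integration.integrable_bound[OF int2])
    show "AE v in lborel. norm (norm (cut k (p v) - cut k (g n v)) * indicator {c..d} v)
        \<le> norm ((2 * real k) * indicator {c..d} v :: real)"
      using bd by (intro AE_I2) (auto intro: order_trans)
  qed measurable
  then have step2: "(\<integral>\<^sup>+v. ennreal (norm (cut k (p v) - cut k (g n v)) * indicator {c..d} v) \<partial>lborel) \<le> ennreal (e / 2)"
    using n by (subst nn_integral_eq_integral) (auto intro: ennreal_leI)
  have "(\<integral>\<^sup>+v\<in>{c..d}. ennreal (norm (p v - cut k (g n v))) \<partial>lborel) \<le>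
      (\<integral>\<^sup>+v. ennreal (norm (p v - cut k (p v))) +
        ennreal (norm (cut k (p v) - cut k (g n v)) * indicator {c..d} v) \<partial>lborel)"
  proof (rule nn_integral_mono)
    fix v
    have "norm (p v - cut k (g n v)) \<le> norm (p v - cut k (p v)) + norm (cut k (p v) - cut k (g n v))"
      using norm_triangle_ineq[of "p v - cut k (p v)" "cut k (p v) - cut k (g n v)"] by simp
    then show "ennreal (norm (p v - cut k (g n v))) * indicator {c..d} v \<le> ennreal (norm (p v - cut k (p v))) +
        ennreal (norm (cut k (p v) - cut k (g n v)) * indicator {c..d} v)"
      by (auto simp: indicator_def ennreal_leI simp flip: ennreal_plus)
  qed
  also have "\<dots> \<le> ennreal (e / 2) + ennreal (e / 2)"
    using step1 step2 by (subst nn_integral_add) (auto intro: add_mono)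
  also have "\<dots> = ennreal e" using e by (simp flip: ennreal_plus)
  finally have "(\<integral>\<^sup>+v\<in>{c..d}. ennreal (norm (p v - cut k (g n v))) \<partial>lborel) \<le> ennreal e" .
  moreover have "continuous_on UNIV (\<lambda>v. cut k (g n v))"
    by (rule continuous_on_compose2[OF cont Z(2)]) auto
  ultimately show ?thesis by (intro exI[of _ "\<lambda>v. cut k (g n v)"]) simp
qed

text \<open>A continuous approximation is uniformly continuous on the window enlarged by 1 at both
  ends, where v + u stays. Two thirds of e pay for the approximation at v + u and at v, the last for
  the oscillation.\<close>

lemma translation_continuous_L1:
  fixes p :: "real \<Rightarrow> complex"
  assumes p: "integrable lborel p" and e: "e > 0"
  shows "\<exists>\<delta>>0. \<forall>u. \<bar>u\<bar> \<le> \<delta> \<longrightarrow> (\<integral>\<^sup>+v\<in>{a..b}. ennreal (norm (p (v + u) - p v)) \<partial>lborel) \<le> ennreal e"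
proof -
  have pm[measurable]: "p \<in> borel_measurable borel" using p by (simp add: borel_measurable_integrable)
  obtain g where g: "continuous_on UNIV g"
      "(\<integral>\<^sup>+v\<in>{a-1..b+1}. ennreal (norm (p v - g v)) \<partial>lborel) \<le> ennreal (e / 3)"
    using continuous_approximation_L1[OF p, of "e / 3" "a - 1" "b + 1"] e by auto
  have gm[measurable]: "g \<in> borel_measurable borel" using g(1) by (rule borel_measurable_continuous_onI)
  \<comment> \<open>No order between a and b is assumed, and the summand 1 keeps the divisor
    positive.\<close>
  define c where "c = \<bar>b - a\<bar> + 1"
  have c: "c > 0" "\<bar>b - a\<bar> = c - 1" by (simp_all add: c_def)
  define \<kappa> where "\<kappa> = e / (3 * c)"
  have \<kappa>: "\<kappa> > 0" using e c by (simp add: \<kappa>_def)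
  have "uniformly_continuous_on {a-1..b+1} g"
    using g(1) by (intro compact_uniformly_continuous) (auto intro: continuous_on_subset)
  then obtain \<delta> where \<delta>: "\<delta> > 0"
      "\<And>v w. v \<in> {a-1..b+1} \<Longrightarrow> w \<in> {a-1..b+1} \<Longrightarrow> dist w v < \<delta> \<Longrightarrow> dist (g w) (g v) < \<kappa>"
    unfolding uniformly_continuous_on_def using \<kappa> by blast
  have "(\<integral>\<^sup>+v\<in>{a..b}. ennreal (norm (p (v + u) - p v)) \<partial>lborel) \<le> ennreal e" if u: "\<bar>u\<bar> \<le> min 1 (\<delta> / 2)" for u
  proof -
    let ?q = "\<lambda>v. ennreal (norm (p v - g v)) * indicator {a-1..b+1} v"
    have "(\<integral>\<^sup>+v\<in>{a..b}. ennreal (norm (p (v + u) - p v)) \<partial>lborel) \<le>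
        (\<integral>\<^sup>+v. (?q (v + u) + ?q v) + ennreal \<kappa> * indicator {a..b} v \<partial>lborel)"
    proof (rule nn_integral_mono)
      fix v
      show "ennreal (norm (p (v + u) - p v)) * indicator {a..b} v \<le> (?q (v + u) + ?q v) + ennreal \<kappa> * indicator {a..b} v"
      proof (cases "v \<in> {a..b}")
        case True
        then have vu: "v \<in> {a-1..b+1}" "v + u \<in> {a-1..b+1}" using u by auto
        have "dist (g (v + u)) (g v) < \<kappa>" using \<delta>(2)[OF vu] u \<delta>(1) by (simp add: dist_norm)
        moreover have "norm (p (v + u) - p v) \<le>
            norm (p (v + u) - g (v + u)) + norm (p v - g v) + norm (g (v + u) - g v)"
          using norm_triangle_ineq[of "p (v + u) - g (v + u)" "g (v + u) - g v"]
            norm_triangle_ineq[of "p (v + u) - g v" "g v - p v"]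
          by (simp add: norm_minus_commute)
        ultimately have "norm (p (v + u) - p v) \<le> norm (p (v + u) - g (v + u)) + norm (p v - g v) + \<kappa>"
          by (simp add: dist_norm)
        then show ?thesis using True vu \<kappa> by (simp add: ennreal_leI flip: ennreal_plus)
      qed simp
    qed
    also have "\<dots> = (\<integral>\<^sup>+v. ?q (v + u) \<partial>lborel) + (\<integral>\<^sup>+v. ?q v \<partial>lborel) + ennreal \<kappa> * emeasure lborel {a..b}"
      by (simp add: nn_integral_add nn_integral_cmult_indicator)
    also have "(\<integral>\<^sup>+v. ?q (v + u) \<partial>lborel) = (\<integral>\<^sup>+v. ?q v \<partial>lborel)"
      by (rule nn_integral_translate) measurable
    also have "(\<integral>\<^sup>+v. ?q v \<partial>lborel) + (\<integral>\<^sup>+v. ?q v \<partial>lborel) + ennreal \<kappa> * emeasure lborel {a..b}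
        \<le> ennreal (e / 3) + ennreal (e / 3) + ennreal (e / 3)"
    proof (intro add_mono g(2))
      have "\<kappa> * c = e / 3" using c(1) by (simp add: \<kappa>_def)
      then have "\<kappa> * \<bar>b - a\<bar> \<le> e / 3" using \<kappa> unfolding c(2) by (simp add: algebra_simps)
      then have "\<kappa> * max 0 (b - a) \<le> e / 3"
        using \<kappa> by (intro order_trans[OF mult_left_mono[of "max 0 (b - a)" "\<bar>b - a\<bar>"]]) auto
      then show "ennreal \<kappa> * emeasure lborel {a..b} \<le> ennreal (e / 3)"
        using \<kappa> by (cases "a \<le> b") (auto simp: emeasure_lborel_Icc_eq ennreal_leI simp flip: ennreal_mult)
    qed
    also have "\<dots> = ennreal e" using e by (simp flip: ennreal_plus)
    finally show ?thesis .
  qed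
  then show ?thesis using \<delta>(1) by (intro exI[of _ "min 1 (\<delta> / 2)"]) auto
qed

section \<open>Borel representatives of classes\<close>

lemma lebesgue_integral_borel_representative:
  fixes f p :: "'a::euclidean_space \<Rightarrow> complex"
  assumes p: "p \<in> borel_measurable borel" and f: "AE t in lborel. f t = p t"
  shows "integrable lebesgue f \<longleftrightarrow> integrable lborel p" "(LINT t|lebesgue. f t) = (LINT t|lborel. p t)"
proof -
  have pl: "p \<in> borel_measurable lborel" using p by simp
  have pm: "p \<in> borel_measurable lebesgue" by (rule measurable_completion[OF pl])
  have ae: "AE t in lebesgue. f t = p t" using f by (simp add: AE_completion_iff)
  have fm: "f \<in> borel_measurable lebesgue"
    by (rule borel_measurable_AE[OF pm]) (use ae in \<open>auto elim: eventually_mono\<close>)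
  show "integrable lebesgue f \<longleftrightarrow> integrable lborel p"
    using integrable_cong_AE[OF fm pm ae] integrable_completion[OF pl] by simp
  show "(LINT t|lebesgue. f t) = (LINT t|lborel. p t)"
    using integral_cong_AE[OF fm pm ae] integral_completion[OF pl] by simp
qed

lemma set_integrable_borel_representative:
  fixes g :: "real \<Rightarrow> complex"
  assumes "set_integrable lebesgue {a..b} g"
  shows "\<exists>p. p \<in> borel_measurable borel \<and> integrable lborel p \<and> (AE t in lborel. ext0 a b g t = p t) \<and>
     (LINT t|lborel. norm (p t)) = (LINT t:{a..b}|lebesgue. norm (g t))"
proof -
  have i: "integrable lebesgue (ext0 a b g)" using assms by (simp add: integrable_ext0_iff)
  obtain p where p: "p \<in> borel_measurable borel" "AE t in lborel. ext0 a b g t = p t"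
    using complex_borel_representative[OF borel_measurable_integrable[OF i]] by blast
  have int: "integrable lborel p"
    using lebesgue_integral_borel_representative(1)[OF p] i by simp
  \<comment> \<open>The rule for changing representatives is stated for complex functions, so the
    norms are regarded as complex.\<close>
  have "(\<lambda>t. complex_of_real (norm (p t))) \<in> borel_measurable borel" using p(1) by measurable
  moreover have "AE t in lborel. complex_of_real (norm (ext0 a b g t)) = complex_of_real (norm (p t))"
    using p(2) by (auto elim!: eventually_mono)
  ultimately have "(LINT t|lebesgue. complex_of_real (norm (ext0 a b g t))) = (LINT t|lborel. complex_of_real (norm (p t)))"
    by (rule lebesgue_integral_borel_representative(2))
  then have "(LINT t|lebesgue. norm (ext0 a b g t)) = (LINT t|lborel. norm (p t))"
    by (simp only: integral_complex_of_real of_real_eq_iff)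
  moreover have "norm (ext0 a b g t) = indicator {a..b} t *\<^sub>R norm (g t)" for t
    by (simp add: ext0_def)
  ultimately show ?thesis using p int unfolding set_lebesgue_integral_def by (intro exI[of _ p]) simp
qed

lemma L1_borel_representative:
  "\<exists>p. p \<in> borel_measurable borel \<and> integrable lborel p \<and> (AE t in lborel. ext0 a b (fun_of x) t = p t) \<and>
     (LINT t|lborel. norm (p t)) \<le> norm x"
proof -
  have i: "set_integrable lebesgue {a..b} (fun_of x)"
    using integrable_ext0_fun_of[of a b x] by (simp add: integrable_ext0_iff)
  show ?thesis
    using set_integrable_borel_representative[OF i] norm_class_on[OF i] norm_restr_le[of a b x]
    by (auto simp: restr_def)
qed

text \<open>Translation preserves null sets, so \<open>f\<close> may be replaced by \<open>p\<close>
  at v and v + u simultaneously. The first part reaches nonnegative integrals, whose order can be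
  exchanged; the second makes the supremum in \<open>w1\<close> a genuine one.\<close>

lemma L1_shift_integral:
  fixes f p :: "real \<Rightarrow> complex"
  assumes p: "p \<in> borel_measurable borel" "integrable lborel p"
    and f: "AE t in lborel. f t = p t"
  shows "ennreal (LINT v:{a..b}|lebesgue. norm (f (v + u) - f v)) =
      (\<integral>\<^sup>+v\<in>{a..b}. ennreal (norm (p (v + u) - p v)) \<partial>lborel)"
    and "(LINT v:{a..b}|lebesgue. norm (f (v + u) - f v)) \<le> 2 * (LINT t|lborel. norm (p t))"
proof -
  note pm[measurable] = p(1)
  have pu: "integrable lborel (\<lambda>v. p (v + u))"
    using lborel_integrable_real_affine[OF p(2), of 1 u] by (simp add: add.commute)
  have int: "integrable lborel (\<lambda>v. norm (p (v + u) - p v))"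
    using pu p(2) by auto
  have intA: "integrable lborel (\<lambda>v. norm (p (v + u) - p v) * indicator {a..b} v)"
    using integrable_mult_indicator[OF _ int, of "{a..b}"] by (simp add: mult.commute)
  have "AE v in lborel. indicator {a..b} v *\<^sub>R norm (f (v + u) - f v) = norm (p (v + u) - p v) * indicator {a..b} v"
    using f AE_lborel_translate[OF f, of u] by eventually_elim simp
  then have ae: "AE v in lebesgue. indicator {a..b} v *\<^sub>R norm (f (v + u) - f v) = norm (p (v + u) - p v) * indicator {a..b} v"
    by (simp add: AE_completion_iff)
  have m: "(\<lambda>v. norm (p (v + u) - p v) * indicator {a..b} v) \<in> borel_measurable lebesgue"
    by (rule measurable_completion) measurable
  have "(LINT v:{a..b}|lebesgue. norm (f (v + u) - f v)) =
      (LINT v|lebesgue. norm (p (v + u) - p v) * indicator {a..b} v)"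
    unfolding set_lebesgue_integral_def
  proof (rule integral_cong_AE[OF _ m ae])
    show "(\<lambda>v. indicator {a..b} v *\<^sub>R norm (f (v + u) - f v)) \<in> borel_measurable lebesgue"
      by (rule borel_measurable_AE[OF m]) (use ae in \<open>auto elim: eventually_mono\<close>)
  qed
  also have "\<dots> = (LINT v|lborel. norm (p (v + u) - p v) * indicator {a..b} v)"
    by (rule integral_completion) measurable
  finally have eq: "(LINT v:{a..b}|lebesgue. norm (f (v + u) - f v)) =
      (LINT v|lborel. norm (p (v + u) - p v) * indicator {a..b} v)" .
  have "ennreal (LINT v|lborel. norm (p (v + u) - p v) * indicator {a..b} v) =
      (\<integral>\<^sup>+v. ennreal (norm (p (v + u) - p v) * indicator {a..b} v) \<partial>lborel)"
    by (rule nn_integral_eq_integral[symmetric, OF intA]) simp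
  also have "\<dots> = (\<integral>\<^sup>+v\<in>{a..b}. ennreal (norm (p (v + u) - p v)) \<partial>lborel)"
    by (intro nn_integral_cong) (simp add: indicator_def)
  finally show "ennreal (LINT v:{a..b}|lebesgue. norm (f (v + u) - f v)) =
      (\<integral>\<^sup>+v\<in>{a..b}. ennreal (norm (p (v + u) - p v)) \<partial>lborel)"
    unfolding eq .
  have "(LINT v|lborel. norm (p (v + u) - p v) * indicator {a..b} v) \<le>
      (LINT v|lborel. norm (p (v + u)) + norm (p v))"
    using intA pu p(2)
    by (intro integral_mono) (auto simp: indicator_def norm_triangle_ineq4)
  also have "\<dots> = (LINT v|lborel. norm (p (v + u))) + (LINT v|lborel. norm (p v))"
    using pu p(2) by simp
  also have "(LINT v|lborel. norm (p (v + u))) = (LINT v|lborel. norm (p v))"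
    using lborel_integral_real_affine[of 1 "\<lambda>v. norm (p v)" u] by (simp add: add.commute)
  finally show "(LINT v:{a..b}|lebesgue. norm (f (v + u) - f v)) \<le> 2 * (LINT t|lborel. norm (p t))"
    unfolding eq by simp
qed

lemma shift_integral_le_norm:
  "(LINT v:{a..b}|lebesgue. norm (ext0 a b (fun_of x) (v + u) - ext0 a b (fun_of x) v)) \<le> 2 * norm x"
proof -
  obtain p where p: "p \<in> borel_measurable borel" "integrable lborel p"
      "AE t in lborel. ext0 a b (fun_of x) t = p t" "(LINT t|lborel. norm (p t)) \<le> norm x"
    using L1_borel_representative[of a b x] by blast
  show ?thesis using L1_shift_integral(2)[OF p(1-3), of a b u] p(4) by linarith
qed

section \<open>The translation modulus \<open>w1\<close>\<close>

lemma w1_upper: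
  assumes "\<bar>u\<bar> \<le> \<bar>h\<bar>"
  shows "(LINT v:{a..b}|lebesgue. norm (ext0 a b (fun_of x) (v + u) - ext0 a b (fun_of x) v)) \<le> w1 a b x h"
  unfolding w1_def
proof (rule cSUP_upper)
  show "u \<in> {u. \<bar>u\<bar> \<in> {0..\<bar>h\<bar>}}" using assms by simp
qed (rule bdd_aboveI2[OF shift_integral_le_norm])

lemma w1_least:
  assumes "\<And>u. \<bar>u\<bar> \<le> \<bar>h\<bar> \<Longrightarrow>
    (LINT v:{a..b}|lebesgue. norm (ext0 a b (fun_of x) (v + u) - ext0 a b (fun_of x) v)) \<le> B"
  shows "w1 a b x h \<le> B"
  unfolding w1_def
proof (rule cSUP_least)
  have "0 \<in> {u. \<bar>u\<bar> \<in> {0..\<bar>h\<bar>}}" by simp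
  then show "{u. \<bar>u\<bar> \<in> {0..\<bar>h\<bar>}} \<noteq> {}" by blast
qed (use assms in simp)

lemma w1_le_norm: "w1 a b x h \<le> 2 * norm x"
  by (rule w1_least) (rule shift_integral_le_norm)

lemma w1_nonneg: "0 \<le> w1 a b x h"
  using w1_upper[of 0 h a b x] by simp

lemma w1_small:
  assumes e: "e > 0"
  shows "\<exists>\<delta>>0. \<forall>h. \<bar>h\<bar> \<le> \<delta> \<longrightarrow> w1 a b x h \<le> e"
proof -
  obtain p where p: "p \<in> borel_measurable borel" "integrable lborel p"
      "AE t in lborel. ext0 a b (fun_of x) t = p t" "(LINT t|lborel. norm (p t)) \<le> norm x"
    using L1_borel_representative[of a b x] by blast
  obtain \<delta> where \<delta>: "\<delta> > 0"
      "\<And>u. \<bar>u\<bar> \<le> \<delta> \<Longrightarrow> (\<integral>\<^sup>+v\<in>{a..b}. ennreal (norm (p (v + u) - p v)) \<partial>lborel) \<le> ennreal e"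
    using translation_continuous_L1[OF p(2) e, of a b] by blast
  have "w1 a b x h \<le> e" if "\<bar>h\<bar> \<le> \<delta>" for h
  proof (rule w1_least)
    fix u assume "\<bar>u\<bar> \<le> \<bar>h\<bar>"
    then have "\<bar>u\<bar> \<le> \<delta>" using that by simp
    then have "ennreal (LINT v:{a..b}|lebesgue. norm (ext0 a b (fun_of x) (v + u) - ext0 a b (fun_of x) v)) \<le> ennreal e"
      unfolding L1_shift_integral(1)[OF p(1-3)] by (rule \<delta>(2))
    then show "(LINT v:{a..b}|lebesgue. norm (ext0 a b (fun_of x) (v + u) - ext0 a b (fun_of x) v)) \<le> e"
      using e by (simp add: ennreal_le_iff)
  qed
  then show ?thesis using \<delta>(1) by blast
qed

section \<open>Cell means\<close>

lemma mesh_pos: "a < b \<Longrightarrow> n \<ge> 1 \<Longrightarrow> mesh a b n > 0"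
  by (simp add: mesh_def)

lemma node_0: "node a b n 0 = a"
  by (simp add: node_def)

lemma node_self: "n \<ge> 1 \<Longrightarrow> node a b n n = b"
  by (simp add: node_def mesh_def)

lemma node_mono: "a < b \<Longrightarrow> n \<ge> 1 \<Longrightarrow> i \<le> j \<Longrightarrow> node a b n i \<le> node a b n j"
  using mesh_pos[of a b n] by (simp add: node_def mult_right_mono)

lemma cell_bounds:
  assumes "a < b" "n \<ge> 1" "t \<in> {a..b}"
  shows "1 \<le> cell a b n t" "cell a b n t \<le> n"
    "node a b n (cell a b n t - 1) \<le> t" "t \<le> node a b n (cell a b n t)"
    "node a b n (cell a b n t) - node a b n (cell a b n t - 1) = mesh a b n"
    "{node a b n (cell a b n t - 1)..node a b n (cell a b n t)} \<subseteq> {a..b}"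
proof -
  let ?P = "\<lambda>i. 1 \<le> i \<and> t \<le> node a b n i"
  have Pn: "?P n" using assms node_self[of n a b] by simp
  from LeastI[of ?P, OF Pn] show 1: "1 \<le> cell a b n t" and 4: "t \<le> node a b n (cell a b n t)"
    unfolding cell_def by blast+
  from Least_le[of ?P, OF Pn] show 2: "cell a b n t \<le> n" unfolding cell_def .
  \<comment> \<open>Minimality of the index gives the lower endpoint, except in the first cell,
    where that endpoint is a.\<close>
  show 3: "node a b n (cell a b n t - 1) \<le> t"
  proof (cases "cell a b n t - 1 = 0")
    case True
    then show ?thesis using assms by (simp add: node_0)
  next
    case False
    then have "cell a b n t - 1 < (LEAST i. ?P i)" unfolding cell_def by simp
    from not_less_Least[OF this] False show ?thesis by auto
  qed
  have "real (cell a b n t - 1) = real (cell a b n t) - 1" using 1 by (simp add: of_nat_diff)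
  then show "node a b n (cell a b n t) - node a b n (cell a b n t - 1) = mesh a b n"
    unfolding node_def by (simp add: algebra_simps)
  show "{node a b n (cell a b n t - 1)..node a b n (cell a b n t)} \<subseteq> {a..b}"
    using node_mono[OF assms(1,2), of 0 "cell a b n t - 1"] node_mono[OF assms(1,2) 2]
    by (simp add: node_0 node_self[OF assms(2)])
qed

lemma measurable_cell [measurable]: "cell a b n \<in> borel \<rightarrow>\<^sub>M count_space UNIV"
  unfolding cell_def by measurable

lemma set_integrable_step:
  fixes f :: "nat \<Rightarrow> complex"
  assumes "a < b" "n \<ge> 1"
  shows "set_integrable lebesgue {a..b} (\<lambda>t. f (cell a b n t))"
proof -
  have "integrable lborel (\<lambda>t. indicator {a..b} t * (\<Sum>i\<le>n. norm (f i)) :: real)"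
    by (intro integrable_mult_left integrable_real_indicator) (auto simp: emeasure_lborel_Icc_eq)
  then have "integrable lborel (\<lambda>t. indicator {a..b} t *\<^sub>R f (cell a b n t))"
  proof (rule Bochner_Integration.integrable_bound)
    show "AE t in lborel. norm (indicator {a..b} t *\<^sub>R f (cell a b n t)) \<le>
        norm (indicator {a..b} t * (\<Sum>i\<le>n. norm (f i)))"
    proof (rule AE_I2)
      fix t
      show "norm (indicator {a..b} t *\<^sub>R f (cell a b n t)) \<le> norm (indicator {a..b} t * (\<Sum>i\<le>n. norm (f i)))"
      proof (cases "t \<in> {a..b}")
        case True
        then have "norm (f (cell a b n t)) \<le> (\<Sum>i\<le>n. norm (f i))"
          using cell_bounds(2)[OF assms True] by (intro member_le_sum) auto
        then show ?thesis using True by (simp add: sum_nonneg)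
      qed simp
    qed
    show "(\<lambda>t. indicator {a..b} t *\<^sub>R f (cell a b n t)) \<in> borel_measurable lborel"
      by measurable
  qed
  then show ?thesis unfolding set_integrable_def
    by (subst integrable_completion) (auto simp: borel_measurable_integrable)
qed

definition cell_avg :: "real \<Rightarrow> real \<Rightarrow> nat \<Rightarrow> nat \<Rightarrow> L1 \<Rightarrow> complex" where
  "cell_avg a b n i x =
     (LINT v:{node a b n (i - 1)..node a b n i}|lebesgue. fun_of x v) / of_real (mesh a b n)"

lemma cell_mean_eq: "cell_mean a b n x = class_on a b (\<lambda>t. cell_avg a b n (cell a b n t) x)"
  by (simp add: cell_mean_def cell_avg_def Let_def)

lemma set_integrable_fun_of: "A \<in> sets lebesgue \<Longrightarrow> set_integrable lebesgue A (fun_of x)"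
  unfolding set_integrable_def by (rule integrable_mult_indicator[OF _ integrable_fun_of])

lemma bounded_linear_set_integral:
  assumes A: "A \<in> sets lebesgue"
  shows "bounded_linear (\<lambda>x. LINT v:A|lebesgue. fun_of x v)"
proof (rule bounded_linear_intro[where K = 1])
  have m: "(\<lambda>v. indicator A v *\<^sub>R fun_of x v) \<in> borel_measurable lebesgue" for x
    using set_integrable_fun_of[OF A, of x] unfolding set_integrable_def by (rule borel_measurable_integrable)
  have i: "integrable lebesgue (\<lambda>v. indicator A v *\<^sub>R fun_of x v)" for x
    using set_integrable_fun_of[OF A, of x] unfolding set_integrable_def .
  fix x z :: L1 and c :: real
  have "(LINT v:A|lebesgue. fun_of (x + z) v) =
      (LINT v|lebesgue. indicator A v *\<^sub>R fun_of x v + indicator A v *\<^sub>R fun_of z v)"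
    unfolding set_lebesgue_integral_def
    using fun_of_add[of x z] by (intro integral_cong_AE m borel_measurable_add) (auto simp: scaleR_right_distrib elim!: eventually_mono)
  then show "(LINT v:A|lebesgue. fun_of (x + z) v) =
      (LINT v:A|lebesgue. fun_of x v) + (LINT v:A|lebesgue. fun_of z v)"
    using i by (simp add: set_lebesgue_integral_def)
  have "(LINT v:A|lebesgue. fun_of (c *\<^sub>R x) v) =
      (LINT v|lebesgue. c *\<^sub>R (indicator A v *\<^sub>R fun_of x v))"
    unfolding set_lebesgue_integral_def
    using fun_of_scaleR[of c x] by (intro integral_cong_AE m borel_measurable_scaleR borel_measurable_const) (auto elim!: eventually_mono)
  then show "(LINT v:A|lebesgue. fun_of (c *\<^sub>R x) v) = c *\<^sub>R (LINT v:A|lebesgue. fun_of x v)"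
    by (simp only: set_lebesgue_integral_def integral_scaleR_right)
  have "norm (LINT v:A|lebesgue. fun_of x v) \<le> (LINT v|lebesgue. norm (indicator A v *\<^sub>R fun_of x v))"
    unfolding set_lebesgue_integral_def by (rule integral_norm_bound)
  also have "\<dots> \<le> (LINT v|lebesgue. norm (fun_of x v))"
    by (intro integral_mono integrable_norm i integrable_fun_of) (simp add: indicator_def)
  finally show "norm (LINT v:A|lebesgue. fun_of x v) \<le> norm x * 1" by (simp add: norm_fun_of)
qed

lemma bounded_linear_cell_avg: "bounded_linear (cell_avg a b n i)"
proof -
  have "bounded_linear (\<lambda>x. LINT v:{node a b n (i - 1)..node a b n i}|lebesgue. fun_of x v)"
    by (rule bounded_linear_set_integral) simp
  from bounded_linear_compose[OF bounded_linear_divide[of "of_real (mesh a b n)"] this]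
  show ?thesis unfolding cell_avg_def .
qed

lemma fun_of_sum:
  assumes "finite I"
  shows "AE t in lebesgue. fun_of (\<Sum>i\<in>I. x i) t = (\<Sum>i\<in>I. fun_of (x i) t)"
  using assms
proof induction
  case empty
  show ?case using fun_of_diff[of 0 0] by simp
next
  case (insert j I)
  from insert.IH fun_of_add[of "x j" "\<Sum>i\<in>I. x i"]
  have "AE t in lebesgue. fun_of (x j + (\<Sum>i\<in>I. x i)) t = fun_of (x j) t + (\<Sum>i\<in>I. fun_of (x i) t)"
    by eventually_elim simp
  then show ?case using insert.hyps by simp
qed

text \<open>Separates coefficients from step functions, with real and imaginary parts apart because
  finite rank maps use real functionals. No point of the interval has index 0, so that summand
  vanishes.\<close>

lemma cell_mean_expansion:
  assumes ab: "a < b" "n \<ge> 1"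
  defines "e \<equiv> \<lambda>i z. class_on a b (\<lambda>t. if cell a b n t = i then z else 0)"
  shows "cell_mean a b n x =
    (\<Sum>i\<le>n. Re (cell_avg a b n i x) *\<^sub>R e i 1 + Im (cell_avg a b n i x) *\<^sub>R e i \<i>)"
proof (rule L1_eqI)
  let ?A = "\<lambda>i. cell_avg a b n i x"
  let ?T = "\<lambda>i. Re (?A i) *\<^sub>R e i 1 + Im (?A i) *\<^sub>R e i \<i>"
  have e: "AE t in lebesgue. fun_of (e i z) t = ext0 a b (\<lambda>t. if cell a b n t = i then z else 0) t" for i z
    unfolding e_def by (rule fun_of_class_on) (rule set_integrable_step[OF ab, of "\<lambda>j. if j = i then z else 0"])
  have T: "AE t in lebesgue. fun_of (?T i) t = ext0 a b (\<lambda>t. if cell a b n t = i then ?A i else 0) t" for i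
    using e[of i 1] e[of i \<i>] fun_of_add[of "Re (?A i) *\<^sub>R e i 1" "Im (?A i) *\<^sub>R e i \<i>"]
      fun_of_scaleR[of "Re (?A i)" "e i 1"] fun_of_scaleR[of "Im (?A i)" "e i \<i>"]
    by eventually_elim (simp add: ext0_def complex_eq_iff)
  then have T': "AE t in lebesgue. \<forall>i. fun_of (?T i) t = ext0 a b (\<lambda>t. if cell a b n t = i then ?A i else 0) t"
    by (simp add: AE_all_countable)
  show "AE t in lebesgue. fun_of (cell_mean a b n x) t = fun_of (\<Sum>i\<le>n. ?T i) t"
    using fun_of_sum[of "{..n}" ?T, OF finite_atMost] T' fun_of_class_on[OF set_integrable_step[OF ab, of "\<lambda>i. ?A i"]]
    unfolding cell_mean_eq
  proof eventually_elim
    case (elim t)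
    show ?case
    proof (cases "t \<in> {a..b}")
      case True
      then show ?thesis using elim cell_bounds(2)[OF ab True] by (simp add: ext0_def)
    next
      case False
      then have "ext0 a b f t = 0" for f :: "real \<Rightarrow> complex" unfolding ext0_def by (rule if_not_P)
      then show ?thesis using elim by simp
    qed
  qed
qed

lemma finite_rank_cell_mean:
  assumes ab: "a < b" "n \<ge> 1"
  shows "finite_rank (cell_mean a b n)"
  unfolding cell_mean_expansion[OF ab, abs_def]
  by (intro finite_rank_sum finite_rank_add finite_rank_one bounded_linear_compose[OF bounded_linear_Re]
      bounded_linear_compose[OF bounded_linear_Im] bounded_linear_cell_avg) simp

lemma cell_mean_in_L1_on: "cell_mean a b n x \<in> L1_on a b"
  unfolding cell_mean_eq by (rule class_on_in_L1_on)

text \<open>All cells involved lie inside the interval. This extends estimates from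
  \<open>L1_on a b\<close> to the whole type.\<close>

lemma cell_mean_restr:
  assumes ab: "a < b" "n \<ge> 1"
  shows "cell_mean a b n (restr a b x) = cell_mean a b n x"
proof -
  have "cell_avg a b n (cell a b n t) (restr a b x) = cell_avg a b n (cell a b n t) x" if t: "t \<in> {a..b}" for t
  proof -
    let ?I = "{node a b n (cell a b n t - 1)..node a b n (cell a b n t)}"
    have "AE v in lebesgue. indicator ?I v *\<^sub>R fun_of (restr a b x) v = indicator ?I v *\<^sub>R fun_of x v"
      using fun_of_restr[of a b x] cell_bounds(6)[OF ab t]
      by (auto simp: ext0_def indicator_def elim!: eventually_mono)
    then have "(LINT v:?I|lebesgue. fun_of (restr a b x) v) = (LINT v:?I|lebesgue. fun_of x v)"
      unfolding set_lebesgue_integral_def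
      using set_integrable_fun_of[of ?I] unfolding set_integrable_def
      by (intro integral_cong_AE borel_measurable_integrable) auto
    then show ?thesis by (simp add: cell_avg_def)
  qed
  then have "ext0 a b (\<lambda>t. cell_avg a b n (cell a b n t) (restr a b x)) =
      ext0 a b (\<lambda>t. cell_avg a b n (cell a b n t) x)"
    by (simp add: ext0_def fun_eq_iff)
  then show ?thesis unfolding cell_mean_eq class_on_def by simp
qed

lemma nn_norm_fun_of: "ennreal (norm x) = (\<integral>\<^sup>+t. ennreal (norm (fun_of x t)) \<partial>lebesgue)"
  unfolding norm_fun_of
  by (rule nn_integral_eq_integral[symmetric]) (simp_all add: integrable_fun_of)

section \<open>Cell means approximate the identity\<close>

text \<open>The difference is the mean of p v - p t over the cell, and v = t + u with u at most h in
  size, as both points share a cell. The window for u no longer depends on t, which prepares an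
  exchange of integrals.\<close>

lemma norm_average_minus_value_le:
  fixes p :: "real \<Rightarrow> complex"
  assumes p: "p \<in> borel_measurable borel" "integrable lborel p"
    and h: "h > 0" "d - c = h" and t: "c \<le> t" "t \<le> d"
  shows "ennreal (norm ((LINT v:{c..d}|lborel. p v) / of_real h - p t)) \<le>
    ennreal (1 / h) * (\<integral>\<^sup>+u\<in>{-h..h}. ennreal (norm (p (t + u) - p t)) \<partial>lborel)"
proof -
  note pm[measurable] = p(1)
  have i1: "integrable lborel (\<lambda>v. indicator {c..d} v *\<^sub>R p v)"
    by (rule integrable_mult_indicator[OF _ p(2)]) simp
  have i2: "integrable lborel (\<lambda>v. indicator {c..d} v *\<^sub>R p t)"
    using h by (intro integrable_scaleR_left integrable_real_indicator) (auto simp: emeasure_lborel_Icc_eq)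
  have "(LINT v|lborel. indicator {c..d} v *\<^sub>R p t) = h *\<^sub>R p t"
    using h by (subst integral_scaleR_left) (auto simp: emeasure_lborel_Icc_eq intro!: integrable_real_indicator)
  then have "(LINT v:{c..d}|lborel. p v) / of_real h - p t =
      (LINT v|lborel. indicator {c..d} v *\<^sub>R p v - indicator {c..d} v *\<^sub>R p t) / of_real h"
    using i1 i2 h by (simp add: set_lebesgue_integral_def diff_divide_distrib scaleR_conv_of_real)
  also have "norm \<dots> = (1 / h) * norm (LINT v|lborel. indicator {c..d} v *\<^sub>R p v - indicator {c..d} v *\<^sub>R p t)"
    using h by (simp add: norm_divide)
  finally have "ennreal (norm ((LINT v:{c..d}|lborel. p v) / of_real h - p t)) =
      ennreal (1 / h) * ennreal (norm (LINT v|lborel. indicator {c..d} v *\<^sub>R p v - indicator {c..d} v *\<^sub>R p t))"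
    using h by (simp only: ennreal_mult'[OF norm_ge_zero] ennreal_mult[OF _ norm_ge_zero] zero_le_divide_1_iff less_imp_le)
  also have "ennreal (norm (LINT v|lborel. indicator {c..d} v *\<^sub>R p v - indicator {c..d} v *\<^sub>R p t)) \<le>
      (\<integral>\<^sup>+v. ennreal (norm (indicator {c..d} v *\<^sub>R p v - indicator {c..d} v *\<^sub>R p t)) \<partial>lborel)"
    by (rule integral_norm_bound_ennreal[OF Bochner_Integration.integrable_diff[OF i1 i2]])
  also have "\<dots> = (\<integral>\<^sup>+u. ennreal (norm (indicator {c..d} (u + t) *\<^sub>R p (u + t) - indicator {c..d} (u + t) *\<^sub>R p t)) \<partial>lborel)"
    by (rule nn_integral_translate[symmetric]) measurable
  also have "\<dots> \<le> (\<integral>\<^sup>+u\<in>{-h..h}. ennreal (norm (p (t + u) - p t)) \<partial>lborel)"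
    using h t by (intro nn_integral_mono) (auto simp: indicator_def add.commute)
  finally show ?thesis by (simp add: mult_left_mono)
qed

text \<open>Integrating over t and exchanging integrals leaves for each u a shift integral bounded
  by \<open>w1\<close>; the window of length 2 h against the factor 1 / h produces the 2.\<close>

lemma norm_cell_mean_diff_le:
  assumes ab: "a < b" "n \<ge> 1" and x: "x \<in> L1_on a b"
  shows "norm (cell_mean a b n x - x) \<le> 2 * w1 a b x (mesh a b n)"
proof -
  define h where "h = mesh a b n"
  have h: "h > 0" using mesh_pos[OF ab] by (simp add: h_def)
  define W where "W = w1 a b x h"
  have W: "W \<ge> 0" by (simp add: W_def w1_nonneg)
  obtain p where p: "p \<in> borel_measurable borel" "integrable lborel p"
      "AE t in lborel. ext0 a b (fun_of x) t = p t" "(LINT t|lborel. norm (p t)) \<le> norm x"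
    using L1_borel_representative[of a b x] by blast
  note pm[measurable] = p(1)
  let ?A = "\<lambda>t. cell_avg a b n (cell a b n t) x"
  have avg: "?A t = (LINT v:{node a b n (cell a b n t - 1)..node a b n (cell a b n t)}|lborel. p v) / of_real h"
    if t: "t \<in> {a..b}" for t
  proof -
    let ?I = "{node a b n (cell a b n t - 1)..node a b n (cell a b n t)}"
    have "AE v in lborel. indicator ?I v *\<^sub>R fun_of x v = indicator ?I v *\<^sub>R p v"
      using p(3) cell_bounds(6)[OF ab t]
      by (auto simp: ext0_def indicator_def elim!: eventually_mono)
    then have ae: "AE v in lebesgue. indicator ?I v *\<^sub>R fun_of x v = indicator ?I v *\<^sub>R p v"
      by (simp add: AE_completion_iff)
    have m: "(\<lambda>v. indicator ?I v *\<^sub>R p v) \<in> borel_measurable lborel" by measurable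
    have "(LINT v:?I|lebesgue. fun_of x v) = (LINT v|lebesgue. indicator ?I v *\<^sub>R p v)"
      unfolding set_lebesgue_integral_def
      using set_integrable_fun_of[of ?I] unfolding set_integrable_def
      by (intro integral_cong_AE[OF _ measurable_completion[OF m] ae] borel_measurable_integrable) auto
    also have "\<dots> = (LINT v:?I|lborel. p v)"
      unfolding set_lebesgue_integral_def using m by (rule integral_completion)
    finally show ?thesis by (simp add: cell_avg_def h_def)
  qed
  have "AE t in lborel. norm (fun_of (cell_mean a b n x - x) t) = norm (?A t - p t) * indicator {a..b} t"
  proof -
    have "AE t in lebesgue. fun_of (cell_mean a b n x) t = ext0 a b ?A t"
      unfolding cell_mean_eq by (rule fun_of_class_on[OF set_integrable_step[OF ab]])
    then have "AE t in lborel. fun_of (cell_mean a b n x) t = ext0 a b ?A t"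
        "AE t in lborel. ext0 a b (fun_of x) t = fun_of x t"
        "AE t in lborel. fun_of (cell_mean a b n x - x) t = fun_of (cell_mean a b n x) t - fun_of x t"
      using L1_on_ext0[OF x] fun_of_diff[of "cell_mean a b n x" x] by (simp_all add: AE_completion_iff)
    then show ?thesis using p(3) by eventually_elim (auto simp: ext0_def)
  qed
  then have "ennreal (norm (cell_mean a b n x - x)) = (\<integral>\<^sup>+t. ennreal (norm (?A t - p t) * indicator {a..b} t) \<partial>lborel)"
    unfolding nn_norm_fun_of nn_integral_completion by (intro nn_integral_cong_AE) (auto elim!: eventually_mono)
  also have "\<dots> \<le> (\<integral>\<^sup>+t. ennreal (1 / h) * (\<integral>\<^sup>+u. ennreal (norm (p (t + u) - p t)) * indicator {a..b} t * indicator {-h..h} u \<partial>lborel) \<partial>lborel)"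
  proof (rule nn_integral_mono)
    fix t
    show "ennreal (norm (?A t - p t) * indicator {a..b} t) \<le>
      ennreal (1 / h) * (\<integral>\<^sup>+u. ennreal (norm (p (t + u) - p t)) * indicator {a..b} t * indicator {-h..h} u \<partial>lborel)"
    proof (cases "t \<in> {a..b}")
      case True
      show ?thesis
        using norm_average_minus_value_le[OF p(1,2) h cell_bounds(5)[OF ab True, folded h_def] cell_bounds(3,4)[OF ab True]]
        using True by (simp add: avg)
    qed simp
  qed
  also have "\<dots> = ennreal (1 / h) * (\<integral>\<^sup>+t. \<integral>\<^sup>+u. ennreal (norm (p (t + u) - p t)) * indicator {a..b} t * indicator {-h..h} u \<partial>lborel \<partial>lborel)"
    by (rule nn_integral_cmult) measurable
  also have "(\<integral>\<^sup>+t. \<integral>\<^sup>+u. ennreal (norm (p (t + u) - p t)) * indicator {a..b} t * indicator {-h..h} u \<partial>lborel \<partial>lborel) =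
      (\<integral>\<^sup>+u. \<integral>\<^sup>+t. ennreal (norm (p (t + u) - p t)) * indicator {a..b} t * indicator {-h..h} u \<partial>lborel \<partial>lborel)"
    by (rule lborel_pair.Fubini'[symmetric]) measurable
  also have "\<dots> \<le> (\<integral>\<^sup>+u. ennreal W * indicator {-h..h} u \<partial>lborel)"
  proof (rule nn_integral_mono)
    fix u
    show "(\<integral>\<^sup>+t. ennreal (norm (p (t + u) - p t)) * indicator {a..b} t * indicator {-h..h} u \<partial>lborel) \<le> ennreal W * indicator {-h..h} u"
    proof (cases "u \<in> {-h..h}")
      case True
      then have "\<bar>u\<bar> \<le> \<bar>h\<bar>" by auto
      from ennreal_leI[OF w1_upper[OF this, of a b x]] True show ?thesis
        unfolding L1_shift_integral(1)[OF p(1-3)] by (simp add: W_def)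
    qed simp
  qed
  also have "\<dots> = ennreal (W * (2 * h))"
    using h W by (simp add: nn_integral_cmult_indicator emeasure_lborel_Icc_eq ennreal_mult)
  finally have "ennreal (norm (cell_mean a b n x - x)) \<le> ennreal (1 / h) * ennreal (W * (2 * h))"
    by (simp add: mult_left_mono)
  also have "\<dots> = ennreal (2 * W)" using h W by (simp flip: ennreal_mult)
  finally show ?thesis using W by (simp add: W_def h_def)
qed

text \<open>6 = 4 + 2: the restricted class costs twice \<open>w1\<close>, hence 4 norms, and
  removing the part outside the interval at most 2 more.\<close>

lemma norm_cell_mean_diff_le_norm:
  assumes ab: "a < b" "n \<ge> 1"
  shows "norm (cell_mean a b n x - x) \<le> 6 * norm x"
proof -
  have "norm (cell_mean a b n (restr a b x) - restr a b x) \<le> 4 * norm (restr a b x)"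
    using norm_cell_mean_diff_le[OF ab restr_in_L1_on[of a b x]] w1_le_norm[of a b "restr a b x" "mesh a b n"]
    by linarith
  then show ?thesis
    using norm_triangle_ineq[of "cell_mean a b n x - restr a b x" "restr a b x - x"]
      norm_triangle_ineq4[of "restr a b x" x] norm_restr_le[of a b x]
    unfolding cell_mean_restr[OF ab] by simp
qed

lemma mesh_tendsto_0: "(\<lambda>n. mesh a b n) \<longlonglongrightarrow> 0"
  unfolding mesh_def by (rule lim_const_over_n)

lemma w1_mesh_tendsto_0: "(\<lambda>n. w1 a b x (mesh a b n)) \<longlonglongrightarrow> 0"
proof (rule LIMSEQ_I)
  fix e :: real assume "e > 0"
  then obtain \<delta> where \<delta>: "\<delta> > 0" "\<And>h. \<bar>h\<bar> \<le> \<delta> \<Longrightarrow> w1 a b x h \<le> e / 2"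
    using w1_small[of "e / 2" a b x] by auto
  obtain n0 where n0: "\<And>n. n \<ge> n0 \<Longrightarrow> \<bar>mesh a b n\<bar> < \<delta>"
    using LIMSEQ_D[OF mesh_tendsto_0 \<delta>(1), of a b] by auto
  have "norm (w1 a b x (mesh a b n) - 0) < e" if "n \<ge> n0" for n
    using \<delta>(2)[OF less_imp_le[OF n0[OF that]]] w1_nonneg[of a b x "mesh a b n"] \<open>e > 0\<close> by simp
  then show "\<exists>n0. \<forall>n\<ge>n0. norm (w1 a b x (mesh a b n) - 0) < e" by blast
qed

lemma cell_mean_tendsto:
  assumes "a < b" "x \<in> L1_on a b"
  shows "(\<lambda>n. cell_mean a b n x) \<longlonglongrightarrow> x"
proof (rule LIM_zero_cancel, rule Lim_null_comparison)
  show "\<forall>\<^sub>F n in sequentially. norm (cell_mean a b n x - x) \<le> 2 * w1 a b x (mesh a b n)"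
    using norm_cell_mean_diff_le[OF assms(1) _ assms(2)] by (auto simp: eventually_sequentially)
  show "(\<lambda>n. 2 * w1 a b x (mesh a b n)) \<longlonglongrightarrow> 0"
    using w1_mesh_tendsto_0 by (rule tendsto_mult_right_zero)
qed

section \<open>Integral operators\<close>

lemma AE_lborel_pair:
  fixes P :: "real \<times> real \<Rightarrow> bool"
  assumes "AE z in lborel. P z"
  shows "AE s in lborel. AE t in lborel. P (s, t)" "AE t in lborel. AE s in lborel. P (s, t)"
proof -
  have P: "AE z in lborel \<Otimes>\<^sub>M lborel. P z" using assms by (simp only: lborel_prod)
  then show "AE s in lborel. AE t in lborel. P (s, t)" by (rule lborel_pair.AE_pair)
  have "AE z in distr (lborel \<Otimes>\<^sub>M lborel) (lborel \<Otimes>\<^sub>M lborel) (\<lambda>(x, y). (y, x)). P z"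
    by (subst lborel_pair.distr_pair_swap[symmetric]) (rule P)
  from AE_distrD[OF _ this] have "AE z in lborel \<Otimes>\<^sub>M lborel. P (case z of (x, y) \<Rightarrow> (y, x))"
    by simp
  from lborel_pair.AE_pair[OF this] show "AE t in lborel. AE s in lborel. P (s, t)" by simp
qed

text \<open>The mass of a function supported in \<open>[a, b]\<close> is read off from its increments: marching from
  beyond \<open>b\<close> towards \<open>a\<close> in steps of length \<open>h\<close>, the mass grows by at most \<open>B\<close> per step.\<close>

lemma mass_le_increments:
  fixes q :: "real \<Rightarrow> complex"
  assumes q[measurable]: "q \<in> borel_measurable borel" and supp: "\<And>s. s \<notin> {a..b} \<Longrightarrow> q s = 0"
    and inc: "(\<integral>\<^sup>+s\<in>{a..b}. ennreal (norm (q (s + h) - q s)) \<partial>lborel) \<le> B"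
    and k: "real k * h > b - a"
  shows "(\<integral>\<^sup>+s. ennreal (norm (q s)) \<partial>lborel) \<le> of_nat k * B"
proof -
  have "(\<integral>\<^sup>+s. ennreal (norm (q s)) * indicator {b - real j * h<..} s \<partial>lborel) \<le> of_nat j * B" for j
  proof (induction j)
    case 0
    have "(\<integral>\<^sup>+s. ennreal (norm (q s)) * indicator {b - real 0 * h<..} s \<partial>lborel) = (\<integral>\<^sup>+s. 0 \<partial>(lborel :: real measure))"
      using supp by (intro nn_integral_cong) (auto simp: indicator_def)
    then show ?case by simp
  next
    case (Suc j)
    let ?f = "\<lambda>s. ennreal (norm (q s)) * indicator {b - real j * h<..} s"
    have "(\<integral>\<^sup>+s. ennreal (norm (q s)) * indicator {b - real (Suc j) * h<..} s \<partial>lborel) \<le>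
        (\<integral>\<^sup>+s. ennreal (norm (q (s + h) - q s)) * indicator {a..b} s + ?f (s + h) \<partial>lborel)"
    proof (rule nn_integral_mono)
      fix s
      show "ennreal (norm (q s)) * indicator {b - real (Suc j) * h<..} s \<le>
          ennreal (norm (q (s + h) - q s)) * indicator {a..b} s + ?f (s + h)"
      proof (cases "s \<in> {a..b} \<and> s > b - real (Suc j) * h")
        case True
        then have "s + h > b - real j * h" by (simp add: algebra_simps)
        moreover have "norm (q s) \<le> norm (q (s + h) - q s) + norm (q (s + h))"
          using norm_triangle_ineq4[of "q (s + h)" "q (s + h) - q s"] by simp
        ultimately show ?thesis using True by (simp add: ennreal_leI flip: ennreal_plus)
      next
        case False
        then have "ennreal (norm (q s)) * indicator {b - real (Suc j) * h<..} s = 0"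
          using supp[of s] by (auto simp: indicator_def)
        then show ?thesis by (rule ord_eq_le_trans) simp
      qed
    qed
    also have "\<dots> = (\<integral>\<^sup>+s\<in>{a..b}. ennreal (norm (q (s + h) - q s)) \<partial>lborel) + (\<integral>\<^sup>+s. ?f (s + h) \<partial>lborel)"
      by (rule nn_integral_add) measurable
    also have "(\<integral>\<^sup>+s. ?f (s + h) \<partial>lborel) = (\<integral>\<^sup>+s. ?f s \<partial>lborel)"
      by (rule nn_integral_translate) measurable
    also have "(\<integral>\<^sup>+s\<in>{a..b}. ennreal (norm (q (s + h) - q s)) \<partial>lborel) + (\<integral>\<^sup>+s. ?f s \<partial>lborel) \<le> B + of_nat j * B"
      by (rule add_mono[OF inc Suc.IH])
    finally show ?case by (simp add: distrib_right)
  qed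
  moreover have "(\<integral>\<^sup>+s. ennreal (norm (q s)) \<partial>lborel) =
      (\<integral>\<^sup>+s. ennreal (norm (q s)) * indicator {b - real k * h<..} s \<partial>lborel)"
  proof (rule nn_integral_cong)
    fix s
    show "ennreal (norm (q s)) = ennreal (norm (q s)) * indicator {b - real k * h<..} s"
      using supp[of s] k by (cases "s \<in> {a..b}") (auto simp: indicator_def)
  qed
  ultimately show ?thesis by simp
qed

text \<open>Tonelli: the operator norm on integrable functions is controlled by the masses of the
  columns, and exceptional columns form a null set of t.\<close>

lemma kernel_operator_bound:
  fixes k :: "real \<times> real \<Rightarrow> complex" and g :: "real \<Rightarrow> complex"
  assumes k[measurable]: "k \<in> borel_measurable borel" and g: "g \<in> borel_measurable borel" "integrable lborel g"
    and c: "c \<ge> 0" and mass: "AE t in lborel. (\<integral>\<^sup>+s. ennreal (norm (k (s, t))) \<partial>lborel) \<le> ennreal c"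
  shows "AE s in lborel. integrable lborel (\<lambda>t. k (s, t) * g t)"
    and "integrable lborel (\<lambda>s. LINT t|lborel. k (s, t) * g t)"
    and "(\<lambda>s. LINT t|lborel. k (s, t) * g t) \<in> borel_measurable borel"
    and "(\<integral>\<^sup>+s. ennreal (norm (LINT t|lborel. k (s, t) * g t)) \<partial>lborel) \<le> ennreal (c * (LINT t|lborel. norm (g t)))"
proof -
  note gm[measurable] = g(1)
  have k'[measurable]: "k \<in> borel_measurable (borel \<Otimes>\<^sub>M borel)" using k by (simp add: borel_prod)
  let ?F = "\<lambda>z. k z * g (snd z)"
  have Fm: "?F \<in> borel_measurable (lborel \<Otimes>\<^sub>M lborel)" by measurable
  have "(\<integral>\<^sup>+s. \<integral>\<^sup>+t. ennreal (norm (k (s, t) * g t)) \<partial>lborel \<partial>lborel) =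
      (\<integral>\<^sup>+t. \<integral>\<^sup>+s. ennreal (norm (k (s, t) * g t)) \<partial>lborel \<partial>lborel)"
    by (rule lborel_pair.Fubini'[symmetric]) measurable
  also have "\<dots> \<le> (\<integral>\<^sup>+t. ennreal c * ennreal (norm (g t)) \<partial>lborel)"
  proof (rule nn_integral_mono_AE)
    show "AE t in lborel. (\<integral>\<^sup>+s. ennreal (norm (k (s, t) * g t)) \<partial>lborel) \<le> ennreal c * ennreal (norm (g t))"
      using mass
    proof eventually_elim
      case (elim t)
      have "(\<integral>\<^sup>+s. ennreal (norm (k (s, t) * g t)) \<partial>lborel) = (\<integral>\<^sup>+s. ennreal (norm (k (s, t))) * ennreal (norm (g t)) \<partial>lborel)"
        by (simp add: norm_mult ennreal_mult)
      also have "\<dots> = (\<integral>\<^sup>+s. ennreal (norm (k (s, t))) \<partial>lborel) * ennreal (norm (g t))"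
        by (rule nn_integral_multc) measurable
      also have "\<dots> \<le> ennreal c * ennreal (norm (g t))" using elim by (rule mult_right_mono) simp
      finally show ?case .
    qed
  qed
  also have "\<dots> = ennreal c * (\<integral>\<^sup>+t. ennreal (norm (g t)) \<partial>lborel)" by (rule nn_integral_cmult) measurable
  also have "\<dots> = ennreal (c * (LINT t|lborel. norm (g t)))"
    using g(2) c by (simp add: nn_integral_eq_integral ennreal_mult)
  finally have total: "(\<integral>\<^sup>+s. \<integral>\<^sup>+t. ennreal (norm (k (s, t) * g t)) \<partial>lborel \<partial>lborel) \<le> ennreal (c * (LINT t|lborel. norm (g t)))" .
  have F: "integrable (lborel \<Otimes>\<^sub>M lborel) ?F"
  proof (rule integrableI_bounded[OF Fm])
    have "(\<integral>\<^sup>+z. ennreal (norm (?F z)) \<partial>(lborel \<Otimes>\<^sub>M lborel)) = (\<integral>\<^sup>+s. \<integral>\<^sup>+t. ennreal (norm (k (s, t) * g t)) \<partial>lborel \<partial>lborel)"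
      using lborel.nn_integral_fst[OF measurable_compose[OF Fm, of "\<lambda>w. ennreal (norm w)" borel]] by simp
    also have "\<dots> < \<infinity>" using total by (rule le_less_trans) simp
    finally show "(\<integral>\<^sup>+z. ennreal (norm (?F z)) \<partial>(lborel \<Otimes>\<^sub>M lborel)) < \<infinity>" .
  qed
  show ae: "AE s in lborel. integrable lborel (\<lambda>t. k (s, t) * g t)"
    using lborel_pair.AE_integrable_fst'[OF F] by simp
  show "integrable lborel (\<lambda>s. LINT t|lborel. k (s, t) * g t)"
    using lborel_pair.integrable_fst'[OF F] by simp
  then show "(\<lambda>s. LINT t|lborel. k (s, t) * g t) \<in> borel_measurable borel"
    using borel_measurable_integrable by fastforce
  have "(\<integral>\<^sup>+s. ennreal (norm (LINT t|lborel. k (s, t) * g t)) \<partial>lborel) \<le>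
      (\<integral>\<^sup>+s. \<integral>\<^sup>+t. ennreal (norm (k (s, t) * g t)) \<partial>lborel \<partial>lborel)"
    using ae by (intro nn_integral_mono_AE) (auto intro: integral_norm_bound_ennreal elim!: eventually_mono)
  also note total
  finally show "(\<integral>\<^sup>+s. ennreal (norm (LINT t|lborel. k (s, t) * g t)) \<partial>lborel) \<le> ennreal (c * (LINT t|lborel. norm (g t)))" .
qed

section \<open>Kernels with uniformly small column increments\<close>

text \<open>\<open>H'\<close> is a Borel version of \<open>H\<close> cut off outside the square.
  Agreement almost everywhere transfers column conditions only to almost all t, which is enough
  under an integral in t.\<close>

locale L1_kernel =
  fixes a b :: real and H H' :: "real \<times> real \<Rightarrow> complex" and c\<^sub>H :: real
  assumes ab: "a < b"
    and H'_measurable [measurable]: "H' \<in> borel_measurable borel"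
    and H'_support: "\<And>z. z \<notin> {a..b} \<times> {a..b} \<Longrightarrow> H' z = 0"
    and H'_eq: "AE s in lborel. AE t in lborel. (s, t) \<in> {a..b} \<times> {a..b} \<longrightarrow> H (s, t) = H' (s, t)"
    and c\<^sub>H_nonneg: "c\<^sub>H \<ge> 0"
    and mass: "AE t in lborel. (\<integral>\<^sup>+s. ennreal (norm (H' (s, t))) \<partial>lborel) \<le> ennreal c\<^sub>H"
    and shift: "\<And>\<omega>. \<omega> > 0 \<Longrightarrow> \<exists>\<delta>>0. \<forall>u. \<bar>u\<bar> \<le> \<delta> \<longrightarrow>
      (AE t in lborel. (\<integral>\<^sup>+s\<in>{a..b}. ennreal (norm (H' (s + u, t) - H' (s, t))) \<partial>lborel) \<le> ennreal \<omega>)"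

text \<open>The modulus \<open>w_H\<close> gives \<open>shift\<close>, and \<open>mass\<close>
  follows from it by \<open>mass_le_increments\<close>, since the columns have bounded
  support.\<close>

lemma L1_kernel_exists:
  fixes H :: "real \<times> real \<Rightarrow> complex"
  assumes ab: "a < b" and H: "H \<in> borel_measurable (lebesgue_on ({a..b} \<times> {a..b}))"
    and wH: "(w_H a b H \<longlongrightarrow> 0) (at 0)"
  shows "\<exists>H' c\<^sub>H. L1_kernel a b H H' c\<^sub>H"
proof -
  let ?D = "{a..b} \<times> {a..b}"
  have Db: "?D \<in> sets borel" by (intro borel_closed closed_Times) auto
  have "(\<lambda>z. if z \<in> ?D then H z else 0) \<in> borel_measurable lebesgue"
    using H by (subst borel_measurable_if) (auto intro!: lmeasurable_compact fmeasurableD compact_Times)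
  then obtain G where G: "G \<in> borel_measurable borel" "AE z in lborel. (if z \<in> ?D then H z else 0) = G z"
    using complex_borel_representative by blast
  \<comment> \<open>\<open>G\<close> vanishes outside the square only almost everywhere; the
    indicator makes the support condition hold at every point.\<close>
  define H' where "H' z = indicator ?D z *\<^sub>R G z" for z
  have H'm[measurable]: "H' \<in> borel_measurable borel"
    unfolding H'_def using Db G(1) by (intro borel_measurable_scaleR borel_measurable_indicator)
  have supp: "H' z = 0" if "z \<notin> ?D" for z using that by (simp add: H'_def)
  have eq: "AE z in lborel. z \<in> ?D \<longrightarrow> H z = H' z"
    using G(2) by eventually_elim (auto simp: H'_def)
  have w: "AE t in lborel. (\<integral>\<^sup>+s\<in>{a..b}. ennreal (norm (H' (s + u, t) - H' (s, t))) \<partial>lborel) \<le> w_H a b H u" for u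
    using AE_lborel_pair(2)[OF eq]
  proof eventually_elim
    case (elim t)
    show ?case
    proof (cases "t \<in> {a..b}")
      case True
      let ?e = "ext0 a b (\<lambda>s. H (s, t))"
      have e: "AE s in lborel. ?e s = H' (s, t)"
        using elim by eventually_elim (use True in \<open>auto simp: ext0_def supp\<close>)
      have "(\<integral>\<^sup>+s\<in>{a..b}. ennreal (norm (H' (s + u, t) - H' (s, t))) \<partial>lborel) =
          (\<integral>\<^sup>+s\<in>{a..b}. ennreal (norm (?e (s + u) - ?e s)) \<partial>lborel)"
        by (rule nn_integral_cong_AE) (use e AE_lborel_translate[OF e, of u] in eventually_elim, simp)
      also have "\<dots> \<le> w_H a b H u"
        unfolding w_H_def nn_integral_completion using True by (rule SUP_upper)
      finally show ?thesis .
    next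
      case False
      then have "H' (s, t) = 0" for s by (intro supp) auto
      then show ?thesis by simp
    qed
  qed
  have shift: "\<exists>\<delta>>0. \<forall>u. \<bar>u\<bar> \<le> \<delta> \<longrightarrow>
      (AE t in lborel. (\<integral>\<^sup>+s\<in>{a..b}. ennreal (norm (H' (s + u, t) - H' (s, t))) \<partial>lborel) \<le> ennreal \<omega>)"
    if "\<omega> > 0" for \<omega>
  proof -
    have "\<forall>\<^sub>F h in at 0. w_H a b H h < ennreal \<omega>"
      using that by (intro order_tendstoD(2)[OF wH]) simp
    then obtain d where d: "d > 0" "\<And>h. h \<noteq> 0 \<Longrightarrow> \<bar>h\<bar> < d \<Longrightarrow> w_H a b H h < ennreal \<omega>"
      unfolding eventually_at by (auto simp: dist_norm)
    have "AE t in lborel. (\<integral>\<^sup>+s\<in>{a..b}. ennreal (norm (H' (s + u, t) - H' (s, t))) \<partial>lborel) \<le> ennreal \<omega>"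
      if u: "\<bar>u\<bar> \<le> d / 2" for u
    \<comment> \<open>The limit at 0 ignores the value at 0 itself, where the increments vanish
      trivially.\<close>
    proof (cases "u = 0")
      case False
      then have "w_H a b H u \<le> ennreal \<omega>" using d(2)[of u] u d(1) by simp
      then show ?thesis using w[of u] by (auto elim!: eventually_mono)
    qed simp
    then show ?thesis using d(1) by (intro exI[of _ "d / 2"]) simp
  qed
  from shift[OF zero_less_one] obtain h where h0: "h > 0 \<and> (\<forall>u. \<bar>u\<bar> \<le> h \<longrightarrow>
      (AE t in lborel. (\<integral>\<^sup>+s\<in>{a..b}. ennreal (norm (H' (s + u, t) - H' (s, t))) \<partial>lborel) \<le> ennreal 1))" ..
  then have h: "h > 0" "AE t in lborel. (\<integral>\<^sup>+s\<in>{a..b}. ennreal (norm (H' (s + h, t) - H' (s, t))) \<partial>lborel) \<le> ennreal 1"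
    by simp_all
  \<comment> \<open>This many steps of length h cross the interval, each adding mass at most 1, so k
    serves as the mass bound.\<close>
  obtain k :: nat where k: "real k * h > b - a" using reals_Archimedean3[OF h(1)] by blast
  have mass: "AE t in lborel. (\<integral>\<^sup>+s. ennreal (norm (H' (s, t))) \<partial>lborel) \<le> ennreal (real k)"
    using h(2)
  proof eventually_elim
    case (elim t)
    have "(\<lambda>s. H' (s, t)) \<in> borel_measurable borel"
      by (rule measurable_compose[OF _ H'm]) (simp add: borel_prod[symmetric])
    moreover have "H' (s, t) = 0" if "s \<notin> {a..b}" for s using that by (intro supp) auto
    ultimately show ?case
      using mass_le_increments[OF _ _ elim k] by (simp add: ennreal_of_nat_eq_real_of_nat)
  qed
  have "L1_kernel a b H H' (real k)"
    by (unfold_locales) (use ab H'm supp AE_lborel_pair(1)[OF eq] mass shift in auto)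
  then show ?thesis by blast
qed

text \<open>With the density \<open>g\<close> left free, \<open>op_K\<close> and
  \<open>op_Kn\<close> become two cases that differ in the factor \<open>L\<close> and in
  \<open>g\<close>.\<close>

definition kernel_op ::
  "real \<Rightarrow> real \<Rightarrow> (real \<times> real \<Rightarrow> complex) \<Rightarrow> (real \<times> real \<Rightarrow> complex) \<Rightarrow> (real \<Rightarrow> complex) \<Rightarrow> L1" where
  "kernel_op a b H L g = class_on a b (\<lambda>s. LINT t:{a..b}|lebesgue. H (s, t) * L (s, t) * g t)"

definition square_ext :: "real \<Rightarrow> real \<Rightarrow> (real \<times> real \<Rightarrow> complex) \<Rightarrow> real \<times> real \<Rightarrow> complex" where
  "square_ext a b L z = (if z \<in> {a..b} \<times> {a..b} then L z else 0)"

context L1_kernel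
begin

lemma section_measurable:
  fixes k :: "real \<times> real \<Rightarrow> complex"
  assumes "k \<in> borel_measurable borel"
  shows "(\<lambda>t. k (s, t)) \<in> borel_measurable borel" "(\<lambda>s. k (s, t)) \<in> borel_measurable borel"
  by (rule measurable_compose[OF _ assms], simp add: borel_prod[symmetric])+

lemma mass_times_bounded:
  fixes f :: "real \<times> real \<Rightarrow> complex"
  assumes f: "f \<in> borel_measurable borel" "\<forall>z\<in>{a..b} \<times> {a..b}. norm (f z) \<le> c" and c: "c \<ge> 0"
  shows "AE t in lborel. (\<integral>\<^sup>+s. ennreal (norm (H' (s, t) * f (s, t))) \<partial>lborel) \<le> ennreal (c\<^sub>H * c)"
  using mass
proof eventually_elim
  case (elim t)
  have "(\<integral>\<^sup>+s. ennreal (norm (H' (s, t) * f (s, t))) \<partial>lborel) \<le>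
      (\<integral>\<^sup>+s. ennreal (norm (H' (s, t))) * ennreal c \<partial>lborel)"
  proof (rule nn_integral_mono)
    fix s
    have "norm (H' (s, t)) * norm (f (s, t)) \<le> norm (H' (s, t)) * c"
      using f(2)[THEN bspec, of "(s, t)"] H'_support[of "(s, t)"]
      by (cases "(s, t) \<in> {a..b} \<times> {a..b}") (auto intro: mult_left_mono)
    then show "ennreal (norm (H' (s, t) * f (s, t))) \<le> ennreal (norm (H' (s, t))) * ennreal c"
      using c by (simp add: norm_mult ennreal_leI flip: ennreal_mult)
  qed
  also have "\<dots> = (\<integral>\<^sup>+s. ennreal (norm (H' (s, t))) \<partial>lborel) * ennreal c"
    using section_measurable(2)[OF H'_measurable, of t] by (intro nn_integral_multc) measurable
  also have "\<dots> \<le> ennreal c\<^sub>H * ennreal c" using elim by (rule mult_right_mono) simp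
  also have "\<dots> = ennreal (c\<^sub>H * c)" using c c\<^sub>H_nonneg by (simp add: ennreal_mult)
  finally show ?case .
qed

text \<open>Identifies the class with an iterated Borel integral. The integrability of almost every
  row is what later allows two such integrals to be subtracted under one integral sign.\<close>

lemma kernel_op_representative:
  assumes L: "square_ext a b L \<in> borel_measurable borel" "\<forall>z\<in>{a..b} \<times> {a..b}. norm (L z) \<le> c"
    and g: "g' \<in> borel_measurable borel" "integrable lborel g'" "AE t in lborel. ext0 a b g t = g' t"
  defines "k \<equiv> \<lambda>z. H' z * square_ext a b L z"
  shows "AE s in lborel. integrable lborel (\<lambda>t. k (s, t) * g' t)"
    and "integrable lborel (\<lambda>s. LINT t|lborel. k (s, t) * g' t)"
    and "(\<lambda>s. LINT t|lborel. k (s, t) * g' t) \<in> borel_measurable borel"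
    and "AE s in lborel. fun_of (kernel_op a b H L g) s = (LINT t|lborel. k (s, t) * g' t)"
    and "AE s in lborel. ext0 a b (fun_of (kernel_op a b H L g)) s = (LINT t|lborel. k (s, t) * g' t)"
proof -
  have c: "c \<ge> 0" by (rule order_trans[OF norm_ge_zero bspec[OF L(2), of "(a, a)"]]) (use ab in auto)
  have k: "k \<in> borel_measurable borel" unfolding k_def using L(1) by measurable
  have m: "AE t in lborel. (\<integral>\<^sup>+s. ennreal (norm (k (s, t))) \<partial>lborel) \<le> ennreal (c\<^sub>H * c)"
    unfolding k_def
    by (rule mass_times_bounded[OF L(1) _ c]) (use L(2) in \<open>simp add: square_ext_def\<close>)
  note bound = kernel_operator_bound[OF k g(1,2) mult_nonneg_nonneg[OF c\<^sub>H_nonneg c] m]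
  show "AE s in lborel. integrable lborel (\<lambda>t. k (s, t) * g' t)"
    and int: "integrable lborel (\<lambda>s. LINT t|lborel. k (s, t) * g' t)"
    and meas: "(\<lambda>s. LINT t|lborel. k (s, t) * g' t) \<in> borel_measurable borel"
    using bound(1-3) by simp_all
  let ?f = "\<lambda>s. LINT t:{a..b}|lebesgue. H (s, t) * L (s, t) * g t"
  have f: "AE s in lborel. ext0 a b ?f s = (LINT t|lborel. k (s, t) * g' t)"
    using H'_eq
  proof eventually_elim
    case (elim s)
    show ?case
    proof (cases "s \<in> {a..b}")
      case True
      have "AE t in lborel. indicator {a..b} t *\<^sub>R (H (s, t) * L (s, t) * g t) = k (s, t) * g' t"
        using elim g(3)
      proof eventually_elim
        case (elim t)
        then show ?case using True H'_support[of "(s, t)"]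
          by (cases "t \<in> {a..b}") (simp_all add: k_def square_ext_def ext0_def)
      qed
      moreover have "(\<lambda>t. k (s, t) * g' t) \<in> borel_measurable borel"
        using section_measurable(1)[OF k, of s] g(1) by measurable
      ultimately show ?thesis
        using lebesgue_integral_borel_representative(2)[of "\<lambda>t. k (s, t) * g' t"] True
        by (simp add: ext0_def set_lebesgue_integral_def)
    next
      case False
      then have "H' (s, t) = 0" for t by (intro H'_support) auto
      then have "k (s, t) = 0" for t by (simp add: k_def)
      then show ?thesis using False by (auto simp: ext0_def)
    qed
  qed
  have "integrable lebesgue (ext0 a b ?f)"
    using lebesgue_integral_borel_representative(1)[OF meas f] int by simp
  then have "AE s in lebesgue. fun_of (kernel_op a b H L g) s = ext0 a b ?f s"
    unfolding kernel_op_def by (intro fun_of_class_on) (simp add: integrable_ext0_iff)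
  then have "AE s in lborel. fun_of (kernel_op a b H L g) s = ext0 a b ?f s" by (simp add: AE_completion_iff)
  then show eq: "AE s in lborel. fun_of (kernel_op a b H L g) s = (LINT t|lborel. k (s, t) * g' t)"
    using f by eventually_elim simp
  have "AE s in lborel. ext0 a b (fun_of (kernel_op a b H L g)) s = fun_of (kernel_op a b H L g) s"
    using L1_on_ext0[of "kernel_op a b H L g" a b] class_on_in_L1_on[of a b ?f]
    by (simp add: AE_completion_iff kernel_op_def)
  then show "AE s in lborel. ext0 a b (fun_of (kernel_op a b H L g)) s = (LINT t|lborel. k (s, t) * g' t)"
    using eq by eventually_elim simp
qed

text \<open>The difference has the kernel \<open>H'\<close> times \<open>L1 - L2\<close>, whose
  columns have mass at most \<open>c\<^sub>H * \<delta>\<close>.\<close>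

lemma norm_kernel_op_diff_le:
  assumes L1: "square_ext a b L1 \<in> borel_measurable borel" "\<forall>z\<in>{a..b} \<times> {a..b}. norm (L1 z) \<le> c1"
    and L2: "square_ext a b L2 \<in> borel_measurable borel" "\<forall>z\<in>{a..b} \<times> {a..b}. norm (L2 z) \<le> c2"
    and d: "\<And>z. z \<in> {a..b} \<times> {a..b} \<Longrightarrow> norm (L1 z - L2 z) \<le> \<delta>" and \<delta>: "\<delta> \<ge> 0"
    and g: "set_integrable lebesgue {a..b} g"
  shows "norm (kernel_op a b H L1 g - kernel_op a b H L2 g) \<le> c\<^sub>H * \<delta> * (LINT t:{a..b}|lebesgue. norm (g t))"
proof -
  obtain g' where g': "g' \<in> borel_measurable borel" "integrable lborel g'" "AE t in lborel. ext0 a b g t = g' t"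
      "(LINT t|lborel. norm (g' t)) = (LINT t:{a..b}|lebesgue. norm (g t))"
    using set_integrable_borel_representative[OF g] by blast
  note r1 = kernel_op_representative[OF L1 g'(1-3)]
  note r2 = kernel_op_representative[OF L2 g'(1-3)]
  let ?f = "\<lambda>z. square_ext a b L1 z - square_ext a b L2 z"
  have f: "?f \<in> borel_measurable borel" using L1(1) L2(1) by measurable
  have m: "AE t in lborel. (\<integral>\<^sup>+s. ennreal (norm (H' (s, t) * ?f (s, t))) \<partial>lborel) \<le> ennreal (c\<^sub>H * \<delta>)"
    by (rule mass_times_bounded[OF f _ \<delta>]) (use d in \<open>simp add: square_ext_def\<close>)
  have k: "(\<lambda>z. H' z * ?f z) \<in> borel_measurable borel" using f by measurable
  have "AE s in lborel. fun_of (kernel_op a b H L1 g - kernel_op a b H L2 g) s = (LINT t|lborel. (H' (s, t) * ?f (s, t)) * g' t)"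
  proof -
    have "AE s in lborel. fun_of (kernel_op a b H L1 g - kernel_op a b H L2 g) s =
        fun_of (kernel_op a b H L1 g) s - fun_of (kernel_op a b H L2 g) s"
      using fun_of_diff[of "kernel_op a b H L1 g" "kernel_op a b H L2 g"] by (simp add: AE_completion_iff)
    then show ?thesis using r1(1,4) r2(1,4)
    proof eventually_elim
      case (elim s)
      have "(H' (s, t) * ?f (s, t)) * g' t =
          (H' (s, t) * square_ext a b L1 (s, t)) * g' t - (H' (s, t) * square_ext a b L2 (s, t)) * g' t" for t
        by (simp add: algebra_simps)
      then show ?case
        by (simp only: elim(1,3,5) Bochner_Integration.integral_diff[OF elim(2,4)])
    qed
  qed
  then have "ennreal (norm (kernel_op a b H L1 g - kernel_op a b H L2 g)) =
      (\<integral>\<^sup>+s. ennreal (norm (LINT t|lborel. (H' (s, t) * ?f (s, t)) * g' t)) \<partial>lborel)"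
    unfolding nn_norm_fun_of nn_integral_completion by (intro nn_integral_cong_AE) (auto elim!: eventually_mono)
  also have "\<dots> \<le> ennreal (c\<^sub>H * \<delta> * (LINT t|lborel. norm (g' t)))"
    by (rule kernel_operator_bound(4)[OF k g'(1,2) mult_nonneg_nonneg[OF c\<^sub>H_nonneg \<delta>] m])
  finally show ?thesis
    unfolding g'(4)[symmetric] using c\<^sub>H_nonneg \<delta> by (subst (asm) ennreal_le_iff) auto
qed

text \<open>The increment of the product kernel splits into \<open>L\<close> times the increment of
  \<open>H'\<close> and the increment of \<open>L\<close> times the shifted \<open>H'\<close>, with
  column masses at most \<open>c * \<omega>\<close> and \<open>c\<^sub>H * \<kappa>\<close>. The
  density enters only through its norm, so the modulus is uniform on bounded sets.\<close>

lemma w1_kernel_op_le: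
  assumes L: "square_ext a b L \<in> borel_measurable borel" "\<forall>z\<in>{a..b} \<times> {a..b}. norm (L z) \<le> c"
    and osc: "\<And>s s' t. s \<in> {a..b} \<Longrightarrow> s' \<in> {a..b} \<Longrightarrow> t \<in> {a..b} \<Longrightarrow> \<bar>s' - s\<bar> \<le> \<bar>h\<bar> \<Longrightarrow>
        norm (L (s', t) - L (s, t)) \<le> \<kappa>"
    and \<omega>: "\<And>u. \<bar>u\<bar> \<le> \<bar>h\<bar> \<Longrightarrow> AE t in lborel.
        (\<integral>\<^sup>+s\<in>{a..b}. ennreal (norm (H' (s + u, t) - H' (s, t))) \<partial>lborel) \<le> ennreal \<omega>"
    and nonneg: "\<omega> \<ge> 0" "\<kappa> \<ge> 0"
    and g: "set_integrable lebesgue {a..b} g"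
  shows "w1 a b (kernel_op a b H L g) h \<le> (c * \<omega> + c\<^sub>H * \<kappa>) * (LINT t:{a..b}|lebesgue. norm (g t))"
proof (rule w1_least)
  fix u assume u: "\<bar>u\<bar> \<le> \<bar>h\<bar>"
  have c: "c \<ge> 0" by (rule order_trans[OF norm_ge_zero bspec[OF L(2), of "(a, a)"]]) (use ab in auto)
  obtain g' where g': "g' \<in> borel_measurable borel" "integrable lborel g'" "AE t in lborel. ext0 a b g t = g' t"
      "(LINT t|lborel. norm (g' t)) = (LINT t:{a..b}|lebesgue. norm (g t))"
    using set_integrable_borel_representative[OF g] by blast
  let ?k = "\<lambda>z. H' z * square_ext a b L z"
  let ?p = "\<lambda>s. LINT t|lborel. ?k (s, t) * g' t"
  note r = kernel_op_representative[OF L g'(1-3)]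
  \<comment> \<open>The kernel of the increment; the indicator is there because \<open>w1\<close>
    integrates over base points in the interval only.\<close>
  define ku where "ku z = indicator ({a..b} \<times> UNIV) z *\<^sub>R (?k (fst z + u, snd z) - ?k z)" for z
  have k: "?k \<in> borel_measurable borel" using L(1) by measurable
  have sh: "(\<lambda>z. (fst z + u, snd z)) \<in> borel_measurable (borel :: (real \<times> real) measure)"
    by (intro borel_measurable_continuous_onI continuous_intros)
  have "{a..b} \<times> UNIV \<in> sets (borel :: (real \<times> real) measure)"
    by (intro borel_closed closed_Times) auto
  then have ku: "ku \<in> borel_measurable borel"
    unfolding ku_def using k measurable_compose[OF sh k]
    by (intro borel_measurable_scaleR borel_measurable_indicator borel_measurable_diff) auto
  have pointwise: "norm (ku (s, t)) \<le> c * (norm (H' (s + u, t) - H' (s, t)) * indicator {a..b} s) + \<kappa> * norm (H' (s + u, t))" for s t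
  proof (cases "s \<in> {a..b} \<and> t \<in> {a..b}")
    case True
    show ?thesis
    proof (cases "s + u \<in> {a..b}")
      case su: True
      have "ku (s, t) = L (s, t) * (H' (s + u, t) - H' (s, t)) + (L (s + u, t) - L (s, t)) * H' (s + u, t)"
        using True su by (simp add: ku_def square_ext_def algebra_simps)
      also have "norm \<dots> \<le> c * norm (H' (s + u, t) - H' (s, t)) + \<kappa> * norm (H' (s + u, t))"
        using L(2)[THEN bspec, of "(s, t)"] osc[of s "s + u" t] True su u
        by (intro order_trans[OF norm_triangle_ineq] add_mono) (auto simp: norm_mult intro!: mult_right_mono)
      finally show ?thesis using True by simp
    next
      case False
      \<comment> \<open>Nothing is known about \<open>L\<close> at the shifted point, but there the
        cut-off kernel vanishes and the first summand alone suffices.\<close>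
      then have "H' (s + u, t) = 0" by (intro H'_support) auto
      moreover have "norm (H' (s, t)) * norm (L (s, t)) \<le> norm (H' (s, t)) * c"
        using L(2)[THEN bspec, of "(s, t)"] True by (intro mult_left_mono) auto
      ultimately show ?thesis using True by (simp add: ku_def square_ext_def norm_mult mult.commute)
    qed
  next
    case False
    then have "ku (s, t) = 0" by (auto simp: ku_def square_ext_def)
    then show ?thesis using c nonneg by simp
  qed
  have m: "AE t in lborel. (\<integral>\<^sup>+s. ennreal (norm (ku (s, t))) \<partial>lborel) \<le> ennreal (c * \<omega> + c\<^sub>H * \<kappa>)"
    using mass \<omega>[OF u]
  proof eventually_elim
    case (elim t)
    note [measurable] = section_measurable(2)[OF H'_measurable, of t]
    have [measurable]: "(\<lambda>s. H' (s + u, t)) \<in> borel_measurable borel"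
      by (rule measurable_compose[OF _ section_measurable(2)[OF H'_measurable]]) measurable
    let ?A = "\<lambda>s. ennreal (norm (H' (s + u, t) - H' (s, t))) * indicator {a..b} s"
    have "(\<integral>\<^sup>+s. ennreal (norm (ku (s, t))) \<partial>lborel) \<le>
        (\<integral>\<^sup>+s. ennreal c * ?A s + ennreal \<kappa> * ennreal (norm (H' (s + u, t))) \<partial>lborel)"
    proof (rule nn_integral_mono)
      fix s
      have "ennreal (norm (ku (s, t))) \<le> ennreal (c * (norm (H' (s + u, t) - H' (s, t)) * indicator {a..b} s) + \<kappa> * norm (H' (s + u, t)))"
        by (rule ennreal_leI[OF pointwise])
      also have "\<dots> = ennreal c * ?A s + ennreal \<kappa> * ennreal (norm (H' (s + u, t)))"
        using c nonneg by (simp add: ennreal_plus ennreal_mult indicator_def)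
      finally show "ennreal (norm (ku (s, t))) \<le> ennreal c * ?A s + ennreal \<kappa> * ennreal (norm (H' (s + u, t)))" .
    qed
    also have "\<dots> = ennreal c * (\<integral>\<^sup>+s. ?A s \<partial>lborel) + ennreal \<kappa> * (\<integral>\<^sup>+s. ennreal (norm (H' (s + u, t))) \<partial>lborel)"
      by (simp add: nn_integral_add nn_integral_cmult)
    also have "(\<integral>\<^sup>+s. ennreal (norm (H' (s + u, t))) \<partial>lborel) = (\<integral>\<^sup>+s. ennreal (norm (H' (s, t))) \<partial>lborel)"
      by (rule nn_integral_translate) measurable
    also have "ennreal c * (\<integral>\<^sup>+s. ?A s \<partial>lborel) + ennreal \<kappa> * (\<integral>\<^sup>+s. ennreal (norm (H' (s, t))) \<partial>lborel) \<le>
        ennreal c * ennreal \<omega> + ennreal \<kappa> * ennreal c\<^sub>H"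
      using elim by (intro add_mono mult_left_mono) auto
    also have "\<dots> = ennreal (c * \<omega> + c\<^sub>H * \<kappa>)"
      using c nonneg c\<^sub>H_nonneg by (simp add: ennreal_plus ennreal_mult mult.commute)
    finally show ?case .
  qed
  have "AE v in lborel. (?p (v + u) - ?p v) * indicator {a..b} v = (LINT t|lborel. ku (v, t) * g' t)"
    using r(1) AE_lborel_translate[OF r(1), of u]
  proof eventually_elim
    case (elim v)
    have "ku (v, t) * g' t = indicator {a..b} v *\<^sub>R (?k (v + u, t) * g' t - ?k (v, t) * g' t)" for t
      by (simp add: ku_def left_diff_distrib indicator_def)
    then have "(LINT t|lborel. ku (v, t) * g' t) = indicator {a..b} v *\<^sub>R (?p (v + u) - ?p v)"
      by (simp only: integral_scaleR_right Bochner_Integration.integral_diff[OF elim(2,1)])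
    then show ?case by (simp add: indicator_def)
  qed
  then have ae: "AE v in lborel. ennreal (norm (?p (v + u) - ?p v)) * indicator {a..b} v = ennreal (norm (LINT t|lborel. ku (v, t) * g' t))"
    by eventually_elim (auto simp: indicator_def split: if_splits)
  have nn: "c * \<omega> + c\<^sub>H * \<kappa> \<ge> 0" using c nonneg c\<^sub>H_nonneg by simp
  have "ennreal (LINT v:{a..b}|lebesgue. norm (ext0 a b (fun_of (kernel_op a b H L g)) (v + u) - ext0 a b (fun_of (kernel_op a b H L g)) v)) =
      (\<integral>\<^sup>+v. ennreal (norm (LINT t|lborel. ku (v, t) * g' t)) \<partial>lborel)"
    unfolding L1_shift_integral(1)[OF r(3,2,5)] by (rule nn_integral_cong_AE[OF ae])
  also have "\<dots> \<le> ennreal ((c * \<omega> + c\<^sub>H * \<kappa>) * (LINT t|lborel. norm (g' t)))"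
    by (rule kernel_operator_bound(4)[OF ku g'(1,2) nn m])
  finally show "(LINT v:{a..b}|lebesgue. norm (ext0 a b (fun_of (kernel_op a b H L g)) (v + u) - ext0 a b (fun_of (kernel_op a b H L g)) v)) \<le>
      (c * \<omega> + c\<^sub>H * \<kappa>) * (LINT t:{a..b}|lebesgue. norm (g t))"
    unfolding g'(4)[symmetric] using nn by (subst (asm) ennreal_le_iff) auto
qed

end

section \<open>Piecewise linear interpolation and linearization\<close>

lemma w2_bdd_above:
  fixes a b :: real and f :: "real \<times> real \<Rightarrow> complex"
  assumes "continuous_on ({a..b} \<times> {a..b}) f"
  shows "bdd_above ((\<lambda>(u, v). norm (f u - f v)) `
    {(u, v). u \<in> {a..b} \<times> {a..b} \<and> v \<in> {a..b} \<times> {a..b} \<and> dist u v \<le> \<bar>h\<bar>})"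
proof -
  have "bounded (f ` ({a..b} \<times> {a..b}))"
    by (intro compact_imp_bounded compact_continuous_image assms compact_Times) auto
  then obtain c where c: "\<And>u. u \<in> {a..b} \<times> {a..b} \<Longrightarrow> norm (f u) \<le> c"
    unfolding bounded_iff by blast
  have "norm (f u - f v) \<le> 2 * c" if "u \<in> {a..b} \<times> {a..b}" "v \<in> {a..b} \<times> {a..b}" for u v
    using norm_triangle_ineq4[of "f u" "f v"] c[OF that(1)] c[OF that(2)] by linarith
  then show ?thesis by (intro bdd_aboveI2[where M = "2 * c"]) force
qed

lemma w2_upper:
  assumes "continuous_on ({a..b} \<times> {a..b}) f" "u \<in> {a..b} \<times> {a..b}" "v \<in> {a..b} \<times> {a..b}" "dist u v \<le> \<bar>h\<bar>"
  shows "norm (f u - f v) \<le> w2 a b f h"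
proof -
  have "(u, v) \<in> {(u, v). u \<in> {a..b} \<times> {a..b} \<and> v \<in> {a..b} \<times> {a..b} \<and> dist u v \<le> \<bar>h\<bar>}"
    using assms(2-4) by simp
  from cSUP_upper[OF this w2_bdd_above[OF assms(1)]] show ?thesis unfolding w2_def by simp
qed

lemma w2_nonneg:
  assumes "a \<le> b" "continuous_on ({a..b} \<times> {a..b}) f"
  shows "0 \<le> w2 a b f h"
  using w2_upper[OF assms(2), of "(a, a)" "(a, a)" h] assms(1) by simp

lemma w2_mesh_tendsto_0:
  assumes ab: "a \<le> b" and f: "continuous_on ({a..b} \<times> {a..b}) f"
  shows "(\<lambda>n. w2 a b f (mesh a b n)) \<longlonglongrightarrow> 0"
proof (rule LIMSEQ_I)
  fix e :: real assume e: "e > 0"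
  have "uniformly_continuous_on ({a..b} \<times> {a..b}) f"
    by (intro compact_uniformly_continuous f compact_Times) auto
  then obtain \<delta> where \<delta>: "\<delta> > 0"
      "\<forall>v\<in>{a..b} \<times> {a..b}. \<forall>u\<in>{a..b} \<times> {a..b}. dist u v < \<delta> \<longrightarrow> dist (f u) (f v) < e / 2"
    unfolding uniformly_continuous_on_def using half_gt_zero[OF e] by blast
  obtain n0 where n0: "\<And>n. n \<ge> n0 \<Longrightarrow> \<bar>mesh a b n\<bar> < \<delta>"
    using LIMSEQ_D[OF mesh_tendsto_0 \<delta>(1), of a b] by auto
  have "norm (w2 a b f (mesh a b n) - 0) < e" if n: "n \<ge> n0" for n
  proof -
    have "w2 a b f (mesh a b n) \<le> e / 2"
      unfolding w2_def
    proof (rule cSUP_least)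
      have "((a, a), (a, a)) \<in> {(u, v). u \<in> {a..b} \<times> {a..b} \<and> v \<in> {a..b} \<times> {a..b} \<and> dist u v \<le> \<bar>mesh a b n\<bar>}"
        using ab by simp
      then show "{(u, v). u \<in> {a..b} \<times> {a..b} \<and> v \<in> {a..b} \<times> {a..b} \<and> dist u v \<le> \<bar>mesh a b n\<bar>} \<noteq> {}"
        by blast
      fix z assume "z \<in> {(u, v). u \<in> {a..b} \<times> {a..b} \<and> v \<in> {a..b} \<times> {a..b} \<and> dist u v \<le> \<bar>mesh a b n\<bar>}"
      then obtain u v where z: "z = (u, v)" "u \<in> {a..b} \<times> {a..b}" "v \<in> {a..b} \<times> {a..b}" "dist u v \<le> \<bar>mesh a b n\<bar>"
        by blast
      have "dist u v < \<delta>" using z(4) n0[OF n] by linarith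
      then have "dist (f u) (f v) < e / 2" using \<delta>(2) z(2,3) by blast
      then show "(case z of (u, v) \<Rightarrow> norm (f u - f v)) \<le> e / 2" by (simp add: z(1) dist_norm)
    qed
    then show ?thesis using w2_nonneg[OF ab f, of "mesh a b n"] e by simp
  qed
  then show "\<exists>n0. \<forall>n\<ge>n0. norm (w2 a b f (mesh a b n) - 0) < e" by blast
qed

section \<open>Interpolation in the second variable\<close>

lemma norm_convex_combination_le:
  fixes x z :: "'a::real_normed_vector"
  assumes "norm x \<le> B" "norm z \<le> B" "0 \<le> \<alpha>" "\<alpha> \<le> 1"
  shows "norm ((1 - \<alpha>) *\<^sub>R x + \<alpha> *\<^sub>R z) \<le> B"
proof -
  have "norm ((1 - \<alpha>) *\<^sub>R x + \<alpha> *\<^sub>R z) \<le> (1 - \<alpha>) * norm x + \<alpha> * norm z"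
    using assms(3,4) norm_triangle_ineq[of "(1 - \<alpha>) *\<^sub>R x" "\<alpha> *\<^sub>R z"] by simp
  also have "\<dots> \<le> B" using assms by (intro convex_bound_le) auto
  finally show ?thesis .
qed

text \<open>Weights and nodes depend on t alone, hence the inner quantifier over s: increments in s
  pass through the interpolation.\<close>

lemma interp_convex:
  assumes ab: "a < b" "n \<ge> 1" and t: "t \<in> {a..b}"
  shows "\<exists>\<alpha> t1 t2. 0 \<le> \<alpha> \<and> \<alpha> \<le> 1 \<and> t1 \<in> {a..b} \<and> t2 \<in> {a..b} \<and>
    \<bar>t1 - t\<bar> \<le> mesh a b n \<and> \<bar>t2 - t\<bar> \<le> mesh a b n \<and>
    (\<forall>s. interp a b n L (s, t) = (1 - \<alpha>) *\<^sub>R L (s, t1) + \<alpha> *\<^sub>R L (s, t2))"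
proof -
  define h where "h = mesh a b n"
  have h: "h > 0" using mesh_pos[OF ab] by (simp add: h_def)
  define t1 where "t1 = node a b n (cell a b n t - 1)"
  define t2 where "t2 = node a b n (cell a b n t)"
  note c = cell_bounds[OF ab t, folded t1_def t2_def h_def]
  have mem: "t1 \<in> {a..b}" "t2 \<in> {a..b}" using c(3,4,6) by (auto simp: subset_iff)
  define \<alpha> where "\<alpha> = (t - t1) / h"
  have \<alpha>: "0 \<le> \<alpha>" "\<alpha> \<le> 1" using c(3-5) h by (simp_all add: \<alpha>_def)
  have \<alpha>': "1 - \<alpha> = (t2 - t) / h" using c(5) h by (simp add: \<alpha>_def field_simps)
  have "interp a b n L (s, t) = (of_real (t2 - t) * L (s, t1) + of_real (t - t1) * L (s, t2)) / of_real h" for s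
    by (simp add: interp_def Let_def t1_def t2_def h_def)
  then have "interp a b n L (s, t) = (1 - \<alpha>) *\<^sub>R L (s, t1) + \<alpha> *\<^sub>R L (s, t2)" for s
    unfolding \<alpha>' by (simp add: \<alpha>_def scaleR_conv_of_real add_divide_distrib)
  then show ?thesis using \<alpha> mem c(3-5) unfolding h_def
    by (intro exI[of _ \<alpha>] exI[of _ t1] exI[of _ t2]) auto
qed

lemma norm_interp_le:
  assumes ab: "a < b" "n \<ge> 1" and L: "\<forall>z\<in>{a..b} \<times> {a..b}. norm (L z) \<le> c"
  shows "\<forall>z\<in>{a..b} \<times> {a..b}. norm (interp a b n L z) \<le> c"
proof
  fix z assume "z \<in> {a..b} \<times> {a..b}"
  then obtain s t where z: "z = (s, t)" "s \<in> {a..b}" "t \<in> {a..b}" by blast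
  from interp_convex[OF ab z(3), of L] obtain \<alpha> t1 t2 where
    c: "0 \<le> \<alpha>" "\<alpha> \<le> 1" "t1 \<in> {a..b}" "t2 \<in> {a..b}"
      "interp a b n L (s, t) = (1 - \<alpha>) *\<^sub>R L (s, t1) + \<alpha> *\<^sub>R L (s, t2)" by blast
  show "norm (interp a b n L z) \<le> c"
    unfolding z(1) c(5) using L z(2) c by (intro norm_convex_combination_le) auto
qed

lemma norm_interp_diff_le:
  assumes ab: "a < b" "n \<ge> 1" and L: "continuous_on ({a..b} \<times> {a..b}) L" and z: "z \<in> {a..b} \<times> {a..b}"
  shows "norm (interp a b n L z - L z) \<le> w2 a b L (mesh a b n)"
proof -
  obtain s t where z: "z = (s, t)" "s \<in> {a..b}" "t \<in> {a..b}" using z by blast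
  from interp_convex[OF ab z(3), of L] obtain \<alpha> t1 t2 where
    c: "0 \<le> \<alpha>" "\<alpha> \<le> 1" "t1 \<in> {a..b}" "t2 \<in> {a..b}" "\<bar>t1 - t\<bar> \<le> mesh a b n" "\<bar>t2 - t\<bar> \<le> mesh a b n"
      "interp a b n L (s, t) = (1 - \<alpha>) *\<^sub>R L (s, t1) + \<alpha> *\<^sub>R L (s, t2)" by blast
  have "interp a b n L z - L z = (1 - \<alpha>) *\<^sub>R (L (s, t1) - L (s, t)) + \<alpha> *\<^sub>R (L (s, t2) - L (s, t))"
    unfolding z(1) c(7) by (simp add: algebra_simps)
  also have "norm \<dots> \<le> w2 a b L (mesh a b n)"
    using z c by (intro norm_convex_combination_le w2_upper[OF L]) (auto simp: dist_Pair_Pair dist_norm)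
  finally show ?thesis .
qed

text \<open>Bounded by the modulus of \<open>L\<close> instead of that of the interpolant, hence
  uniformly in n, as the collective approximation requires.\<close>

lemma interp_oscillation_le:
  assumes ab: "a < b" "n \<ge> 1" and L: "continuous_on ({a..b} \<times> {a..b}) L"
    and s: "s \<in> {a..b}" "s' \<in> {a..b}" "\<bar>s' - s\<bar> \<le> \<bar>h\<bar>" and t: "t \<in> {a..b}"
  shows "norm (interp a b n L (s', t) - interp a b n L (s, t)) \<le> w2 a b L h"
proof -
  from interp_convex[OF ab t, of L] obtain \<alpha> t1 t2 where
    c: "0 \<le> \<alpha>" "\<alpha> \<le> 1" "t1 \<in> {a..b}" "t2 \<in> {a..b}"
      "\<And>s. interp a b n L (s, t) = (1 - \<alpha>) *\<^sub>R L (s, t1) + \<alpha> *\<^sub>R L (s, t2)" by blast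
  have "interp a b n L (s', t) - interp a b n L (s, t) =
      (1 - \<alpha>) *\<^sub>R (L (s', t1) - L (s, t1)) + \<alpha> *\<^sub>R (L (s', t2) - L (s, t2))"
    unfolding c(5) by (simp add: algebra_simps)
  also have "norm \<dots> \<le> w2 a b L h"
    using s c by (intro norm_convex_combination_le w2_upper[OF L]) (auto simp: dist_Pair_Pair dist_norm)
  finally show ?thesis .
qed

lemma square_ext_measurable:
  assumes "continuous_on ({a..b} \<times> {a..b}) L"
  shows "square_ext a b L \<in> borel_measurable borel"
proof -
  have "(\<lambda>z. indicator ({a..b} \<times> {a..b}) z *\<^sub>R L z) \<in> borel_measurable borel"
    by (rule borel_measurable_continuous_on_indicator[OF _ assms]) (intro borel_closed closed_Times, auto)
  moreover have "square_ext a b L = (\<lambda>z. indicator ({a..b} \<times> {a..b}) z *\<^sub>R L z)"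
    by (auto simp: square_ext_def indicator_def fun_eq_iff)
  ultimately show ?thesis by simp
qed

text \<open>For a fixed cell index the formula is Borel in both variables, and the index takes
  countably many values.\<close>

lemma square_ext_interp_measurable:
  assumes ab: "a < b" "n \<ge> 1" and L: "continuous_on ({a..b} \<times> {a..b}) L"
  shows "square_ext a b (interp a b n L) \<in> borel_measurable borel"
proof -
  define \<Phi> where "\<Phi> i z = indicator ({a..b} \<times> {a..b}) z *\<^sub>R
     ((of_real (node a b n i - snd z) * square_ext a b L (fst z, node a b n (i - 1)) +
       of_real (snd z - node a b n (i - 1)) * square_ext a b L (fst z, node a b n i)) / of_real (mesh a b n))" for i z
  have D: "{a..b} \<times> {a..b} \<in> sets (borel :: (real \<times> real) measure)"
    by (intro borel_closed closed_Times) auto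
  have sec: "(\<lambda>z. square_ext a b L (fst z, c)) \<in> borel_measurable (borel :: (real \<times> real) measure)" for c
    by (rule measurable_compose[OF _ square_ext_measurable[OF L]])
       (intro borel_measurable_continuous_onI continuous_intros)
  have lin: "(\<lambda>z. complex_of_real (c - snd z)) \<in> borel_measurable (borel :: (real \<times> real) measure)"
      "(\<lambda>z. complex_of_real (snd z - c)) \<in> borel_measurable (borel :: (real \<times> real) measure)" for c
    by (intro borel_measurable_continuous_onI continuous_intros)+
  have \<Phi>: "\<Phi> i \<in> borel_measurable borel" for i
    unfolding \<Phi>_def
    by (intro borel_measurable_scaleR borel_measurable_indicator D borel_measurable_divide borel_measurable_add
        borel_measurable_times sec lin borel_measurable_const)
  have "(\<lambda>z. cell a b n (snd z)) \<in> borel \<rightarrow>\<^sub>M count_space UNIV"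
    by (rule measurable_compose[OF _ measurable_cell])
       (intro borel_measurable_continuous_onI continuous_intros)
  from measurable_compose_countable[OF \<Phi> this]
  have "(\<lambda>z. \<Phi> (cell a b n (snd z)) z) \<in> borel_measurable borel" .
  moreover have "square_ext a b (interp a b n L) = (\<lambda>z. \<Phi> (cell a b n (snd z)) z)"
  proof
    fix z :: "real \<times> real"
    show "square_ext a b (interp a b n L) z = \<Phi> (cell a b n (snd z)) z"
    proof (cases "z \<in> {a..b} \<times> {a..b}")
      case True
      obtain s t where z: "z = (s, t)" "s \<in> {a..b}" "t \<in> {a..b}" using True by blast
      note c = cell_bounds[OF ab z(3)]
      have "node a b n (cell a b n t - 1) \<in> {a..b}" "node a b n (cell a b n t) \<in> {a..b}"
        using c(3,4,6) by (auto simp: subset_iff)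
      then show ?thesis using z by (simp add: square_ext_def \<Phi>_def interp_def Let_def)
    next
      case False
      then show ?thesis by (auto simp: square_ext_def \<Phi>_def)
    qed
  qed
  ultimately show ?thesis by simp
qed

section \<open>Linearization from second derivative bounds\<close>

lemma convex_L1_ball: "convex (L1_ball a b \<phi> r)"
  unfolding L1_ball_def by (intro convex_Int convex_ball subspace_imp_convex subspace_L1_on)

lemma has_fderiv_fderiv:
  assumes "twice_fdiff_on a b F (L1_ball a b \<phi> r)" "x \<in> L1_ball a b \<phi> r"
  shows "has_fderiv a b F (fderiv a b F x) x"
    "has_fderiv a b (fderiv a b F) (fderiv a b (fderiv a b F) x) x"
proof -
  have x: "x \<in> L1_on a b" using assms(2) by (simp add: L1_ball_def)
  show "has_fderiv a b F (fderiv a b F x) x" "has_fderiv a b (fderiv a b F) (fderiv a b (fderiv a b F) x) x"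
    using assms fderiv_eq[OF x] unfolding twice_fdiff_on_def by metis+
qed

lemma has_fderiv_has_derivative:
  assumes "has_fderiv a b F T x" "S \<subseteq> L1_on a b"
  shows "(F has_derivative blinfun_apply T) (at x within S)"
  using assms has_derivative_subset unfolding has_fderiv_def by blast

text \<open>Two mean value inequalities: the second derivative keeps \<open>fderiv a b F\<close>
  within \<open>C * \<rho>\<close> of its value at \<phi>, and this bounds the deviation of
  \<open>F\<close> from the linear map along a segment.\<close>

lemma fderiv_linearization:
  assumes F: "twice_fdiff_on a b F (L1_ball a b \<phi> r)"
    and C: "\<And>x. x \<in> L1_ball a b \<phi> r \<Longrightarrow> norm (fderiv a b (fderiv a b F) x) \<le> C"
    and \<phi>: "\<phi> \<in> L1_on a b" and \<rho>: "\<rho> \<le> r"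
    and x: "x \<in> L1_ball a b \<phi> \<rho>" and z: "z \<in> L1_ball a b \<phi> \<rho>"
  shows "norm (F x - F z - fderiv a b F \<phi> (x - z)) \<le> C * \<rho> * norm (x - z)"
proof -
  let ?S = "L1_ball a b \<phi> \<rho>"
  have \<rho>0: "\<rho> > 0" using x by (auto simp: L1_ball_def intro: le_less_trans[OF zero_le_dist])
  have S: "?S \<subseteq> L1_ball a b \<phi> r" "?S \<subseteq> L1_on a b" using \<rho> by (auto simp: L1_ball_def)
  have \<phi>S: "\<phi> \<in> ?S" using \<phi> \<rho>0 by (simp add: L1_ball_def)
  have C0: "C \<ge> 0" using order_trans[OF norm_ge_zero C] \<phi>S S(1) by blast
  \<comment> \<open>Derivatives are known only within the subspace, so everything is done relative
    to the convex set \<open>?S\<close>.\<close>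
  have der: "(F has_derivative blinfun_apply (fderiv a b F w)) (at w within ?S)" if "w \<in> ?S" for w
    using has_fderiv_has_derivative[OF has_fderiv_fderiv(1)[OF F] S(2)] that S(1) by blast
  have der2: "(fderiv a b F has_derivative blinfun_apply (fderiv a b (fderiv a b F) w)) (at w within ?S)" if "w \<in> ?S" for w
    using has_fderiv_has_derivative[OF has_fderiv_fderiv(2)[OF F] S(2)] that S(1) by blast
  have lip: "norm (fderiv a b F w - fderiv a b F \<phi>) \<le> C * \<rho>" if w: "w \<in> ?S" for w
  proof -
    have "norm (fderiv a b F w - fderiv a b F \<phi>) \<le> C * norm (w - \<phi>)"
      by (rule differentiable_bound[OF convex_L1_ball der2 _ w \<phi>S])
         (use C S(1) in \<open>auto simp: norm_blinfun.rep_eq[symmetric]\<close>)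
    also have "\<dots> \<le> C * \<rho>"
      using w C0 by (intro mult_left_mono) (auto simp: L1_ball_def dist_norm norm_minus_commute)
    finally show ?thesis .
  qed
  have "norm (F x - F z - fderiv a b F \<phi> (x - z)) \<le> norm (x - z) * (C * \<rho>)"
  proof (rule differentiable_bound_linearization[where S = ?S and f' = "\<lambda>w. blinfun_apply (fderiv a b F w)"])
    show "z + s *\<^sub>R (x - z) \<in> ?S" if "s \<in> {0..1}" for s
      using convexD_alt[OF convex_L1_ball z x, of s] that by (simp add: algebra_simps)
    show "onorm (blinfun_apply (fderiv a b F w) - blinfun_apply (fderiv a b F \<phi>)) \<le> C * \<rho>" if "w \<in> ?S" for w
    proof -
      have "blinfun_apply (fderiv a b F w) - blinfun_apply (fderiv a b F \<phi>) =
          blinfun_apply (fderiv a b F w - fderiv a b F \<phi>)"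
        by (simp add: fun_eq_iff blinfun.diff_left)
      then show ?thesis using lip[OF that] by (simp only: norm_blinfun.rep_eq)
    qed
  qed (use der \<phi>S in auto)
  then show ?thesis by (simp add: mult.commute)
qed

section \<open>The theorem\<close>

theorem theorem3:
  fixes a b :: real
    and \<Omega> :: "L1 set" and y \<phi> :: L1
    and H L :: "real \<times> real \<Rightarrow> complex"
    and N :: "complex \<Rightarrow> complex"
    and r m\<^sub>0 M\<^sub>0 M\<^sub>1 M\<^sub>2 C\<^sub>1 C\<^sub>2 M C :: real
  assumes "a < b"
    and "\<Omega> \<subseteq> L1_on a b" and "y \<in> L1_on a b"
    and "H \<in> borel_measurable (lebesgue_on ({a..b} \<times> {a..b}))"
    and "twice_frechet_differentiable N"
    and "fixed_point_in \<Omega> (op_U a b H L N y) \<phi>"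
    and "\<not> eigenvalue_on a b (fderiv a b (op_U a b H L N y) \<phi>) 1"
    and P1: "continuous_on ({a..b} \<times> {a..b}) L"
    and P2: "r > 0" "L1_ball a b \<phi> r \<subseteq> \<Omega>"
      "m\<^sub>0 > 0" "M\<^sub>0 > 0" "M\<^sub>1 > 0" "M\<^sub>2 > 0" "C\<^sub>1 > 0" "C\<^sub>2 > 0" "M > 0" "C > 0"
    and P21: "\<forall>x\<in>L1_ball a b \<phi> r. A0_in_L1 a b H N x \<and> norm_A0 a b H N x \<le> M\<^sub>0"
      "\<forall>n\<ge>1. \<forall>x\<in>L1_ball a b \<phi> r.
         A0_in_L1 a b H N (cell_mean a b n x) \<and> norm_A0 a b H N (cell_mean a b n x) \<le> m\<^sub>0"
    and P22: "twice_fdiff_on a b (op_K a b H L N) (L1_ball a b \<phi> r)"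
      "\<forall>x\<in>L1_ball a b \<phi> r. norm (fderiv a b (op_K a b H L N) x) \<le> M\<^sub>1"
      "\<forall>x\<in>L1_ball a b \<phi> r. norm (fderiv a b (fderiv a b (op_K a b H L N)) x) \<le> M\<^sub>2"
    and P23: "\<forall>n\<ge>1. twice_fdiff_on a b (op_Kn a b H L N n) (L1_ball a b \<phi> r)"
      "\<forall>n\<ge>1. norm (fderiv a b (op_Kn a b H L N n) \<phi>) \<le> C\<^sub>1"
      "\<forall>\<^sub>F n in sequentially. \<forall>x\<in>L1_ball a b \<phi> r.
         norm (fderiv a b (fderiv a b (op_Kn a b H L N n)) x) \<le> C\<^sub>2"
    and P24: "\<forall>n\<ge>1. \<forall>x\<in>L1_ball a b \<phi> r.
         set_integrable lebesgue {a..b} (\<lambda>t. N (fun_of (cell_mean a b n x) t)) \<and>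
         (LINT t:{a..b}|lebesgue. norm (N (fun_of (cell_mean a b n x) t))) \<le> M"
      "\<forall>x\<in>L1_ball a b \<phi> r.
         set_integrable lebesgue {a..b} (\<lambda>t. N (fun_of x t)) \<and>
         (LINT t:{a..b}|lebesgue. norm (N (fun_of x t))) \<le> C"
    and P25: "\<forall>t\<in>{a..b}. set_borel_measurable lebesgue {a..b} (\<lambda>s. H (s, t))"
      "(w_H a b H \<longlongrightarrow> 0) (at 0)"
  shows "isolated_fixed_point_in \<Omega> (op_U a b H L N y) \<phi> \<and>
    (\<exists>\<epsilon> n\<^sub>\<epsilon> (\<phi>s :: nat \<Rightarrow> L1). 0 < \<epsilon> \<and> \<epsilon> < r \<and> 0 < n\<^sub>\<epsilon> \<and>
       (\<forall>n\<ge>n\<^sub>\<epsilon>. \<forall>x. fixed_point_in (L1_ball a b \<phi> \<epsilon>) (op_Un a b H L N y n) x \<longleftrightarrow> x = \<phi>s n) \<and>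
       (\<exists>\<gamma>>0. \<forall>n\<ge>n\<^sub>\<epsilon>. norm (\<phi> - \<phi>s n) \<le>
          \<gamma> * (2 * w2 a b L (mesh a b n) * m\<^sub>0 + 2 * M\<^sub>1 * w1 a b \<phi> (mesh a b n) +
               2 * M\<^sub>2 * (w1 a b \<phi> (mesh a b n))\<^sup>2)))"
proof -
  note ab = \<open>a < b\<close>
  let ?K = "op_K a b H L N" and ?Kn = "op_Kn a b H L N"
  let ?D = "{a..b} \<times> {a..b}"
  have \<phi>\<Omega>: "\<phi> \<in> \<Omega>" and \<phi>fix: "?K \<phi> - y = \<phi>"
    using \<open>fixed_point_in \<Omega> (op_U a b H L N y) \<phi>\<close> by (auto simp: fixed_point_in_def op_U_def)
  have \<phi>X: "\<phi> \<in> L1_on a b" using \<phi>\<Omega> \<open>\<Omega> \<subseteq> L1_on a b\<close> by blast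
  have \<phi>ball: "\<phi> \<in> L1_ball a b \<phi> r" using \<phi>X \<open>r > 0\<close> by (simp add: L1_ball_def)
  have ball_eq: "L1_on a b \<inter> ball \<phi> \<rho> = L1_ball a b \<phi> \<rho>" for \<rho> by (auto simp: L1_ball_def)

  obtain H' c\<^sub>H where "L1_kernel a b H H' c\<^sub>H"
    using L1_kernel_exists[OF ab \<open>H \<in> borel_measurable (lebesgue_on ?D)\<close> P25(2)] by blast
  then interpret L1_kernel a b H H' c\<^sub>H .
  have "bounded (L ` ?D)"
    by (intro compact_imp_bounded compact_continuous_image P1 compact_Times) auto
  then obtain c\<^sub>L where c\<^sub>L: "c\<^sub>L > 0" "\<forall>z\<in>?D. norm (L z) \<le> c\<^sub>L"
    unfolding bounded_pos by auto
  have K_eq: "?K x = kernel_op a b H L (\<lambda>t. N (fun_of x t))" for x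
    by (simp add: op_K_def kernel_op_def)
  have Kn_eq: "?Kn n x = kernel_op a b H (interp a b n L) (\<lambda>t. N (fun_of (cell_mean a b n x) t))" for n x
    by (simp add: op_Kn_def kernel_op_def)
  have w2_pos: "0 \<le> w2 a b L h" for h using ab P1 by (intro w2_nonneg) auto

  \<comment> \<open>Both operators are applied to the same density and differ only in the
    interpolation of \<open>L\<close>; M bounds the density.\<close>
  have Kn_consistent: "norm (?Kn n x - ?K (cell_mean a b n x)) \<le> c\<^sub>H * w2 a b L (mesh a b n) * M"
    if n: "n \<ge> 1" and x: "x \<in> L1_ball a b \<phi> r" for n x
  proof -
    let ?g = "\<lambda>t. N (fun_of (cell_mean a b n x) t)"
    have "norm (?Kn n x - ?K (cell_mean a b n x)) \<le>
        c\<^sub>H * w2 a b L (mesh a b n) * (LINT t:{a..b}|lebesgue. norm (?g t))"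
      unfolding K_eq Kn_eq using P24(1) n x
      by (intro norm_kernel_op_diff_le[OF square_ext_interp_measurable[OF ab n P1] norm_interp_le[OF ab n c\<^sub>L(2)]
            square_ext_measurable[OF P1] c\<^sub>L(2) norm_interp_diff_le[OF ab n P1] w2_pos]) auto
    also have "\<dots> \<le> c\<^sub>H * w2 a b L (mesh a b n) * M"
      using P24(1) n x c\<^sub>H_nonneg w2_pos by (intro mult_left_mono mult_nonneg_nonneg) auto
    finally show ?thesis .
  qed

  from P23(3) obtain n\<^sub>2 where n\<^sub>2: "\<And>n x. n \<ge> n\<^sub>2 \<Longrightarrow> x \<in> L1_ball a b \<phi> r \<Longrightarrow>
      norm (fderiv a b (fderiv a b (?Kn n)) x) \<le> C\<^sub>2"
    unfolding eventually_sequentially by blast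
  define n\<^sub>1 where "n\<^sub>1 = max 1 n\<^sub>2"
  have n\<^sub>1: "n \<ge> n\<^sub>1 \<Longrightarrow> n \<ge> 1 \<and> n \<ge> n\<^sub>2" for n by (simp add: n\<^sub>1_def)
  define C' where "C' = max M\<^sub>2 C\<^sub>2"

  \<comment> \<open>Compared through the value of \<open>?K\<close> at the cell means: the
    consistency error vanishes, and continuity of \<open>?K\<close> at x within the subspace does
    the rest.\<close>
  have K_conv: "(\<lambda>n. ?Kn n x) \<longlonglongrightarrow> ?K x" if x: "x \<in> L1_ball a b \<phi> r" for x
  proof -
    have xX: "x \<in> L1_on a b" using x by (simp add: L1_ball_def)
    have "continuous (at x within L1_on a b) ?K"
      by (rule has_derivative_continuous[OF has_fderiv_has_derivative[OF has_fderiv_fderiv(1)[OF P22(1) x] order_refl]])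
    then have lim: "(\<lambda>n. ?K (cell_mean a b n x)) \<longlonglongrightarrow> ?K x"
      by (rule continuous_within_tendsto_compose)
         (auto simp: cell_mean_in_L1_on cell_mean_tendsto[OF ab xX])
    have "(\<lambda>n. ?Kn n x - ?K (cell_mean a b n x)) \<longlonglongrightarrow> 0"
    proof (rule Lim_null_comparison)
      show "\<forall>\<^sub>F n in sequentially. norm (?Kn n x - ?K (cell_mean a b n x)) \<le> c\<^sub>H * w2 a b L (mesh a b n) * M"
        using Kn_consistent[OF _ x] by (auto simp: eventually_sequentially)
      show "(\<lambda>n. c\<^sub>H * w2 a b L (mesh a b n) * M) \<longlonglongrightarrow> 0"
        using w2_mesh_tendsto_0[OF less_imp_le[OF ab] P1]
        by (intro tendsto_mult_left_zero tendsto_mult_right_zero)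
    qed
    from tendsto_add[OF this lim] show ?thesis by simp
  qed

  have approx: "\<exists>P. finite_rank P \<and> range P \<subseteq> L1_on a b \<and> (\<forall>x. norm (P x - x) \<le> 6 * norm x) \<and>
      (\<forall>n\<ge>n\<^sub>1. \<forall>x\<in>L1_on a b \<inter> ball \<phi> r. norm (P (?Kn n x) - ?Kn n x) \<le> \<eta>)" if \<eta>: "\<eta> > 0" for \<eta>
  proof -
    \<comment> \<open>The kernel increments then cost \<eta> / 4 and the oscillation of
      \<open>L\<close> another \<eta> / 4; the factor 2 in the cell mean estimate restores \<eta>.
      The mesh index m depends on neither n nor x.\<close>
    define \<omega> where "\<omega> = \<eta> / (4 * c\<^sub>L * M)"
    have \<omega>: "\<omega> > 0" using \<eta> c\<^sub>L(1) \<open>M > 0\<close> by (simp add: \<omega>_def)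
    obtain \<delta> where \<delta>: "\<delta> > 0" "\<And>u. \<bar>u\<bar> \<le> \<delta> \<Longrightarrow>
        AE t in lborel. (\<integral>\<^sup>+s\<in>{a..b}. ennreal (norm (H' (s + u, t) - H' (s, t))) \<partial>lborel) \<le> ennreal \<omega>"
      using shift[OF \<omega>] by blast
    have "\<forall>\<^sub>F m in sequentially. \<bar>mesh a b m\<bar> < \<delta>"
      using tendsto_rabs_zero[OF mesh_tendsto_0] \<delta>(1) by (rule order_tendstoD(2))
    moreover have "\<forall>\<^sub>F m in sequentially. c\<^sub>H * w2 a b L (mesh a b m) < \<eta> / (4 * M)"
      using tendsto_mult_right_zero[OF w2_mesh_tendsto_0[OF less_imp_le[OF ab] P1], of c\<^sub>H] \<eta> \<open>M > 0\<close>
      by (intro order_tendstoD(2)) auto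
    moreover have "\<forall>\<^sub>F m in sequentially. (1::nat) \<le> m" by (rule eventually_ge_at_top)
    ultimately have "\<forall>\<^sub>F m in sequentially. \<bar>mesh a b m\<bar> < \<delta> \<and> c\<^sub>H * w2 a b L (mesh a b m) < \<eta> / (4 * M) \<and> 1 \<le> m"
      by (simp add: eventually_conj_iff)
    then obtain m where m: "\<bar>mesh a b m\<bar> < \<delta>" "c\<^sub>H * w2 a b L (mesh a b m) < \<eta> / (4 * M)" "m \<ge> 1"
      using eventually_happens'[OF sequentially_bot] by blast
    have "norm (cell_mean a b m (?Kn n x) - ?Kn n x) \<le> \<eta>" if n: "n \<ge> n\<^sub>1" and x: "x \<in> L1_ball a b \<phi> r" for n x
    proof -
      have n1: "n \<ge> 1" using n\<^sub>1[OF n] by simp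
      let ?g = "\<lambda>t. N (fun_of (cell_mean a b n x) t)"
      let ?w = "w2 a b L (mesh a b m)"
      have "w1 a b (?Kn n x) (mesh a b m) \<le> (c\<^sub>L * \<omega> + c\<^sub>H * ?w) * (LINT t:{a..b}|lebesgue. norm (?g t))"
        unfolding Kn_eq
      proof (rule w1_kernel_op_le[OF square_ext_interp_measurable[OF ab n1 P1] norm_interp_le[OF ab n1 c\<^sub>L(2)]])
        show "AE t in lborel. (\<integral>\<^sup>+s\<in>{a..b}. ennreal (norm (H' (s + u, t) - H' (s, t))) \<partial>lborel) \<le> ennreal \<omega>"
          if "\<bar>u\<bar> \<le> \<bar>mesh a b m\<bar>" for u
          using \<delta>(2)[of u] that m(1) by simp
      qed (use interp_oscillation_le[OF ab n1 P1] \<omega> w2_pos P24(1) n1 x in auto)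
      also have "\<dots> \<le> (c\<^sub>L * \<omega> + c\<^sub>H * ?w) * M"
        using P24(1) n1 x c\<^sub>L(1) \<omega> c\<^sub>H_nonneg w2_pos by (intro mult_left_mono) auto
      also have "\<dots> \<le> (\<eta> / (4 * M) + \<eta> / (4 * M)) * M"
        using m(2) c\<^sub>L(1) \<open>M > 0\<close> by (intro mult_right_mono add_mono) (auto simp: \<omega>_def)
      also have "\<dots> = \<eta> / 2" using \<open>M > 0\<close> by (simp add: field_simps)
      finally have "w1 a b (?Kn n x) (mesh a b m) \<le> \<eta> / 2" .
      moreover have "?Kn n x \<in> L1_on a b" unfolding op_Kn_def by (rule class_on_in_L1_on)
      ultimately show ?thesis using norm_cell_mean_diff_le[OF ab m(3), of "?Kn n x"] by linarith
    qed
    then show ?thesis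
      using finite_rank_cell_mean[OF ab m(3)] norm_cell_mean_diff_le_norm[OF ab m(3)] cell_mean_in_L1_on
      unfolding ball_eq by (intro exI[of _ "cell_mean a b m"]) auto
  qed

  have no_eigenvector: "x = 0" if "x \<in> L1_on a b" "fderiv a b ?K \<phi> x = x" for x
  proof -
    \<comment> \<open>Subtracting the constant y leaves the derivative unchanged, so the eigenvalue
      hypothesis applies to \<open>?K\<close>.\<close>
    have "has_fderiv a b ?K (fderiv a b ?K \<phi>) \<phi>" by (rule has_fderiv_fderiv(1)[OF P22(1) \<phi>ball])
    then have "has_fderiv a b (op_U a b H L N y) (fderiv a b ?K \<phi>) \<phi>"
      unfolding has_fderiv_def op_U_def[abs_def] by (auto intro!: derivative_eq_intros)
    then have "fderiv a b (op_U a b H L N y) \<phi> = fderiv a b ?K \<phi>" by (rule fderiv_eq[OF \<phi>X])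
    then show ?thesis
      using \<open>\<not> eigenvalue_on a b (fderiv a b (op_U a b H L N y) \<phi>) 1\<close> that
      by (auto simp: eigenvalue_on_def)
  qed

  \<comment> \<open>A ball containing a point has positive radius, so both second derivative bounds
    can be raised to their maximum \<open>C'\<close>.\<close>
  have mono: "D * \<rho> * norm (x - z) \<le> C' * \<rho> * norm (x - z)"
    if "D \<le> C'" "x \<in> L1_ball a b \<phi> \<rho>" for D \<rho> and x z :: L1
  proof -
    have "\<rho> > 0" using that(2) by (auto simp: L1_ball_def intro: le_less_trans[OF zero_le_dist])
    then show ?thesis using that(1) by (intro mult_right_mono) auto
  qed
  interpret collectively_compact_approximation "L1_on a b" ?K ?Kn "fderiv a b ?K \<phi>"
    "\<lambda>n. fderiv a b (?Kn n) \<phi>" \<phi> y r C' 6 C\<^sub>1 n\<^sub>1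
  proof (unfold_locales, unfold ball_eq)
    show "norm (?K x - ?K z - fderiv a b ?K \<phi> (x - z)) \<le> C' * \<rho> * norm (x - z)"
      if "\<rho> \<le> r" "x \<in> L1_ball a b \<phi> \<rho>" "z \<in> L1_ball a b \<phi> \<rho>" for \<rho> x z
      using fderiv_linearization[OF P22(1) _ \<phi>X that] P22(3) mono[OF _ that(2), of "M\<^sub>2" z]
      by (auto simp: C'_def intro: order_trans)
    show "norm (?Kn n x - ?Kn n z - fderiv a b (?Kn n) \<phi> (x - z)) \<le> C' * \<rho> * norm (x - z)"
      if "n\<^sub>1 \<le> n" "\<rho> \<le> r" "x \<in> L1_ball a b \<phi> \<rho>" "z \<in> L1_ball a b \<phi> \<rho>" for n \<rho> x z
      using fderiv_linearization[of a b "?Kn n" \<phi> r C\<^sub>2, OF _ _ \<phi>X that(2-4)] P23(1) n\<^sub>2 n\<^sub>1[OF that(1)]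
        mono[OF _ that(3), of "C\<^sub>2" z]
      by (auto simp: C'_def intro: order_trans)
    show "?Kn n x \<in> L1_on a b" for n x unfolding op_Kn_def by (rule class_on_in_L1_on)
    show "norm (fderiv a b (?Kn n) \<phi>) \<le> C\<^sub>1" if "n\<^sub>1 \<le> n" for n using P23(2) n\<^sub>1[OF that] by blast
    show "\<exists>P. finite_rank P \<and> range P \<subseteq> L1_on a b \<and> (\<forall>x. norm (P x - x) \<le> 6 * norm x) \<and>
      (\<forall>n\<ge>n\<^sub>1. \<forall>x\<in>L1_ball a b \<phi> r. norm (P (?Kn n x) - ?Kn n x) \<le> \<eta>)" if "\<eta> > 0" for \<eta>
      using approx[OF that] unfolding ball_eq .
  qed (use subspace_L1_on closed_L1_on \<phi>X \<phi>fix \<open>y \<in> L1_on a b\<close> \<open>r > 0\<close> \<open>M\<^sub>2 > 0\<close> K_conv no_eigenvector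
      in \<open>auto simp: C'_def\<close>)

  from fixed_points[unfolded ball_eq] obtain \<epsilon> \<gamma> n\<^sub>0 where \<epsilon>: "\<epsilon> > 0" "\<epsilon> < r"
    and iso: "\<And>x. x \<in> L1_ball a b \<phi> \<epsilon> \<Longrightarrow> ?K x - y = x \<Longrightarrow> x = \<phi>" and \<gamma>: "\<gamma> > 0"
    and sol: "\<And>n. n \<ge> n\<^sub>0 \<Longrightarrow> \<exists>x. (\<forall>z. z \<in> L1_ball a b \<phi> \<epsilon> \<and> ?Kn n z - y = z \<longleftrightarrow> z = x) \<and>
      norm (\<phi> - x) \<le> \<gamma> * norm (?Kn n \<phi> - ?K \<phi>)" by blast
  have isolated: "isolated_fixed_point_in \<Omega> (op_U a b H L N y) \<phi>"
    unfolding isolated_fixed_point_in_def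
  proof (intro conjI exI[of _ "ball \<phi> \<epsilon>"] ballI impI)
    fix z assume "z \<in> ball \<phi> \<epsilon>" "fixed_point_in \<Omega> (op_U a b H L N y) z"
    then show "z = \<phi>"
      using \<open>\<Omega> \<subseteq> L1_on a b\<close> by (intro iso) (auto simp: fixed_point_in_def op_U_def L1_ball_def)
  qed (use \<epsilon> \<open>fixed_point_in \<Omega> (op_U a b H L N y) \<phi>\<close> in auto)

  \<comment> \<open>The mean value inequality between \<phi> and its cell mean needs both in the
    ball.\<close>
  have "\<forall>\<^sub>F n in sequentially. dist (cell_mean a b n \<phi>) \<phi> < r"
    using cell_mean_tendsto[OF ab \<phi>X] \<open>r > 0\<close> by (rule tendstoD)
  then obtain n\<^sub>3 where n\<^sub>3: "\<And>n. n \<ge> n\<^sub>3 \<Longrightarrow> dist (cell_mean a b n \<phi>) \<phi> < r"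
    unfolding eventually_sequentially by blast
  define bnd where "bnd n = 2 * w2 a b L (mesh a b n) * m\<^sub>0 + 2 * M\<^sub>1 * w1 a b \<phi> (mesh a b n) +
               2 * M\<^sub>2 * (w1 a b \<phi> (mesh a b n))\<^sup>2" for n
  \<comment> \<open>The consistency error carries the factor \<open>c\<^sub>H * M\<close> where the
    required bound has \<open>m\<^sub>0\<close>; the quotient converts one into the other.\<close>
  define \<gamma>' where "\<gamma>' = 1 + c\<^sub>H * M / m\<^sub>0"
  have cM: "c\<^sub>H * M / m\<^sub>0 \<ge> 0" using c\<^sub>H_nonneg \<open>M > 0\<close> \<open>m\<^sub>0 > 0\<close> by simp
  have err: "norm (?Kn n \<phi> - ?K \<phi>) \<le> \<gamma>' * bnd n" if n: "n \<ge> max 1 n\<^sub>3" for n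
  proof -
    let ?w = "w2 a b L (mesh a b n)" and ?v = "w1 a b \<phi> (mesh a b n)"
    have n1: "n \<ge> 1" using n by simp
    have \<pi>: "cell_mean a b n \<phi> \<in> L1_ball a b \<phi> r"
      using n\<^sub>3[of n] n by (simp add: L1_ball_def cell_mean_in_L1_on dist_commute)
    have "norm (?K (cell_mean a b n \<phi>) - ?K \<phi>) \<le> M\<^sub>1 * norm (cell_mean a b n \<phi> - \<phi>)"
    proof (rule differentiable_bound[OF convex_L1_ball _ _ \<pi> \<phi>ball])
      show "(?K has_derivative blinfun_apply (fderiv a b ?K x)) (at x within L1_ball a b \<phi> r)"
        if "x \<in> L1_ball a b \<phi> r" for x
        by (rule has_fderiv_has_derivative[OF has_fderiv_fderiv(1)[OF P22(1) that]]) (auto simp: L1_ball_def)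
    qed (use P22(2) in \<open>auto simp: norm_blinfun.rep_eq[symmetric]\<close>)
    also have "\<dots> \<le> M\<^sub>1 * (2 * ?v)"
      using norm_cell_mean_diff_le[OF ab n1 \<phi>X] \<open>M\<^sub>1 > 0\<close> by (intro mult_left_mono) auto
    finally have "norm (?Kn n \<phi> - ?K \<phi>) \<le> c\<^sub>H * ?w * M + 2 * M\<^sub>1 * ?v"
      using Kn_consistent[OF n1 \<phi>ball]
        norm_triangle_ineq[of "?Kn n \<phi> - ?K (cell_mean a b n \<phi>)" "?K (cell_mean a b n \<phi>) - ?K \<phi>"] by simp
    also have "\<dots> \<le> c\<^sub>H * M / m\<^sub>0 * bnd n + bnd n"
    proof (rule add_mono)
      have nn: "0 \<le> M\<^sub>1 * ?v" "0 \<le> M\<^sub>2 * ?v\<^sup>2" "0 \<le> ?w * m\<^sub>0"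
        using w2_pos w1_nonneg \<open>M\<^sub>1 > 0\<close> \<open>M\<^sub>2 > 0\<close> \<open>m\<^sub>0 > 0\<close> by simp_all
      then show "2 * M\<^sub>1 * ?v \<le> bnd n" by (simp add: bnd_def)
      have eq: "c\<^sub>H * ?w * M = c\<^sub>H * M / m\<^sub>0 * (?w * m\<^sub>0)" using \<open>m\<^sub>0 > 0\<close> by simp
      have "bnd n - ?w * m\<^sub>0 = ?w * m\<^sub>0 + 2 * (M\<^sub>1 * ?v) + 2 * (M\<^sub>2 * ?v\<^sup>2)"
        by (simp add: bnd_def algebra_simps)
      then have "?w * m\<^sub>0 \<le> bnd n" using nn by linarith
      then have "c\<^sub>H * M / m\<^sub>0 * (?w * m\<^sub>0) \<le> c\<^sub>H * M / m\<^sub>0 * bnd n"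
        using cM by (rule mult_left_mono)
      then show "c\<^sub>H * ?w * M \<le> c\<^sub>H * M / m\<^sub>0 * bnd n" unfolding eq .
    qed
    finally show ?thesis by (simp add: \<gamma>'_def algebra_simps)
  qed

  define n\<^sub>\<epsilon> where "n\<^sub>\<epsilon> = max n\<^sub>0 (max 1 n\<^sub>3)"
  \<comment> \<open>Below \<open>n\<^sub>\<epsilon>\<close> the choice is arbitrary.\<close>
  define \<phi>s where "\<phi>s n = (SOME x. (\<forall>z. z \<in> L1_ball a b \<phi> \<epsilon> \<and> ?Kn n z - y = z \<longleftrightarrow> z = x) \<and>
      norm (\<phi> - x) \<le> \<gamma> * norm (?Kn n \<phi> - ?K \<phi>))" for n
  have \<phi>s: "(\<forall>z. z \<in> L1_ball a b \<phi> \<epsilon> \<and> ?Kn n z - y = z \<longleftrightarrow> z = \<phi>s n) \<and>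
      norm (\<phi> - \<phi>s n) \<le> \<gamma> * norm (?Kn n \<phi> - ?K \<phi>)" if "n \<ge> n\<^sub>\<epsilon>" for n
    unfolding \<phi>s_def by (rule someI_ex, rule sol) (use that in \<open>simp add: n\<^sub>\<epsilon>_def\<close>)
  have "\<forall>n\<ge>n\<^sub>\<epsilon>. \<forall>x. fixed_point_in (L1_ball a b \<phi> \<epsilon>) (op_Un a b H L N y n) x \<longleftrightarrow> x = \<phi>s n"
    using \<phi>s by (simp add: fixed_point_in_def op_Un_def)
  moreover have "\<forall>n\<ge>n\<^sub>\<epsilon>. norm (\<phi> - \<phi>s n) \<le> (\<gamma> * \<gamma>') * bnd n"
  proof (intro allI impI)
    fix n assume n: "n \<ge> n\<^sub>\<epsilon>"
    have "norm (\<phi> - \<phi>s n) \<le> \<gamma> * norm (?Kn n \<phi> - ?K \<phi>)" using \<phi>s[OF n] by blast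
    also have "\<dots> \<le> \<gamma> * (\<gamma>' * bnd n)"
      using err[of n] n \<gamma> by (intro mult_left_mono) (auto simp: n\<^sub>\<epsilon>_def)
    finally show "norm (\<phi> - \<phi>s n) \<le> (\<gamma> * \<gamma>') * bnd n" by (simp add: mult.assoc)
  qed
  moreover have "\<gamma> * \<gamma>' > 0" using \<gamma> cM by (simp add: \<gamma>'_def add_pos_nonneg)
  moreover have "0 < n\<^sub>\<epsilon>" by (simp add: n\<^sub>\<epsilon>_def)
  ultimately show ?thesis
    using isolated \<epsilon> unfolding bnd_def by blast
qed

end
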